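(* Fix $W,V$, $\kappa\ge0$, $\beta>0$ and $0<\alpha<1/2$. For $\rho\in\mathbb{R}$ put $\delta^-=\min_{[\rho-1,\rho+1]}W''$, $\delta^+=\max_{[\rho-1,\rho+1]}W''$, and let (H) be the condition on $\rho$: there are $a,b\in\mathbb{R}$ with $1/2+\alpha\le b-a<1$ such that $\kappa V'(x)\ge\delta^++\beta$ for all $x\in[a,b]$. For each $\tau>0$ let $v(\rho,\tau)$ be the transport speed for the $2\tau$-periodic step pulse $K$ equal to $0$ on $[2n\tau,(2n+1)\tau)$ and $\kappa$ on $[(2n+1)\tau,(2n+2)\tau)$, $n\in\mathbb{Z}$. Let $c=(\delta^+)^{1/4}/\left(6^{1/8}(\delta^-)^{3/8}\right)$ and $\gamma_L=\exp(\pi^2/(12\ln2))$. Then: (i) Let $\rho=p_0/q_0$ be rational satisfying (H), with $p_0,q_0$ relatively prime and $q_0\ge2$. If $\alpha>\frac1{\sqrt{q_0}}-\frac1{2q_0}$, then there exists $\tau_0$ such that $v(\rho,\tau)>0$ for all $\tau>\tau_0$, and $$\liminf_{\tau\to\infty}\frac{2v(\rho,\tau)\tau}{\alpha-1/\sqrt{q_0}+1/(2q_0)}\ge1.$$ (ii) For every irrational $\rho$ satisfying (H), $v(\rho,\tau)>0$ for all sufficiently large $\tau$, and there is a sequence $\tau_n\to\infty$ such that $$v(\rho,\tau_n)\ge\frac\alpha2\tau_n^{-1}-c\,\tau_n^{-9/8}+\mathcal{O}\left(\tau_n^{-5/4}\right)\quad\text{as }n\to\infty.$$ (iii) There exists a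 subset $R\subset\mathbb{R}$ of full Lebesgue measure such that for all $\rho\in R$ satisfying (H) and all $\varepsilon>0$, $$v(\rho,\tau)\ge\frac\alpha2\tau^{-1}-c\left(\frac{\gamma_L+1}{2}\right)^{1/2}(1+\varepsilon)\tau^{-9/8}+\mathcal{O}\left(\tau^{-5/4}\right)\quad\text{as }\tau\to\infty,$$ where the implicit constant depends on $\varepsilon,\rho$.
   Context: Standing assumptions: $W,V:\mathbb{R}\to\mathbb{R}$ are $C^2$; $W''$ is positive and bounded away from zero; $V(x+1)=V(x)$ for all $x$. The dynamics is, for $k\in\mathbb{Z}$, $$\frac{d}{dt}u_k(t)=W'(u_{k+1}-u_k)-W'(u_k-u_{k-1})+K(t)V'(u_k).$$ A configuration $u\in\mathbb{R}^{\mathbb{Z}}$ has bounded width with mean spacing $\rho$ and constant $n$ (a positive integer) if $|u_{j+k}-u_j-k\rho|\le n$ for all $j,k\in\mathbb{Z}$, $k\ge1$. The transport speed $v(\rho)=v(\rho,\tau)$ is the unique number such that for every solution $u(t)$ whose initial configuration $u(t_0)$ has bounded width with mean spacing $\rho$ and constant $n$, and all $k,m\in\mathbb{Z}$, $m\ge1$, one has $\left|\frac{u_k(t_0+2m\tau)-u_k(t_0)}{2m\tau}-v(\rho)\right|\le\frac{n+2}{2m\tau}$. In the asymptotic statements all data other than $\tau$ are fixed. *)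

theory Defs
  imports "HOL-Analysis.Analysis" "HOL-Library.Landau_Symbols"
begin

definition C2 :: "(real \<Rightarrow> real) \<Rightarrow> bool" where
  "C2 f \<longleftrightarrow> (\<forall>x. f differentiable (at x)) \<and> (\<forall>x. deriv f differentiable (at x))
             \<and> continuous_on UNIV (deriv (deriv f))"

text \<open>
  The trajectory is written \<open>u t k\<close>, with time \<open>t\<close> and particle index \<open>k\<close>. Two conventions:
  as \<open>K\<close> may jump, the differential equation is imposed at the times where \<open>K\<close> is continuous and
  each \<open>u\<^sub>k\<close> is required to be continuous throughout (for a step pulse this is the
  usual notion of a piecewise classical solution). Moreover the spacings must stay bounded,
  uniformly in \<open>k\<close> and locally uniformly in time. This is the state space in which the infinite
  system is well posed: without it, already the discrete heat equation has non-unique solutions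
  of Tychonoff type, and no transport speed would exist.
\<close>

definition is_solution ::
  "(real \<Rightarrow> real) \<Rightarrow> (real \<Rightarrow> real) \<Rightarrow> (real \<Rightarrow> real) \<Rightarrow> real \<Rightarrow> (real \<Rightarrow> int \<Rightarrow> real) \<Rightarrow> bool" where
  "is_solution W V K t\<^sub>0 u \<longleftrightarrow>
     (\<forall>k. continuous_on {t\<^sub>0..} (\<lambda>t. u t k)) \<and>
     (\<forall>k. \<forall>t>t\<^sub>0. isCont K t \<longrightarrow>
        ((\<lambda>s. u s k) has_real_derivative
           (deriv W (u t (k + 1) - u t k) - deriv W (u t k - u t (k - 1)) + K t * deriv V (u t k)))
        (at t)) \<and>
     (\<forall>T. \<exists>M. \<forall>t\<in>{t\<^sub>0..T}. \<forall>k. \<bar>u t (k + 1) - u t k\<bar> \<le> M)"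

definition bounded_width :: "real \<Rightarrow> nat \<Rightarrow> (int \<Rightarrow> real) \<Rightarrow> bool" where
  "bounded_width \<rho> n u \<longleftrightarrow> (\<forall>j k. k \<ge> 1 \<longrightarrow> \<bar>u (j + k) - u j - of_int k * \<rho>\<bar> \<le> real n)"

definition is_transport_speed ::
  "(real \<Rightarrow> real) \<Rightarrow> (real \<Rightarrow> real) \<Rightarrow> (real \<Rightarrow> real) \<Rightarrow> real \<Rightarrow> real \<Rightarrow> real \<Rightarrow> bool" where
  "is_transport_speed W V K \<tau> \<rho> v \<longleftrightarrow>
     (\<forall>n t\<^sub>0 u. n \<ge> 1 \<longrightarrow> is_solution W V K t\<^sub>0 u \<longrightarrow> bounded_width \<rho> n (u t\<^sub>0) \<longrightarrow>
        (\<forall>k m :: int. m \<ge> 1 \<longrightarrow>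
           \<bar>(u (t\<^sub>0 + 2 * of_int m * \<tau>) k - u t\<^sub>0 k) / (2 * of_int m * \<tau>) - v\<bar>
             \<le> (real n + 2) / (2 * of_int m * \<tau>)))"

definition transport_speed ::
  "(real \<Rightarrow> real) \<Rightarrow> (real \<Rightarrow> real) \<Rightarrow> (real \<Rightarrow> real) \<Rightarrow> real \<Rightarrow> real \<Rightarrow> real" where
  "transport_speed W V K \<tau> \<rho> = (THE v. is_transport_speed W V K \<tau> \<rho> v)"

text \<open>For \<open>\<tau> > 0\<close> the intervals below and their complements \<open>[(2n+1)\<tau>, (2n+2)\<tau>)\<close> partition the line.\<close>

definition step_pulse :: "real \<Rightarrow> real \<Rightarrow> real \<Rightarrow> real" where
  "step_pulse \<kappa> \<tau> t =
     (if \<exists>n::int. t \<in> {2 * of_int n * \<tau> ..< (2 * of_int n + 1) * \<tau>} then 0 else \<kappa>)"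

definition pulse_speed ::
  "(real \<Rightarrow> real) \<Rightarrow> (real \<Rightarrow> real) \<Rightarrow> real \<Rightarrow> real \<Rightarrow> real \<Rightarrow> real" where
  "pulse_speed W V \<kappa> \<rho> \<tau> = transport_speed W V (step_pulse \<kappa> \<tau>) \<tau> \<rho>"

text \<open>The extrema are attained when \<open>W''\<close> is continuous.\<close>

definition delta_minus :: "(real \<Rightarrow> real) \<Rightarrow> real \<Rightarrow> real" where
  "delta_minus W \<rho> = (INF x\<in>{\<rho> - 1..\<rho> + 1}. deriv (deriv W) x)"

definition delta_plus :: "(real \<Rightarrow> real) \<Rightarrow> real \<Rightarrow> real" where
  "delta_plus W \<rho> = (SUP x\<in>{\<rho> - 1..\<rho> + 1}. deriv (deriv W) x)"

definition cond_H ::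
  "(real \<Rightarrow> real) \<Rightarrow> (real \<Rightarrow> real) \<Rightarrow> real \<Rightarrow> real \<Rightarrow> real \<Rightarrow> real \<Rightarrow> bool" where
  "cond_H W V \<kappa> \<beta> \<alpha> \<rho> \<longleftrightarrow>
     (\<exists>a b. 1 / 2 + \<alpha> \<le> b - a \<and> b - a < 1 \<and>
        (\<forall>x\<in>{a..b}. \<kappa> * deriv V x \<ge> delta_plus W \<rho> + \<beta>))"

definition c_const :: "(real \<Rightarrow> real) \<Rightarrow> real \<Rightarrow> real" where
  "c_const W \<rho> =
     delta_plus W \<rho> powr (1 / 4) / (6 powr (1 / 8) * delta_minus W \<rho> powr (3 / 8))"

definition gamma_L :: real where
  "gamma_L = exp (pi\<^sup>2 / (12 * ln 2))"

end

theory Submission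
  imports Defs
begin

text \<open>
  Why the pulse moves the chain. Consider one period of a solution whose spacings are nearly uniform
  when the pulse switches on. On the arc \<open>[a, b]\<close> of the circle the force
  \<open>\<kappa> V'\<close> exceeds the largest backward pull \<open>\<delta>\<^sup>+\<close> of the neighbours by at least \<open>\<beta>\<close>. For long pulses a
  particle at phase \<open>y = frac (u - a)\<close> therefore ends at or beyond \<open>b\<close>, that is, it advances by at least
  \<open>b - a - y\<close>; this number may be negative, but its mean over equidistributed phases is
  \<open>b - a - 1/2 \<ge> \<alpha>\<close>. While the pulse is off, the mean position changes only through the ends of a block
  of particles. Hence the displacement per period \<open>2 \<tau> v\<close> is at least \<open>\<alpha>\<close> minus a loss that measures
  how far the phases are from being equidistributed.

  The loss. While the pulse is off, the chain relaxes towards uniform spacing: with \<open>W'' \<ge> d\<close>, an energy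
  estimate (\<open>relaxation_estimate\<close>) bounds the mean square of \<open>u\<^sub>k\<^sub>+\<^sub>1 - u\<^sub>k - \<rho>\<close> by \<open>1 / (2 d \<tau>)\<close>
  up to boundary terms. If \<open>p\<close> and \<open>q\<close> are coprime, the phases of \<open>q\<close> consecutive particles then lie
  near a translate of the lattice \<open>{0, 1/q, ..., (q-1)/q}\<close>, and \<open>sum_frac_near_lattice_le\<close> turns
  this into a bound for their sum. Averaging over long blocks and many periods gives, uniformly in
  \<open>p\<close>, \<open>q\<close> and for all large \<open>\<tau>\<close> (\<open>transport_speed_lower_bound\<close>),
  \<open>2 \<tau> v \<ge> \<alpha> - 1 / (2 q) - 2 |q \<rho> - p| - 2 q / sqrt (2 d \<tau>)\<close>.

  The three claims follow by choosing \<open>q\<close>. For \<open>\<rho> = p\<^sub>0/q\<^sub>0\<close> take \<open>q = q\<^sub>0\<close>; the second error vanishes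
  and \<open>1/(2 q\<^sub>0) \<le> 1/\<surd>q\<^sub>0 - 1/(2 q\<^sub>0)\<close>. For irrational \<open>\<rho>\<close> there are arbitrarily large \<open>q\<close> with
  \<open>|q \<rho> - p| < 1/q\<close>; a fixed such \<open>q\<close> gives positivity, and \<open>\<tau> = q\<^sup>4\<close> makes the whole loss of order
  \<open>\<tau> powr (-1/4)\<close>. For almost every \<open>\<rho>\<close> there is \<open>c > 0\<close>
  with \<open>|q \<rho> - p| \<ge> c / q\<^sup>2\<close> for all \<open>p\<close> and \<open>q \<ge> 1\<close>, so Dirichlet's
  theorem with bound \<open>N\<close>, about \<open>\<tau> powr (5/16)\<close>, yields a denominator between a multiple of \<open>\<surd>N\<close> and \<open>N\<close>,
  and the loss is of order \<open>\<tau> powr (-5/32)\<close>. In both cases the loss is \<open>o(\<tau> powr (-1/8))\<close>, hence eventually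
  below any positive multiple of \<open>\<tau> powr (-1/8)\<close>; the remainder may then be taken to be zero.

  All this presupposes that the transport speed exists. A weighted comparison principle
  (\<open>comparison_principle\<close>) shows that the flow preserves the order of configurations. The solution
  that starts from \<open>u\<^sub>k = k \<rho>\<close> is then comparable with each of its integer translates for all time,
  so its width stays at most one, and its displacements are quasi-additive over periods. This gives
  the speed and, by comparison again, the bound for every other solution.
\<close>

section \<open>The comparison principle\<close>

text \<open>
  The right-hand side for a general bond force \<open>f\<close> and substrate force \<open>g\<close>. Existence is first proved
  for a truncated bond force, so \<open>f\<close> cannot simply be \<open>W'\<close>.
\<close>

definition drift :: "(real \<Rightarrow> real) \<Rightarrow> (real \<Rightarrow> real) \<Rightarrow> real \<Rightarrow> (int \<Rightarrow> real) \<Rightarrow> int \<Rightarrow> real" where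
  "drift f g c x k = f (x (k + 1) - x k) - f (x k - x (k - 1)) + c * g (x k)"

text \<open>
  One phase of the pulse, where its value is a constant \<open>c\<close>. The equation is imposed only in the open
  interval: continuity up to the endpoints carries the information across the jumps.
\<close>

definition solves_on ::
  "(real \<Rightarrow> real) \<Rightarrow> (real \<Rightarrow> real) \<Rightarrow> real \<Rightarrow> real \<Rightarrow> real \<Rightarrow> (real \<Rightarrow> int \<Rightarrow> real) \<Rightarrow> bool" where
  "solves_on f g c s\<^sub>0 s\<^sub>1 u \<longleftrightarrow>
     (\<forall>k. continuous_on {s\<^sub>0..s\<^sub>1} (\<lambda>t. u t k)) \<and>
     (\<forall>k. \<forall>t\<in>{s\<^sub>0<..<s\<^sub>1}. ((\<lambda>s. u s k) has_real_derivative drift f g c (u t) k) (at t))"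

lemma linear_growth_of_bounded_increments:
  fixes x :: "int \<Rightarrow> real"
  assumes "\<And>k. \<bar>x (k + 1) - x k\<bar> \<le> M"
  shows "\<bar>x k - x 0\<bar> \<le> M * \<bar>of_int k\<bar>"
proof (induction k rule: int_induct[where k = 0])
  case base
  then show ?case by simp
next
  case (step1 i)
  have "\<bar>x (i + 1) - x 0\<bar> \<le> \<bar>x (i + 1) - x i\<bar> + \<bar>x i - x 0\<bar>" by linarith
  then show ?case using step1 assms[of i] by (simp add: algebra_simps)
next
  case (step2 i)
  have "\<bar>x (i - 1) - x 0\<bar> \<le> \<bar>x i - x (i - 1)\<bar> + \<bar>x i - x 0\<bar>" by linarith
  then show ?case using step2 assms[of "i - 1"] by (simp add: algebra_simps)
qed

lemma quadratic_dominates_linear: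
  fixes D M \<epsilon> :: real
  assumes "\<epsilon> > 0" "D \<ge> 0" "M \<ge> 0"
  shows "\<exists>R::int. \<forall>k::int. \<bar>k\<bar> > R \<longrightarrow> D + M * \<bar>of_int k\<bar> < \<epsilon> * (1 + (of_int k)\<^sup>2)"
proof -
  obtain R :: int where R: "(D + M) / \<epsilon> \<le> of_int R"
    using ex_le_of_int by blast
  have "D + M * \<bar>of_int k\<bar> < \<epsilon> * (1 + (of_int k)\<^sup>2)" if k: "\<bar>k\<bar> > max 1 R" for k :: int
  proof -
    let ?x = "\<bar>of_int k :: real\<bar>"
    have x1: "?x \<ge> 1" using k by linarith
    have "(D + M) / \<epsilon> \<le> ?x" using R k by linarith
    then have "D + M \<le> \<epsilon> * ?x" using assms by (simp add: field_simps)
    then have "(D + M) * ?x \<le> \<epsilon> * ?x * ?x" using x1 by (intro mult_right_mono) auto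
    moreover have "D \<le> D * ?x" using x1 assms mult_left_mono[of 1 ?x D] by simp
    moreover have "\<epsilon> * ?x * ?x = \<epsilon> * (of_int k)\<^sup>2" by (simp add: power2_eq_square)
    ultimately show ?thesis using assms by (simp add: algebra_simps)
  qed
  then show ?thesis by blast
qed

text \<open>
  The difference \<open>w - u\<close> solves a linear discrete heat equation with bounded coefficients, and bounded
  spacings force it to grow at most linearly in \<open>k\<close>. Adding \<open>\<epsilon> exp (\<mu> t) (1 + k\<^sup>2)\<close> makes it positive for
  large \<open>|k|\<close>, uniformly in time, so a first zero would be attained at some particle. There the neighbours
  can pull it down only at a rate that \<open>\<mu>\<close> compensates, which excludes the zero. Then \<open>\<epsilon>\<close> tends to zero.
\<close>

lemma comparison_principle:
  fixes f g :: "real \<Rightarrow> real" and u w :: "real \<Rightarrow> int \<Rightarrow> real"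
  assumes u: "solves_on f g c s\<^sub>0 s\<^sub>1 u" and w: "solves_on f g c s\<^sub>0 s\<^sub>1 w"
    and spu: "\<And>t k. t \<in> {s\<^sub>0..s\<^sub>1} \<Longrightarrow> \<bar>u t (k + 1) - u t k\<bar> \<le> M"
    and spw: "\<And>t k. t \<in> {s\<^sub>0..s\<^sub>1} \<Longrightarrow> \<bar>w t (k + 1) - w t k\<bar> \<le> M"
    and f_mono: "mono f"
    and f_lip: "\<And>x y. \<bar>x\<bar> \<le> M \<Longrightarrow> \<bar>y\<bar> \<le> M \<Longrightarrow> \<bar>f x - f y\<bar> \<le> A * \<bar>x - y\<bar>"
    and g_lip: "\<And>x y. \<bar>g x - g y\<bar> \<le> L * \<bar>x - y\<bar>"
    and A: "A \<ge> 0" and L: "L \<ge> 0"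
    and init: "\<And>k. u s\<^sub>0 k \<le> w s\<^sub>0 k"
    and t: "t \<in> {s\<^sub>0..s\<^sub>1}"
  shows "u t k \<le> w t k"
proof -
  define d where "d = (\<lambda>t k. w t k - u t k)"
  \<comment> \<open>As long as \<open>\<psi>\<close> is positive at all particles, it decays at relative rate at most \<open>B\<close>; \<open>\<mu>\<close> absorbs the
    differences of the weight \<open>1 + k\<^sup>2\<close> between neighbours, which are at most twice the weight.\<close>
  define B where "B = 2 * A + \<bar>c\<bar> * L"
  define \<mu> where "\<mu> = 4 * A + \<bar>c\<bar> * L"
  define E where "E = (\<lambda>\<epsilon> t. \<epsilon> * exp (\<mu> * (t - s\<^sub>0)))"
  define \<psi> where "\<psi> = (\<lambda>\<epsilon> t k. d t k + E \<epsilon> t * (1 + (of_int k)\<^sup>2))"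
  have B0: "B \<ge> 0" and l0: "\<mu> \<ge> 0" unfolding B_def \<mu>_def using A L by auto
  have M0: "M \<ge> 0" using spu[OF t, of 0] by linarith
  have cont_d: "continuous_on {s\<^sub>0..s\<^sub>1} (\<lambda>t. d t k)" for k
    using u w unfolding d_def solves_on_def by (intro continuous_intros) auto
  have cont_psi: "continuous_on {s\<^sub>0..s\<^sub>1} (\<lambda>t. \<psi> \<epsilon> t k)" for \<epsilon> k
    unfolding \<psi>_def E_def by (intro continuous_intros cont_d)
  have bdd: "bounded ((\<lambda>t. d t 0) ` {s\<^sub>0..s\<^sub>1})"
    by (intro compact_imp_bounded compact_continuous_image cont_d) auto
  obtain D where D: "\<And>t. t \<in> {s\<^sub>0..s\<^sub>1} \<Longrightarrow> \<bar>d t 0\<bar> \<le> D"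
    using bdd unfolding bounded_iff real_norm_def by (metis imageI)
  have D0: "D \<ge> 0" using D[OF t] by linarith
  have grow: "\<bar>d t k\<bar> \<le> D + 2 * M * \<bar>of_int k\<bar>" if t: "t \<in> {s\<^sub>0..s\<^sub>1}" for t k
  proof -
    have "\<bar>d t k - d t 0\<bar> \<le> 2 * M * \<bar>of_int k\<bar>"
    proof (rule linear_growth_of_bounded_increments)
      fix k show "\<bar>d t (k + 1) - d t k\<bar> \<le> 2 * M"
        using spu[OF t, of k] spw[OF t, of k] unfolding d_def by linarith
    qed
    then show ?thesis using D[OF t] by linarith
  qed
  have pos: "\<psi> \<epsilon> t k > 0" if \<epsilon>: "\<epsilon> > 0" and t: "t \<in> {s\<^sub>0..s\<^sub>1}" for \<epsilon> t k
  proof (rule ccontr)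
    assume neg: "\<not> \<psi> \<epsilon> t k > 0"
    have Eeps: "E \<epsilon> t \<ge> \<epsilon>" if "t \<in> {s\<^sub>0..s\<^sub>1}" for t
      using \<epsilon> l0 that unfolding E_def by (simp add: mult_le_cancel_left1)
    obtain R :: int where R: "\<And>k::int. \<bar>k\<bar> > R \<Longrightarrow> D + 2 * M * \<bar>of_int k\<bar> < \<epsilon> * (1 + (of_int k)\<^sup>2)"
      using quadratic_dominates_linear[OF \<epsilon> D0, of "2 * M"] M0 by auto
    have far: "\<psi> \<epsilon> t k > 0" if "\<bar>k\<bar> > R" "t \<in> {s\<^sub>0..s\<^sub>1}" for t k
    proof -
      have "\<epsilon> * (1 + (of_int k)\<^sup>2) \<le> E \<epsilon> t * (1 + (of_int k)\<^sup>2)"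
        by (intro mult_right_mono Eeps that) auto
      then show ?thesis using R[OF that(1)] grow[OF that(2), of k] unfolding \<psi>_def by linarith
    qed
    define Bad where "Bad = (\<Union>k\<in>{-R..R}. {s\<^sub>0..s\<^sub>1} \<inter> (\<lambda>t. \<psi> \<epsilon> t k) -` {..0})"
    have "closed Bad" unfolding Bad_def
      by (intro closed_UN continuous_closed_preimage[OF cont_psi] closed_atMost closed_real_atLeastAtMost ballI) auto
    moreover have "Bad \<subseteq> {s\<^sub>0..s\<^sub>1}" unfolding Bad_def by auto
    ultimately have "compact Bad"
      using closed_Int_compact[of Bad] by (metis compact_Icc inf.absorb1)
    have inBad: "t \<in> Bad" if "t \<in> {s\<^sub>0..s\<^sub>1}" "\<not> \<psi> \<epsilon> t k > 0" for t k
      proof -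
      have "\<bar>k\<bar> \<le> R" using far[of k t] that by force
      then have "k \<in> {-R..R}" by auto
      then show ?thesis using that unfolding Bad_def by (intro UN_I[of k]) auto
    qed
    have "Bad \<noteq> {}" using inBad[OF t neg] by auto
    from compact_attains_inf[OF \<open>compact Bad\<close> this]
    obtain t1 where t1: "t1 \<in> Bad" and least: "\<And>t. t \<in> Bad \<Longrightarrow> t1 \<le> t" by auto
    obtain k1 where k1: "\<psi> \<epsilon> t1 k1 \<le> 0" and t1s: "t1 \<in> {s\<^sub>0..s\<^sub>1}" using t1 unfolding Bad_def by auto
    have before: "\<psi> \<epsilon> t j > 0" if "t \<in> {s\<^sub>0..<t1}" for t j
      using inBad[of t j] least[of t] that t1s by fastforce
    have start: "\<psi> \<epsilon> s\<^sub>0 k1 > 0"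
      using init[of k1] \<epsilon> unfolding \<psi>_def d_def E_def
      by (simp add: add_nonneg_pos pos_add_strict add_pos_nonneg)
    \<comment> \<open>The factor \<open>exp (B (t - s\<^sub>0))\<close> compensates the decay of \<open>\<psi>\<close> up to the first zero, where a contradiction arises.\<close>
    define h where "h = (\<lambda>t. \<psi> \<epsilon> t k1 * exp (B * (t - s\<^sub>0)))"
    have "h s\<^sub>0 \<le> h t1"
    proof (rule DERIV_nonneg_imp_increasing_open[of s\<^sub>0 t1 h])
      show "s\<^sub>0 \<le> t1" using t1s by auto
      show "continuous_on {s\<^sub>0..t1} h" unfolding h_def
        by (intro continuous_intros continuous_on_subset[OF cont_psi]) (use t1s in auto)
      fix t assume t: "s\<^sub>0 < t" "t < t1"
      then have ts: "t \<in> {s\<^sub>0<..<s\<^sub>1}" and tc: "t \<in> {s\<^sub>0..s\<^sub>1}" using t1s by auto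
      define Q where "Q = 1 + (of_int k1 :: real)\<^sup>2"
      define d' where "d' = drift f g c (w t) k1 - drift f g c (u t) k1"
      have Dpsi: "((\<lambda>t. \<psi> \<epsilon> t k1) has_real_derivative d' + \<mu> * E \<epsilon> t * Q) (at t)"
        unfolding \<psi>_def d_def E_def d'_def Q_def
        using u w ts unfolding solves_on_def
        by (auto intro!: derivative_eq_intros)
      have Dh: "(h has_real_derivative
         (d' + \<mu> * E \<epsilon> t * Q + B * \<psi> \<epsilon> t k1) * exp (B * (t - s\<^sub>0))) (at t)"
        unfolding h_def
        by (rule derivative_eq_intros Dpsi refl | simp add: algebra_simps)+
      have Et: "E \<epsilon> t > 0" using \<epsilon> unfolding E_def by simp
      have Q1: "Q \<ge> 1" unfolding Q_def by simp
      have psi_t: "\<psi> \<epsilon> t k1 = d t k1 + E \<epsilon> t * Q" unfolding \<psi>_def Q_def by simp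
      have p0: "\<psi> \<epsilon> t k1 > 0" using before t by auto
      have neigh: "d t k1 - d t j \<le> \<psi> \<epsilon> t k1 + 2 * (E \<epsilon> t * Q)" if "j = k1 + 1 \<or> j = k1 - 1" for j
      proof -
        have "\<psi> \<epsilon> t j > 0" using before t by auto
        moreover have sq: "1 + (of_int j)\<^sup>2 \<le> 3 * Q"
        proof -
          define x where "x = (of_int k1 :: real)"
          have "3 * Q - (1 + (x + 1)\<^sup>2) = x\<^sup>2 + (x - 1)\<^sup>2"
            "3 * Q - (1 + (x - 1)\<^sup>2) = x\<^sup>2 + (x + 1)\<^sup>2"
            unfolding Q_def x_def by (simp_all add: power2_eq_square algebra_simps)
          moreover have "0 \<le> x\<^sup>2 + (x - 1)\<^sup>2" "0 \<le> x\<^sup>2 + (x + 1)\<^sup>2" by simp_all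
          ultimately have "1 + (x + 1)\<^sup>2 \<le> 3 * Q" "1 + (x - 1)\<^sup>2 \<le> 3 * Q" by linarith+
          then show ?thesis using that unfolding x_def by (elim disjE) simp_all
        qed
        then have "E \<epsilon> t * (1 + (of_int j)\<^sup>2) \<le> E \<epsilon> t * (3 * Q)"
          using Et sq by (intro mult_left_mono) auto
        ultimately show ?thesis unfolding psi_t by (simp add: \<psi>_def algebra_simps)
      qed
      have bond: "f X - f Y \<ge> - A * Z" if "X - Y \<ge> - Z" "Z \<ge> 0" "\<bar>X\<bar> \<le> M" "\<bar>Y\<bar> \<le> M" for X Y Z
      proof (cases "X \<ge> Y")
        case True
        then have "f Y \<le> f X" using f_mono by (simp add: monoD)
        moreover have "A * Z \<ge> 0" using A that by simp
        ultimately show ?thesis by simp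
      next
        case False
        have "\<bar>f X - f Y\<bar> \<le> A * \<bar>X - Y\<bar>" using f_lip that by blast
        also have "\<dots> \<le> A * Z" using A that False by (intro mult_left_mono) auto
        finally show ?thesis by simp
      qed
      define Z where "Z = \<psi> \<epsilon> t k1 + 2 * (E \<epsilon> t * Q)"
      have EQ: "E \<epsilon> t * Q > 0" using Et Q1 by simp
      have Z0: "Z \<ge> 0" using p0 EQ unfolding Z_def by simp
      have b1: "f (w t (k1 + 1) - w t k1) - f (u t (k1 + 1) - u t k1) \<ge> - A * Z"
        using neigh[of "k1 + 1"] spu[OF tc, of k1] spw[OF tc, of k1] Z0
        by (intro bond) (auto simp: Z_def d_def)
      have b2: "f (u t k1 - u t (k1 - 1)) - f (w t k1 - w t (k1 - 1)) \<ge> - A * Z"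
        using neigh[of "k1 - 1"] spu[OF tc, of "k1 - 1"] spw[OF tc, of "k1 - 1"] Z0
        by (intro bond) (auto simp: Z_def d_def)
      have "\<bar>d t k1\<bar> \<le> \<psi> \<epsilon> t k1 + E \<epsilon> t * Q" using p0 EQ unfolding psi_t by linarith
      then have "\<bar>g (w t k1) - g (u t k1)\<bar> \<le> L * (\<psi> \<epsilon> t k1 + E \<epsilon> t * Q)"
        using g_lip[of "w t k1" "u t k1"] L mult_left_mono[of "\<bar>d t k1\<bar>" _ L]
        unfolding d_def by fastforce
      then have "\<bar>c * (g (w t k1) - g (u t k1))\<bar> \<le> \<bar>c\<bar> * (L * (\<psi> \<epsilon> t k1 + E \<epsilon> t * Q))"
        unfolding abs_mult by (intro mult_left_mono) auto
      then have b3: "c * (g (w t k1) - g (u t k1)) \<ge> - \<bar>c\<bar> * L * (\<psi> \<epsilon> t k1 + E \<epsilon> t * Q)"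
        by (simp add: algebra_simps)
      have "d' \<ge> - 2 * A * Z - \<bar>c\<bar> * L * (\<psi> \<epsilon> t k1 + E \<epsilon> t * Q)"
        using b1 b2 b3 unfolding d'_def drift_def by (simp add: algebra_simps)
      moreover have "- 2 * A * Z - \<bar>c\<bar> * L * (\<psi> \<epsilon> t k1 + E \<epsilon> t * Q)
          + \<mu> * E \<epsilon> t * Q + B * \<psi> \<epsilon> t k1 = 0"
        unfolding Z_def \<mu>_def B_def by (simp add: algebra_simps)
      ultimately have "d' + \<mu> * E \<epsilon> t * Q + B * \<psi> \<epsilon> t k1 \<ge> 0" by linarith
      then show "\<exists>y. (h has_real_derivative y) (at t) \<and> 0 \<le> y"
        using Dh by (meson exp_ge_zero mult_nonneg_nonneg)
    qed
    moreover have "h s\<^sub>0 > 0" unfolding h_def using start by simp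
    moreover have "h t1 \<le> 0" unfolding h_def using k1 by (simp add: mult_nonpos_nonneg)
    ultimately show False by linarith
  qed
  have "d t k \<ge> 0"
  proof (rule field_le_epsilon)
    fix e :: real assume e: "e > 0"
    define \<epsilon> where "\<epsilon> = e / (exp (\<mu> * (t - s\<^sub>0)) * (1 + (of_int k)\<^sup>2))"
    have Qp: "1 + (of_int k :: real)\<^sup>2 > 0" by (simp add: add_pos_nonneg)
    then have "\<epsilon> > 0" unfolding \<epsilon>_def using e by simp
    moreover have "\<epsilon> * exp (\<mu> * (t - s\<^sub>0)) * (1 + (of_int k)\<^sup>2) = e"
      unfolding \<epsilon>_def using Qp by simp
    ultimately have "d t k + e > 0"
      using pos[OF _ t, of \<epsilon> k] unfolding \<psi>_def E_def by simp
    then show "0 \<le> d t k + e" by simp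
  qed
  then show ?thesis unfolding d_def by simp
qed

section \<open>Existence of solutions for bounded Lipschitz forces\<close>

lemma drift_lipschitz:
  assumes f: "\<And>x y. \<bar>f x - f y\<bar> \<le> A * \<bar>x - y\<bar>" and g: "\<And>x y. \<bar>g x - g y\<bar> \<le> L * \<bar>x - y\<bar>"
    and A: "A \<ge> 0" and L: "L \<ge> 0" and c: "\<bar>c\<bar> \<le> \<kappa>" and xy: "\<And>j. \<bar>x j - y j\<bar> \<le> b"
  shows "\<bar>drift f g c x k - drift f g c y k\<bar> \<le> (4 * A + \<kappa> * L) * b"
proof -
  have b0: "b \<ge> 0" using xy[of 0] by linarith
  have bond: "\<bar>f (x i - x j) - f (y i - y j)\<bar> \<le> A * (2 * b)" for i j
  proof -
    have "\<bar>(x i - x j) - (y i - y j)\<bar> \<le> 2 * b" using xy[of i] xy[of j] by linarith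
    then show ?thesis using f[of "x i - x j" "y i - y j"] mult_left_mono[OF _ A] by fastforce
  qed
  have "\<bar>g (x k) - g (y k)\<bar> \<le> L * b"
    using g[of "x k" "y k"] mult_left_mono[OF xy[of k] L] by linarith
  then have "\<bar>c * (g (x k) - g (y k))\<bar> \<le> \<kappa> * (L * b)"
    unfolding abs_mult using c by (intro mult_mono) auto
  then show ?thesis
    using bond[of "k + 1" k] bond[of k "k - 1"] unfolding drift_def
    by (simp add: algebra_simps)
qed

lemma continuous_on_atLeast_of_Icc:
  fixes h :: "real \<Rightarrow> real"
  assumes cont: "\<And>T. continuous_on {a..T} h"
  shows "continuous_on {a..} h"
  unfolding continuous_on_eq_continuous_within
proof
  fix t assume "t \<in> {a..}"
  then have "continuous (at t within {a..t + 1}) h"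
    using cont[of "t + 1"] by (simp add: continuous_on_eq_continuous_within)
  moreover have "at t within {a..t + 1} = at t within {a..}"
    by (rule at_within_nhd[of t "{..<t + 1}"]) auto
  ultimately show "continuous (at t within {a..}) h" by simp
qed

text \<open>
  Picard iteration for the integral equation. The forces are Lipschitz in the supremum norm over all
  particles, so in the time-weighted norm \<open>sup |v t k| exp (-2 \<Lambda> t)\<close> the Picard map halves distances and the
  iterates converge on the whole half line at once. Jumps of \<open>K\<close> are harmless in the integral, and the
  equation holds wherever \<open>K\<close> is continuous.
\<close>

lemma chain_solution_exists_for_bounded_lipschitz_forces:
  fixes f g K :: "real \<Rightarrow> real" and x\<^sub>0 :: "int \<Rightarrow> real"
  assumes f: "\<And>x y. \<bar>f x - f y\<bar> \<le> A * \<bar>x - y\<bar>" and g: "\<And>x y. \<bar>g x - g y\<bar> \<le> L * \<bar>x - y\<bar>"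
    and A: "A \<ge> 0" and L: "L \<ge> 0"
    and Bf: "\<And>x. \<bar>f x\<bar> \<le> F" and Bg: "\<And>x. \<bar>g x\<bar> \<le> G"
    and K_meas: "K \<in> borel_measurable borel" and K: "\<And>t. \<bar>K t\<bar> \<le> \<kappa>"
  shows "\<exists>u. (\<forall>k. u 0 k = x\<^sub>0 k) \<and> (\<forall>k. continuous_on {0..} (\<lambda>t. u t k)) \<and>
     (\<forall>k. \<forall>t>0. isCont K t \<longrightarrow>
        ((\<lambda>s. u s k) has_real_derivative drift f g (K t) (u t) k) (at t)) \<and>
     (\<forall>k. \<forall>t\<ge>0. \<bar>u t k - x\<^sub>0 k\<bar> \<le> (2 * F + \<kappa> * G) * t)"
proof -
  define B where "B = 2 * F + \<kappa> * G"
  \<comment> \<open>The summand \<open>1\<close> keeps \<open>\<Lambda>\<close> positive when both Lipschitz constants vanish.\<close>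
  define \<Lambda> where "\<Lambda> = 4 * A + \<kappa> * L + 1"
  define J where "J = (\<lambda>v k s. drift f g (K s) (v s) k)"
  define P where "P = (\<lambda>v t k. x\<^sub>0 k + integral {0..t} (J v k))"
  define cts where "cts = (\<lambda>v :: real \<Rightarrow> int \<Rightarrow> real. \<forall>k. continuous_on {0..} (\<lambda>t. v t k))"
  have F0: "F \<ge> 0" and G0: "G \<ge> 0" and kap0: "\<kappa> \<ge> 0" using Bf[of 0] Bg[of 0] K[of 0] by linarith+
  have B0: "B \<ge> 0" unfolding B_def using F0 G0 kap0 by simp
  have L0: "\<Lambda> > 0" unfolding \<Lambda>_def using A L kap0 by (simp add: add_nonneg_pos)
  have cont_f: "continuous_on UNIV f" if "\<And>x y. \<bar>f x - f y\<bar> \<le> A * \<bar>x - y\<bar>" "A \<ge> 0" for f :: "real \<Rightarrow> real" and A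
    by (rule lipschitz_on_continuous_on[of A]) (use that in \<open>auto simp: lipschitz_on_def dist_real_def\<close>)
  have J_bound: "\<bar>J v k s\<bar> \<le> B" for v k s
  proof -
    have "\<bar>K s * g (v s k)\<bar> \<le> \<kappa> * G" unfolding abs_mult using K Bg kap0 by (intro mult_mono) auto
    then show ?thesis using Bf[of "v s (k + 1) - v s k"] Bf[of "v s k - v s (k - 1)"]
      unfolding J_def drift_def B_def by linarith
  qed
  have J_int: "J v k integrable_on {a..b}" if v: "cts v" and a: "a \<ge> 0" for v k a b
  proof (rule measurable_bounded_by_integrable_imp_integrable[where g = "\<lambda>_. B"])
    have cv: "continuous_on {a..b} (\<lambda>t. v t j)" for j
      using v a unfolding cts_def by (auto intro: continuous_on_subset)
    have meas: "h \<in> borel_measurable (lebesgue_on {a..b})" if "continuous_on {a..b} h" for h :: "real \<Rightarrow> real"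
      by (rule continuous_imp_measurable_on_sets_lebesgue[OF that]) auto
    have "K \<in> borel_measurable (lebesgue_on {a..b})"
      using K_meas by (intro measurable_restrict_space1 measurable_completion) auto
    moreover have "(\<lambda>s. f (v s (k + 1) - v s k) - f (v s k - v s (k - 1))) \<in> borel_measurable (lebesgue_on {a..b})"
      by (intro meas continuous_intros continuous_on_compose2[OF cont_f[OF f A]] cv) auto
    moreover have "(\<lambda>s. g (v s k)) \<in> borel_measurable (lebesgue_on {a..b})"
      by (intro meas continuous_on_compose2[OF cont_f[OF g L]] cv) auto
    ultimately show "J v k \<in> borel_measurable (lebesgue_on {a..b})"
      unfolding J_def drift_def by measurable
  qed (use J_bound in auto)
  have P_cts: "cts (P v)" if v: "cts v" for v
    unfolding cts_def
  proof
    fix k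
    have "continuous_on {0..T} (\<lambda>t. P v t k)" for T
      unfolding P_def by (intro continuous_intros indefinite_integral_continuous_1 J_int v) auto
    then show "continuous_on {0..} (\<lambda>t. P v t k)" by (rule continuous_on_atLeast_of_Icc)
  qed
  have P_bound: "\<bar>P v t k - x\<^sub>0 k\<bar> \<le> B * t" if "t \<ge> 0" "cts v" for v t k
  proof -
    have "norm (integral {0..t} (J v k)) \<le> integral {0..t} (\<lambda>_. B)"
      by (rule integral_norm_bound_integral) (use that J_int J_bound in auto)
    then show ?thesis unfolding P_def using that by (simp add: mult.commute)
  qed
  have contract: "\<bar>P v t k - P v' t k\<bar> \<le> D / 2 * exp (2 * \<Lambda> * t)"
    if v: "cts v" "cts v'" and t: "t \<ge> 0" and D: "D \<ge> 0"
      and close: "\<And>s k. s \<ge> 0 \<Longrightarrow> \<bar>v s k - v' s k\<bar> \<le> D * exp (2 * \<Lambda> * s)" for v v' t k D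
  proof -
    have ptw: "\<bar>J v k s - J v' k s\<bar> \<le> \<Lambda> * (D * exp (2 * \<Lambda> * s))" if "s \<ge> 0" for s
    proof -
      have "\<bar>J v k s - J v' k s\<bar> \<le> (4 * A + \<kappa> * L) * (D * exp (2 * \<Lambda> * s))"
        unfolding J_def by (rule drift_lipschitz[OF f g A L K close[OF that]])
      also have "\<dots> \<le> \<Lambda> * (D * exp (2 * \<Lambda> * s))"
        unfolding \<Lambda>_def using D by (intro mult_right_mono) auto
      finally show ?thesis .
    qed
    have E: "((\<lambda>s. \<Lambda> * (D * exp (2 * \<Lambda> * s))) has_integral
        (D / 2 * exp (2 * \<Lambda> * t) - D / 2 * exp (2 * \<Lambda> * 0))) {0..t}"
    proof (rule fundamental_theorem_of_calculus[OF t])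
      fix x assume "x \<in> {0..t}"
      show "((\<lambda>s. D / 2 * exp (2 * \<Lambda> * s)) has_vector_derivative \<Lambda> * (D * exp (2 * \<Lambda> * x)))
          (at x within {0..t})"
        unfolding has_real_derivative_iff_has_vector_derivative[symmetric]
        by (auto intro!: derivative_eq_intros)
    qed
    have "norm (integral {0..t} (\<lambda>s. J v k s - J v' k s)) \<le> integral {0..t} (\<lambda>s. \<Lambda> * (D * exp (2 * \<Lambda> * s)))"
      by (rule integral_norm_bound_integral)
        (use ptw J_int v in \<open>auto intro!: integrable_diff has_integral_integrable[OF E]\<close>)
    also have "\<dots> \<le> D / 2 * exp (2 * \<Lambda> * t)" using integral_unique[OF E] D by simp
    finally show ?thesis unfolding P_def using integral_diff[OF J_int[of v 0 k t] J_int[of v' 0 k t]] v by simp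
  qed
  define it where "it = (\<lambda>n. (P ^^ n) (\<lambda>t k. x\<^sub>0 k))"
  have it_Suc: "it (Suc n) = P (it n)" for n unfolding it_def by simp
  have it_cts: "cts (it n)" for n
    by (induction n) (auto simp: it_Suc P_cts, simp add: it_def cts_def)
  \<comment> \<open>Chosen so that \<open>B t = D (2 \<Lambda> t) \<le> D exp (2 \<Lambda> t)\<close> bounds the first Picard step.\<close>
  define D where "D = B / (2 * \<Lambda>)"
  have D0: "D \<ge> 0" unfolding D_def using B0 L0 by simp
  have step: "\<bar>it (Suc n) t k - it n t k\<bar> \<le> D * (1/2) ^ n * exp (2 * \<Lambda> * t)" if "t \<ge> 0" for n t k
    using that
  proof (induction n arbitrary: t k)
    case 0
    have "\<bar>it (Suc 0) t k - it 0 t k\<bar> \<le> B * t"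
      using P_bound[OF 0 it_cts[of 0]] by (simp add: it_def)
    also have "\<dots> = D * (2 * \<Lambda> * t)" unfolding D_def using L0 by simp
    also have "\<dots> \<le> D * exp (2 * \<Lambda> * t)"
      using exp_ge_add_one_self[of "2 * \<Lambda> * t"] by (intro mult_left_mono D0) linarith
    finally show ?case by simp
  next
    case (Suc n)
    have "\<bar>it (Suc (Suc n)) t k - it (Suc n) t k\<bar> \<le> (D * (1/2) ^ n) / 2 * exp (2 * \<Lambda> * t)"
      unfolding it_Suc[of "Suc n"] it_Suc[of n]
      by (rule contract) (use Suc it_cts D0 in \<open>auto simp flip: it_Suc\<close>)
    then show ?case by simp
  qed
  have tail: "\<bar>it (n + j) t k - it n t k\<bar> \<le> 2 * D * exp (2 * \<Lambda> * t) * ((1/2) ^ n - (1/2) ^ (n + j))"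
    if "t \<ge> 0" for n j t k
  proof (induction j)
    case 0 then show ?case by simp
  next
    case (Suc j)
    then show ?case using step[OF that, of "n + j" k] by (simp add: algebra_simps)
  qed
  have tail': "\<bar>it m t k - it n t k\<bar> \<le> 2 * D * (1/2) ^ n * exp (2 * \<Lambda> * t)"
    if "t \<ge> 0" "m \<ge> n" for n m t k
  proof -
    have "2 * D * exp (2 * \<Lambda> * t) * ((1/2) ^ n - (1/2) ^ m) \<le> 2 * D * exp (2 * \<Lambda> * t) * (1/2) ^ n"
      by (rule mult_left_mono) (use D0 in auto)
    then show ?thesis using tail[OF that(1), of n "m - n" k] that(2) by (simp add: mult.commute mult.left_commute)
  qed
  define u where "u = (\<lambda>t k. if t \<ge> 0 then lim (\<lambda>n. it n t k) else x\<^sub>0 k)"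
  have half0: "(\<lambda>n. 2 * D * (1/2) ^ n * C) \<longlonglongrightarrow> 0" for C :: real
    by (intro tendsto_mult_left_zero tendsto_mult_right_zero LIMSEQ_realpow_zero) auto
  have conv: "(\<lambda>n. it n t k) \<longlonglongrightarrow> u t k" if t: "t \<ge> 0" for t k
  proof -
    have "Cauchy (\<lambda>n. it n t k)"
    proof (rule metric_CauchyI)
      fix e :: real assume "e > 0"
      from half0[of "exp (2 * \<Lambda> * t)", THEN LIMSEQ_D, OF this]
      obtain N where N: "\<And>n. n \<ge> N \<Longrightarrow> \<bar>2 * D * (1/2) ^ n * exp (2 * \<Lambda> * t)\<bar> < e" by auto
      have "dist (it m t k) (it n t k) < e" if "m \<ge> N" "n \<ge> N" for m n
      proof (cases "m \<ge> n")
        case True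
        then show ?thesis using tail'[OF t True, of k] N[OF that(2)] by (simp add: dist_real_def)
      next
        case False
        then have "n \<ge> m" by simp
        then show ?thesis using tail'[OF t \<open>n \<ge> m\<close>, of k] N[OF that(1)] by (simp add: dist_real_def)
      qed
      then show "\<exists>M. \<forall>m\<ge>M. \<forall>n\<ge>M. dist (it m t k) (it n t k) < e" by blast
    qed
    then show ?thesis using t unfolding u_def by (simp add: Cauchy_convergent_iff convergent_LIMSEQ_iff)
  qed
  have u_near: "\<bar>u t k - it n t k\<bar> \<le> 2 * D * (1/2) ^ n * exp (2 * \<Lambda> * t)" if t: "t \<ge> 0" for t k n
  proof (rule LIMSEQ_le_const2)
    show "(\<lambda>m. \<bar>it m t k - it n t k\<bar>) \<longlonglongrightarrow> \<bar>u t k - it n t k\<bar>"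
      by (intro tendsto_intros conv t)
    show "\<exists>N. \<forall>m\<ge>N. \<bar>it m t k - it n t k\<bar> \<le> 2 * D * (1/2) ^ n * exp (2 * \<Lambda> * t)"
      using tail'[OF t] by blast
  qed
  have u_cts: "cts u"
    unfolding cts_def
  proof
    fix k
    have "continuous_on {0..T} (\<lambda>t. u t k)" for T
    proof (rule uniform_limit_theorem[where F = sequentially and f = "\<lambda>n t. it n t k"])
      show "\<forall>\<^sub>F n in sequentially. continuous_on {0..T} (\<lambda>t. it n t k)"
        using it_cts unfolding cts_def
        by (intro always_eventually allI) (rule continuous_on_subset[of "{0..}"], auto)
      show "uniform_limit {0..T} (\<lambda>n t. it n t k) (\<lambda>t. u t k) sequentially"
      proof (rule uniform_limitI)
        fix e :: real assume "e > 0"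
        from half0[of "exp (2 * \<Lambda> * T)", THEN LIMSEQ_D, OF this]
        obtain N where N: "\<And>n. n \<ge> N \<Longrightarrow> \<bar>2 * D * (1/2) ^ n * exp (2 * \<Lambda> * T)\<bar> < e" by auto
        have "dist (it n t k) (u t k) < e" if "n \<ge> N" "t \<in> {0..T}" for n t
        proof -
          have "2 * D * (1/2) ^ n * exp (2 * \<Lambda> * t) \<le> 2 * D * (1/2) ^ n * exp (2 * \<Lambda> * T)"
            by (rule mult_left_mono) (use that L0 D0 in auto)
          then show ?thesis using u_near[of t k n] N[OF that(1)] that(2)
            by (simp add: dist_real_def)
        qed
        then show "\<forall>\<^sub>F n in sequentially. \<forall>t\<in>{0..T}. dist (it n t k) (u t k) < e"
          unfolding eventually_sequentially by blast
      qed
    qed auto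
    then show "continuous_on {0..} (\<lambda>t. u t k)" by (rule continuous_on_atLeast_of_Icc)
  qed
  have fixpoint: "P u t k = u t k" if t: "t \<ge> 0" for t k
  proof -
    have "\<bar>P u t k - it (Suc n) t k\<bar> \<le> 2 * D * (1/2) ^ n * exp (2 * \<Lambda> * t)" for n
    proof -
      have "\<bar>P u t k - P (it n) t k\<bar> \<le> (2 * D * (1/2) ^ n) / 2 * exp (2 * \<Lambda> * t)"
        by (rule contract[OF u_cts it_cts t]) (use D0 u_near in auto)
      also have "\<dots> \<le> 2 * D * (1/2) ^ n * exp (2 * \<Lambda> * t)"
        by (rule mult_right_mono) (use D0 in auto)
      finally show ?thesis by (simp add: it_Suc)
    qed
    then have "(\<lambda>n. P u t k - it (Suc n) t k) \<longlonglongrightarrow> 0"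
      by (intro Lim_null_comparison[OF _ half0[of "exp (2 * \<Lambda> * t)"]]) auto
    moreover have "(\<lambda>n. P u t k - it (Suc n) t k) \<longlonglongrightarrow> P u t k - u t k"
      by (intro tendsto_intros LIMSEQ_Suc conv t)
    ultimately show ?thesis using LIMSEQ_unique by fastforce
  qed
  have deriv: "((\<lambda>s. u s k) has_real_derivative drift f g (K t) (u t) k) (at t)"
    if t: "t > 0" and Kt: "isCont K t" for t k
  proof -
    have cu: "isCont (\<lambda>t. u t j) t" for j
      using u_cts t continuous_on_interior[of "{0..}" "\<lambda>t. u t j" t] unfolding cts_def by simp
    have cf: "isCont f x" "isCont g x" for x
      using cont_f[OF f A] cont_f[OF g L] by (simp_all add: continuous_on_eq_continuous_at)
    have "isCont (J u k) t"
      unfolding J_def drift_def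
      by (intro continuous_intros Kt cu isCont_o2[OF _ cf(1)] isCont_o2[OF _ cf(2)])
    then have "((\<lambda>s. integral {0..s} (J u k)) has_vector_derivative J u k t) (at t within {0..t + 1})"
      using integral_has_vector_derivative_continuous_at[of "J u k" 0 "t + 1" t "{}"] J_int[OF u_cts] t
      by (simp add: continuous_at_imp_continuous_at_within)
    moreover have "at t within {0..t + 1} = at t" using t by (simp add: at_within_Icc_at)
    ultimately have "((\<lambda>s. P u s k) has_real_derivative J u k t) (at t)"
      unfolding P_def has_real_derivative_iff_has_vector_derivative
      by (simp add: has_vector_derivative_add_const add.commute[of "x\<^sub>0 k"])
    then have "((\<lambda>s. u s k) has_real_derivative J u k t) (at t)"
    proof (rule has_field_derivative_transform_within_open[where S = "{0<..}"])
      show "P u s k = u s k" if "s \<in> {0<..}" for s using fixpoint that by auto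
    qed (use t in auto)
    then show ?thesis unfolding J_def .
  qed
  have "u 0 k = x\<^sub>0 k" for k using fixpoint[of 0 k] unfolding P_def by simp
  moreover have "\<bar>u t k - x\<^sub>0 k\<bar> \<le> B * t" if "t \<ge> 0" for t k
    using P_bound[OF that u_cts, of k] fixpoint[OF that] by simp
  ultimately show ?thesis
    using u_cts deriv unfolding cts_def B_def by (intro exI[of _ u]) blast
qed

section \<open>Solutions driven by the step pulse\<close>

text \<open>
  The solution concept of the problem for general forces, so that it also applies to truncated ones.
\<close>

definition chain_solution ::
  "(real \<Rightarrow> real) \<Rightarrow> (real \<Rightarrow> real) \<Rightarrow> (real \<Rightarrow> real) \<Rightarrow> real \<Rightarrow> (real \<Rightarrow> int \<Rightarrow> real) \<Rightarrow> bool" where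
  "chain_solution f g K t\<^sub>0 u \<longleftrightarrow>
     (\<forall>k. continuous_on {t\<^sub>0..} (\<lambda>t. u t k)) \<and>
     (\<forall>k. \<forall>t>t\<^sub>0. isCont K t \<longrightarrow>
        ((\<lambda>s. u s k) has_real_derivative drift f g (K t) (u t) k) (at t)) \<and>
     (\<forall>T. \<exists>M. \<forall>t\<in>{t\<^sub>0..T}. \<forall>k. \<bar>u t (k + 1) - u t k\<bar> \<le> M)"

lemma is_solution_iff_chain_solution:
  "is_solution W V K t\<^sub>0 u \<longleftrightarrow> chain_solution (deriv W) (deriv V) K t\<^sub>0 u"
  unfolding is_solution_def chain_solution_def drift_def ..

definition phase_value :: "real \<Rightarrow> int \<Rightarrow> real" where
  "phase_value \<kappa> i = (if even i then 0 else \<kappa>)"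

lemma step_pulse_on_phase:
  assumes "\<tau> > 0" "of_int i * \<tau> \<le> t" "t < (of_int i + 1) * \<tau>"
  shows "step_pulse \<kappa> \<tau> t = phase_value \<kappa> i"
proof -
  have fl: "\<lfloor>t / \<tau>\<rfloor> = i"
    using assms by (intro floor_unique) (auto simp: field_simps)
  have "(\<exists>n::int. t \<in> {2 * of_int n * \<tau>..<(2 * of_int n + 1) * \<tau>}) \<longleftrightarrow> even i"
  proof
    assume "\<exists>n::int. t \<in> {2 * of_int n * \<tau>..<(2 * of_int n + 1) * \<tau>}"
    then obtain n :: int where "2 * of_int n * \<tau> \<le> t" "t < (2 * of_int n + 1) * \<tau>" by auto
    then have "\<lfloor>t / \<tau>\<rfloor> = 2 * n" using \<open>\<tau> > 0\<close> by (intro floor_unique) (auto simp: field_simps)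
    then show "even i" using fl by auto
  next
    assume "even i"
    then obtain n where "i = 2 * n" by (elim evenE)
    then show "\<exists>n::int. t \<in> {2 * of_int n * \<tau>..<(2 * of_int n + 1) * \<tau>}"
      using assms by (intro exI[of _ n]) auto
  qed
  then show ?thesis unfolding step_pulse_def phase_value_def by simp
qed

lemma isCont_step_pulse_in_phase:
  assumes "\<tau> > 0" "of_int i * \<tau> < t" "t < (of_int i + 1) * \<tau>"
  shows "isCont (step_pulse \<kappa> \<tau>) t"
proof -
  have "\<forall>\<^sub>F s in nhds t. s \<in> {of_int i * \<tau><..<(of_int i + 1) * \<tau>}"
    using assms by (intro eventually_nhds_in_open) auto
  then have "\<forall>\<^sub>F s in nhds t. step_pulse \<kappa> \<tau> s = phase_value \<kappa> i"
    by eventually_elim (use assms step_pulse_on_phase in auto)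
  then show ?thesis by (subst isCont_cong) auto
qed

lemma step_pulse_measurable: "step_pulse \<kappa> \<tau> \<in> borel_measurable borel"
proof -
  have "{t. \<exists>n::int. t \<in> {2 * of_int n * \<tau>..<(2 * of_int n + 1) * \<tau>}} =
      (\<Union>n::int. {2 * of_int n * \<tau>..<(2 * of_int n + 1) * \<tau>})" by auto
  also have "\<dots> \<in> sets borel" by (intro sets.countable_UN) auto
  finally have "Measurable.pred borel (\<lambda>t. \<exists>n::int. t \<in> {2 * of_int n * \<tau>..<(2 * of_int n + 1) * \<tau>})"
    by (simp add: pred_def)
  then show ?thesis unfolding step_pulse_def by measurable
qed

lemma step_pulse_periodic: "step_pulse \<kappa> \<tau> (t + 2 * of_int m * \<tau>) = step_pulse \<kappa> \<tau> t"
proof -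
  have "(t + 2 * of_int m * \<tau> \<in> {2 * of_int n * \<tau>..<(2 * of_int n + 1) * \<tau>}) \<longleftrightarrow>
      (t \<in> {2 * of_int (n - m) * \<tau>..<(2 * of_int (n - m) + 1) * \<tau>})" for n :: int
    by (auto simp: algebra_simps)
  then have "(\<exists>n::int. t + 2 * of_int m * \<tau> \<in> {2 * of_int n * \<tau>..<(2 * of_int n + 1) * \<tau>}) \<longleftrightarrow>
      (\<exists>n::int. t \<in> {2 * of_int n * \<tau>..<(2 * of_int n + 1) * \<tau>})"
    by (metis add_diff_cancel_right')
  then show ?thesis unfolding step_pulse_def by simp
qed

lemma step_pulse_bounded: "\<bar>step_pulse \<kappa> \<tau> t\<bar> \<le> \<bar>\<kappa>\<bar>"
  unfolding step_pulse_def by auto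

lemma chain_solution_solves_on_phase:
  assumes "chain_solution f g (step_pulse \<kappa> \<tau>) t\<^sub>0 u" "\<tau> > 0"
    and "t\<^sub>0 \<le> s\<^sub>0" "of_int i * \<tau> \<le> s\<^sub>0" "s\<^sub>1 \<le> (of_int i + 1) * \<tau>"
  shows "solves_on f g (phase_value \<kappa> i) s\<^sub>0 s\<^sub>1 u"
  unfolding solves_on_def
proof (intro conjI allI ballI)
  show "continuous_on {s\<^sub>0..s\<^sub>1} (\<lambda>t. u t k)" for k
    using assms unfolding chain_solution_def by (auto intro: continuous_on_subset)
  fix k t assume t: "t \<in> {s\<^sub>0<..<s\<^sub>1}"
  have "isCont (step_pulse \<kappa> \<tau>) t"
    using t assms by (intro isCont_step_pulse_in_phase[of _ i]) auto
  moreover have "step_pulse \<kappa> \<tau> t = phase_value \<kappa> i"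
    using t assms by (intro step_pulse_on_phase) auto
  moreover have "t > t\<^sub>0" using assms(3) t by auto
  ultimately show "((\<lambda>s. u s k) has_real_derivative drift f g (phase_value \<kappa> i) (u t) k) (at t)"
    using assms(1) unfolding chain_solution_def by metis
qed

definition locally_lipschitz :: "(real \<Rightarrow> real) \<Rightarrow> bool" where
  "locally_lipschitz f \<longleftrightarrow>
     (\<forall>M. \<exists>A\<ge>0. \<forall>x y. \<bar>x\<bar> \<le> M \<longrightarrow> \<bar>y\<bar> \<le> M \<longrightarrow> \<bar>f x - f y\<bar> \<le> A * \<bar>x - y\<bar>)"

definition lipschitz :: "(real \<Rightarrow> real) \<Rightarrow> bool" where
  "lipschitz g \<longleftrightarrow> (\<exists>L\<ge>0. \<forall>x y. \<bar>g x - g y\<bar> \<le> L * \<bar>x - y\<bar>)"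

text \<open>
  The comparison principle is applied in one phase after another. The first phase may start in the
  middle, at \<open>t\<^sub>0\<close>, and \<open>i\<^sub>0\<close> is its index.
\<close>

lemma pulse_comparison:
  assumes u: "chain_solution f g (step_pulse \<kappa> \<tau>) t\<^sub>0 u"
    and w: "chain_solution f g (step_pulse \<kappa> \<tau>) t\<^sub>0 w" and \<tau>: "\<tau> > 0"
    and f: "mono f" "locally_lipschitz f" and g: "lipschitz g"
    and init: "\<And>k. u t\<^sub>0 k \<le> w t\<^sub>0 k" and t: "t \<ge> t\<^sub>0"
  shows "u t k \<le> w t k"
proof -
  obtain L where L: "L \<ge> 0" "\<And>x y. \<bar>g x - g y\<bar> \<le> L * \<bar>x - y\<bar>"
    using g unfolding lipschitz_def by blast
  define i\<^sub>0 where "i\<^sub>0 = \<lfloor>t\<^sub>0 / \<tau>\<rfloor>"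
  have "\<forall>t\<in>{t\<^sub>0..of_int (i\<^sub>0 + int n) * \<tau>}. \<forall>k. u t k \<le> w t k" for n
  proof (induction n)
    case 0
    have "of_int i\<^sub>0 * \<tau> \<le> t\<^sub>0" unfolding i\<^sub>0_def using \<tau> by (simp add: floor_divide_lower)
    then show ?case using init by (auto dest: order_antisym)
  next
    case (Suc n)
    let ?i = "i\<^sub>0 + int n"
    define s\<^sub>0 where "s\<^sub>0 = max t\<^sub>0 (of_int ?i * \<tau>)"
    define s\<^sub>1 where "s\<^sub>1 = (of_int ?i + 1) * \<tau>"
    have su: "solves_on f g (phase_value \<kappa> ?i) s\<^sub>0 s\<^sub>1 u"
      by (rule chain_solution_solves_on_phase[OF u \<tau>]) (auto simp: s\<^sub>0_def s\<^sub>1_def)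
    have sw: "solves_on f g (phase_value \<kappa> ?i) s\<^sub>0 s\<^sub>1 w"
      by (rule chain_solution_solves_on_phase[OF w \<tau>]) (auto simp: s\<^sub>0_def s\<^sub>1_def)
    obtain Mu where Mu: "\<And>t k. t \<in> {t\<^sub>0..s\<^sub>1} \<Longrightarrow> \<bar>u t (k + 1) - u t k\<bar> \<le> Mu"
      using u unfolding chain_solution_def by meson
    obtain Mw where Mw: "\<And>t k. t \<in> {t\<^sub>0..s\<^sub>1} \<Longrightarrow> \<bar>w t (k + 1) - w t k\<bar> \<le> Mw"
      using w unfolding chain_solution_def by meson
    define M where "M = max Mu Mw"
    obtain A where A: "A \<ge> 0" "\<And>x y. \<bar>x\<bar> \<le> M \<Longrightarrow> \<bar>y\<bar> \<le> M \<Longrightarrow> \<bar>f x - f y\<bar> \<le> A * \<bar>x - y\<bar>"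
      using f(2) unfolding locally_lipschitz_def by blast
    have start: "u s\<^sub>0 k \<le> w s\<^sub>0 k" for k
      using init Suc unfolding s\<^sub>0_def by (auto simp: max_def)
    show ?case
    proof (intro ballI allI)
      fix t k assume t: "t \<in> {t\<^sub>0..of_int (i\<^sub>0 + int (Suc n)) * \<tau>}"
      show "u t k \<le> w t k"
      proof (cases "t \<le> of_int ?i * \<tau>")
        case True then show ?thesis using Suc t by auto
      next
        case False
        show ?thesis
        proof (rule comparison_principle[OF su sw _ _ f(1) A(2) L(2) A(1) L(1) start])
          show "\<bar>u t (k + 1) - u t k\<bar> \<le> M" if "t \<in> {s\<^sub>0..s\<^sub>1}" for t k
            using Mu[of t k] that unfolding M_def s\<^sub>0_def by auto
          show "\<bar>w t (k + 1) - w t k\<bar> \<le> M" if "t \<in> {s\<^sub>0..s\<^sub>1}" for t k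
            using Mw[of t k] that unfolding M_def s\<^sub>0_def by auto
          show "t \<in> {s\<^sub>0..s\<^sub>1}" using t False unfolding s\<^sub>0_def s\<^sub>1_def by (auto simp: algebra_simps)
        qed
      qed
    qed
  qed
  moreover obtain n :: nat where "t / \<tau> \<le> of_int (i\<^sub>0 + int n)"
  proof -
    obtain n :: nat where "t / \<tau> - of_int i\<^sub>0 \<le> real n" using real_arch_simple by blast
    then show ?thesis by (intro that[of n]) simp
  qed
  ultimately show ?thesis using t \<tau> by (simp add: pos_divide_le_eq)
qed

section \<open>Regularity of the forces\<close>

lemma periodic_int_shift:
  fixes g :: "real \<Rightarrow> 'a"
  assumes g: "\<And>x. g (x + 1) = g x"
  shows "g (x + of_int l) = g x"
proof (induction l rule: int_induct[where k = 0])
  case base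
  then show ?case by simp
next
  case (step1 i)
  then show ?case using g[of "x + of_int i"] by (simp add: add.assoc)
next
  case (step2 i)
  then show ?case using g[of "x + of_int i - 1"] by (simp add: algebra_simps)
qed

lemma C2_derivatives:
  assumes "C2 f"
  shows "(f has_real_derivative deriv f x) (at x)"
    and "(deriv f has_real_derivative deriv (deriv f) x) (at x)"
    and "continuous_on S (deriv (deriv f))"
  using assms unfolding C2_def
  by (auto simp: DERIV_deriv_iff_real_differentiable intro: continuous_on_subset)

lemma lipschitz_of_bounded_derivative:
  fixes f f' :: "real \<Rightarrow> real"
  assumes d: "\<And>x. (f has_real_derivative f' x) (at x)" and S: "convex S"
    and B: "\<And>x. x \<in> S \<Longrightarrow> \<bar>f' x\<bar> \<le> B" and xy: "x \<in> S" "y \<in> S"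
  shows "\<bar>f x - f y\<bar> \<le> B * \<bar>x - y\<bar>"
  using field_differentiable_bound[OF S, of f f' B y x] d B xy
  by (simp add: has_field_derivative_at_within abs_minus_commute)

lemma strongly_monotone_of_deriv_ge:
  fixes f f' :: "real \<Rightarrow> real"
  assumes d: "\<And>x. (f has_real_derivative f' x) (at x)" and ge: "\<And>x. f' x \<ge> c" and xy: "x \<le> y"
  shows "f y - f x \<ge> c * (y - x)"
proof -
  have "f x - c * x \<le> f y - c * y"
    by (rule DERIV_nonneg_imp_nondecreasing[OF xy])
      (use d ge in \<open>auto intro!: exI derivative_eq_intros\<close>)
  then show ?thesis by (simp add: algebra_simps)
qed

lemma C2_deriv_locally_lipschitz:
  assumes "C2 f" shows "locally_lipschitz (deriv f)"
  unfolding locally_lipschitz_def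
proof
  fix M
  have "bounded (deriv (deriv f) ` {-M..M})"
    by (intro compact_imp_bounded compact_continuous_image C2_derivatives(3)[OF assms]) auto
  then obtain B where B: "\<And>x. x \<in> {-M..M} \<Longrightarrow> \<bar>deriv (deriv f) x\<bar> \<le> B"
    unfolding bounded_iff real_norm_def by (metis imageI)
  show "\<exists>A\<ge>0. \<forall>x y. \<bar>x\<bar> \<le> M \<longrightarrow> \<bar>y\<bar> \<le> M \<longrightarrow> \<bar>deriv f x - deriv f y\<bar> \<le> A * \<bar>x - y\<bar>"
  proof (intro exI[of _ "\<bar>B\<bar>"] conjI allI impI)
    fix x y assume "\<bar>x\<bar> \<le> M" "\<bar>y\<bar> \<le> M"
    then show "\<bar>deriv f x - deriv f y\<bar> \<le> \<bar>B\<bar> * \<bar>x - y\<bar>"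
      using B by (intro lipschitz_of_bounded_derivative[OF C2_derivatives(2)[OF assms], of "{-M..M}"]) force+
  qed simp
qed

lemma continuous_periodic_bounded:
  fixes h :: "real \<Rightarrow> real"
  assumes per: "\<And>x. h (x + 1) = h x" and cont: "continuous_on UNIV h"
  shows "\<exists>B. \<forall>x. \<bar>h x\<bar> \<le> B"
proof -
  have "bounded (h ` {0..1})"
    by (intro compact_imp_bounded compact_continuous_image continuous_on_subset[OF cont]) auto
  then obtain B where B: "\<And>x. x \<in> {0..1} \<Longrightarrow> \<bar>h x\<bar> \<le> B"
    unfolding bounded_iff real_norm_def by (metis imageI)
  note int = periodic_int_shift[of h, OF per]
  have "\<bar>h x\<bar> \<le> B" for x
  proof -
    have "h x = h (frac x)" using int[of "frac x" "\<lfloor>x\<rfloor>"] by (simp add: frac_def)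
    moreover have "frac x \<in> {0..1}" using frac_lt_1[of x] by simp
    ultimately show ?thesis using B by metis
  qed
  then show ?thesis by blast
qed

lemma deriv_periodic:
  fixes V :: "real \<Rightarrow> real"
  assumes per: "\<And>x. V (x + 1) = V x" and V: "\<And>x. (V has_real_derivative deriv V x) (at x)"
  shows "deriv V (x + 1) = deriv V x"
proof -
  have "((\<lambda>y. V (y + 1)) has_real_derivative deriv V (x + 1)) (at x)"
    using V[of "x + 1"] by (simp add: DERIV_shift)
  then show ?thesis using V[of x] unfolding per by (rule DERIV_unique)
qed

lemma potential_force_regular:
  assumes V: "C2 V" and per: "\<And>x. V (x + 1) = V x"
  shows "lipschitz (deriv V)" "deriv V (x + 1) = deriv V x" "\<exists>G. \<forall>x. \<bar>deriv V x\<bar> \<le> G"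
    "continuous_on UNIV (deriv V)"
proof -
  show per': "deriv V (x + 1) = deriv V x" for x
    by (rule deriv_periodic[OF per C2_derivatives(1)[OF V]])
  show cont: "continuous_on UNIV (deriv V)"
    using C2_derivatives(2)[OF V] by (meson DERIV_continuous_on UNIV_I has_field_derivative_at_within)
  show "\<exists>G. \<forall>x. \<bar>deriv V x\<bar> \<le> G" by (rule continuous_periodic_bounded[OF per' cont])
  have "deriv (deriv V) (x + 1) = deriv (deriv V) x" for x
    by (rule deriv_periodic[OF per' C2_derivatives(2)[OF V]])
  from continuous_periodic_bounded[OF this C2_derivatives(3)[OF V]]
  obtain B where "\<And>x. \<bar>deriv (deriv V) x\<bar> \<le> B" by blast
  then have "\<bar>deriv V x - deriv V y\<bar> \<le> B * \<bar>x - y\<bar>" for x y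
    by (intro lipschitz_of_bounded_derivative[OF C2_derivatives(2)[OF V], of UNIV]) auto
  moreover have "B \<ge> 0" using \<open>\<And>x. \<bar>deriv (deriv V) x\<bar> \<le> B\<close>[of 0] by linarith
  ultimately show "lipschitz (deriv V)" unfolding lipschitz_def by blast
qed

section \<open>Ordered solutions and the transport speed\<close>

lemma chain_solution_translate:
  assumes u: "chain_solution f g K t\<^sub>0 u" and g: "\<And>x. g (x + 1) = g x"
  shows "chain_solution f g K t\<^sub>0 (\<lambda>t k. u t (k + j) + of_int l)"
proof -
  note g_int = periodic_int_shift[of g, OF g]
  have drift_eq: "drift f g c (\<lambda>k. x (k + j) + of_int l) k = drift f g c x (k + j)" for c x k
    unfolding drift_def g_int by (simp add: algebra_simps)
  show ?thesis
    unfolding chain_solution_def drift_eq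
  proof (intro conjI allI impI)
    show "continuous_on {t\<^sub>0..} (\<lambda>t. u t (k + j) + of_int l)" for k
      using u unfolding chain_solution_def by (intro continuous_intros) auto
    show "((\<lambda>s. u s (k + j) + of_int l) has_real_derivative drift f g (K t) (u t) (k + j)) (at t)"
      if "t > t\<^sub>0" "isCont K t" for k t
      using u that unfolding chain_solution_def by (auto intro!: derivative_eq_intros)
    fix T
    obtain M where "\<forall>t\<in>{t\<^sub>0..T}. \<forall>k. \<bar>u t (k + 1) - u t k\<bar> \<le> M"
      using u unfolding chain_solution_def by meson
    then have "\<forall>t\<in>{t\<^sub>0..T}. \<forall>k. \<bar>u t ((k + j) + 1) - u t (k + j)\<bar> \<le> M" by blast
    then show "\<exists>M. \<forall>t\<in>{t\<^sub>0..T}. \<forall>k. \<bar>(u t (k + 1 + j) + of_int l) - (u t (k + j) + of_int l)\<bar> \<le> M"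
      by (intro exI[of _ M]) (simp add: algebra_simps)
  qed
qed

lemma chain_solution_time_shift:
  assumes u: "chain_solution f g K t\<^sub>1 u" and K: "\<And>t. K (t + s) = K t" and t: "t\<^sub>1 \<le> t\<^sub>0 + s"
  shows "chain_solution f g K t\<^sub>0 (\<lambda>t. u (t + s))"
  unfolding chain_solution_def
proof (intro conjI allI impI)
  show "continuous_on {t\<^sub>0..} (\<lambda>t. u (t + s) k)" for k
  proof -
    have "continuous_on {t\<^sub>1..} (\<lambda>t. u t k)" using u unfolding chain_solution_def by auto
    then show ?thesis
      by (rule continuous_on_compose2) (use t in \<open>auto intro!: continuous_intros\<close>)
  qed
  show "((\<lambda>r. u (r + s) k) has_real_derivative drift f g (K t) (u (t + s)) k) (at t)"
    if "t > t\<^sub>0" "isCont K t" for k t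
  proof -
    have Ks: "K = (\<lambda>r. K (r - s))" using K[of "r - s" for r] by (auto simp: fun_eq_iff)
    have "isCont (\<lambda>r. K (r - s)) (t + s)"
      by (rule isCont_o2[where g = K]) (use that in \<open>auto intro!: continuous_intros\<close>)
    then have "isCont K (t + s)" using Ks by simp
    moreover have "t + s > t\<^sub>1" using that t by simp
    ultimately have "((\<lambda>r. u r k) has_real_derivative drift f g (K (t + s)) (u (t + s)) k) (at (t + s))"
      using u unfolding chain_solution_def by blast
    then show ?thesis unfolding K by (simp add: DERIV_shift)
  qed
  fix T
  obtain M where "\<forall>t\<in>{t\<^sub>1..T + s}. \<forall>k. \<bar>u t (k + 1) - u t k\<bar> \<le> M"
    using u unfolding chain_solution_def by meson
  then show "\<exists>M. \<forall>t\<in>{t\<^sub>0..T}. \<forall>k. \<bar>u (t + s) (k + 1) - u (t + s) k\<bar> \<le> M"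
    using t by (intro exI[of _ M]) auto
qed

text \<open>
  Rotational order: the increment over \<open>j\<close> particles lies between the two integers next to \<open>j \<rho>\<close>. This
  is what remains of uniform spacing when only comparisons with integer translates are available.
\<close>

definition ordered :: "real \<Rightarrow> (int \<Rightarrow> real) \<Rightarrow> bool" where
  "ordered \<rho> x \<longleftrightarrow> (\<forall>k j. of_int \<lfloor>of_int j * \<rho>\<rfloor> \<le> x (k + j) - x k \<and>
      x (k + j) - x k \<le> of_int \<lceil>of_int j * \<rho>\<rceil>)"

lemma ordered_imp_bounded_width: "ordered \<rho> x \<Longrightarrow> bounded_width \<rho> 1 x"
  unfolding ordered_def bounded_width_def
proof (intro allI impI)
  fix j k :: int
  assume "\<forall>k j. of_int \<lfloor>of_int j * \<rho>\<rfloor> \<le> x (k + j) - x k \<and>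
      x (k + j) - x k \<le> of_int \<lceil>of_int j * \<rho>\<rceil>"
  then have "of_int \<lfloor>of_int k * \<rho>\<rfloor> \<le> x (j + k) - x j" "x (j + k) - x j \<le> of_int \<lceil>of_int k * \<rho>\<rceil>"
    by auto
  moreover have "of_int \<lfloor>of_int k * \<rho>\<rfloor> > of_int k * \<rho> - 1" "of_int \<lceil>of_int k * \<rho>\<rceil> < of_int k * \<rho> + 1"
    by linarith+
  ultimately have "\<bar>x (j + k) - x j - of_int k * \<rho>\<bar> \<le> 1" by linarith
  then show "\<bar>x (j + k) - x j - of_int k * \<rho>\<bar> \<le> real 1" by simp
qed

text \<open>
  An ordered configuration has spacings in \<open>[\<rho> - 1, \<rho> + 1]\<close>. So the bond force is first truncated
  outside this interval, which makes it bounded and Lipschitz. The solution of the truncated system that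
  starts from \<open>k \<rho>\<close> lies initially on one side of each of its translates in space and particle index;
  by comparison it stays there, hence it is ordered and never feels the truncation.
\<close>

lemma ordered_solution_exists:
  assumes f: "mono f" "locally_lipschitz f" and g: "lipschitz g" "\<And>x. g (x + 1) = g x" "\<And>x. \<bar>g x\<bar> \<le> G"
    and \<tau>: "\<tau> > 0"
  shows "\<exists>w. chain_solution f g (step_pulse \<kappa> \<tau>) 0 w \<and> (\<forall>t\<ge>0. ordered \<rho> (w t))"
proof -
  define cl where "cl = (\<lambda>x. max (\<rho> - 1) (min (\<rho> + 1) x))"
  define fc where "fc = (\<lambda>x. f (cl x))"
  define K where "K = step_pulse \<kappa> \<tau>"
  have cl_bound: "\<bar>cl x\<bar> \<le> \<bar>\<rho>\<bar> + 1" for x unfolding cl_def by linarith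
  obtain A where A: "A \<ge> 0" "\<And>x y. \<bar>x\<bar> \<le> \<bar>\<rho>\<bar> + 1 \<Longrightarrow> \<bar>y\<bar> \<le> \<bar>\<rho>\<bar> + 1 \<Longrightarrow> \<bar>f x - f y\<bar> \<le> A * \<bar>x - y\<bar>"
    using f(2) unfolding locally_lipschitz_def by blast
  obtain L where L: "L \<ge> 0" "\<And>x y. \<bar>g x - g y\<bar> \<le> L * \<bar>x - y\<bar>"
    using g(1) unfolding lipschitz_def by blast
  have fc_lip: "\<bar>fc x - fc y\<bar> \<le> A * \<bar>x - y\<bar>" for x y
  proof -
    have "\<bar>fc x - fc y\<bar> \<le> A * \<bar>cl x - cl y\<bar>" unfolding fc_def by (intro A cl_bound)
    also have "\<dots> \<le> A * \<bar>x - y\<bar>" using A(1) by (intro mult_left_mono) (auto simp: cl_def)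
    finally show ?thesis .
  qed
  have fc_bound: "\<bar>fc x\<bar> \<le> \<bar>f 0\<bar> + A * (\<bar>\<rho>\<bar> + 1)" for x
  proof -
    have "\<bar>f (cl x) - f 0\<bar> \<le> A * \<bar>cl x - 0\<bar>" by (intro A cl_bound) auto
    also have "\<dots> \<le> A * (\<bar>\<rho>\<bar> + 1)" using cl_bound[of x] A(1) by (intro mult_left_mono) auto
    finally show ?thesis unfolding fc_def by linarith
  qed
  have fc_mono: "mono fc"
    using f(1) unfolding fc_def mono_def cl_def by (meson max.mono min.mono order_refl)
  have fc_loc: "locally_lipschitz fc" unfolding locally_lipschitz_def using fc_lip A(1) by blast
  obtain w B where w0: "\<And>k. w 0 k = of_int k * \<rho>"
    and wc: "\<And>k. continuous_on {0..} (\<lambda>t. w t k)"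
    and wd: "\<And>k t. t > 0 \<Longrightarrow> isCont K t \<Longrightarrow>
        ((\<lambda>s. w s k) has_real_derivative drift fc g (K t) (w t) k) (at t)"
    and wb: "\<And>k t. t \<ge> 0 \<Longrightarrow> \<bar>w t k - of_int k * \<rho>\<bar> \<le> B * t"
    using chain_solution_exists_for_bounded_lipschitz_forces[OF fc_lip L(2) A(1) L(1) fc_bound g(3)
        step_pulse_measurable step_pulse_bounded, of "\<lambda>k. of_int k * \<rho>" \<kappa> \<tau>, folded K_def] by metis
  have B0: "B \<ge> 0" using wb[of 1 0] by simp
  have spacing: "\<exists>M. \<forall>t\<in>{0..T}. \<forall>k. \<bar>w t (k + 1) - w t k\<bar> \<le> M" for T
  proof (intro exI ballI allI)
    fix t k assume t: "t \<in> {0..T}"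
    then have "B * t \<le> B * T" using B0 by (intro mult_left_mono) auto
    then show "\<bar>w t (k + 1) - w t k\<bar> \<le> \<bar>\<rho>\<bar> + 2 * (B * T)"
      using wb[of t k] wb[of t "k + 1"] t by (auto simp: algebra_simps abs_if split: if_splits)
  qed
  have sol: "chain_solution fc g K 0 w" unfolding chain_solution_def using wc wd spacing by blast
  \<comment> \<open>The translate by \<open>j\<close> particles and \<open>l\<close> in space lies above \<open>w\<close> at time \<open>0\<close> if and only if \<open>j \<rho> + l \<ge> 0\<close>.\<close>
  have order: "w t k \<le> w t (k + j) + of_int l" if "of_int j * \<rho> + of_int l \<ge> 0" "t \<ge> 0" for t j l k
    by (rule pulse_comparison[OF sol[unfolded K_def]
          chain_solution_translate[OF sol g(2), unfolded K_def] \<tau> fc_mono fc_loc g(1)])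
       (use that in \<open>auto simp: w0 algebra_simps\<close>)
  have ord: "ordered \<rho> (w t)" if t: "t \<ge> 0" for t
    unfolding ordered_def
  proof (intro allI conjI)
    fix k j :: int
    show "of_int \<lfloor>of_int j * \<rho>\<rfloor> \<le> w t (k + j) - w t k"
      using order[of j "- \<lfloor>of_int j * \<rho>\<rfloor>" t k] t by simp
    show "w t (k + j) - w t k \<le> of_int \<lceil>of_int j * \<rho>\<rceil>"
      using order[of "- j" "\<lceil>of_int j * \<rho>\<rceil>" t "k + j"] t by simp
  qed
  have in_range: "cl (w t (k + 1) - w t k) = w t (k + 1) - w t k" if "t \<ge> 0" for t k
  proof -
    have "of_int \<lfloor>\<rho>\<rfloor> \<le> w t (k + 1) - w t k" "w t (k + 1) - w t k \<le> of_int \<lceil>\<rho>\<rceil>"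
      using ord[OF that, unfolded ordered_def, rule_format, of 1 k] by simp_all
    then show ?thesis unfolding cl_def by linarith
  qed
  have "drift fc g c (w t) k = drift f g c (w t) k" if "t \<ge> 0" for t c k
    using in_range[OF that, of k] in_range[OF that, of "k - 1"] unfolding drift_def fc_def by simp
  then have "chain_solution f g K 0 w"
    unfolding chain_solution_def using wc wd spacing by (metis less_imp_le)
  then show ?thesis using ord unfolding K_def by blast
qed

lemma bounded_width_two_sided:
  assumes "bounded_width \<rho> n x"
  shows "\<bar>x i - x k - of_int (i - k) * \<rho>\<bar> \<le> real n"
proof -
  consider "i = k" | "i - k \<ge> 1" | "k - i \<ge> 1" by linarith
  then show ?thesis
  proof cases
    case 1 then show ?thesis by simp
  next
    case 2
    then show ?thesis using assms unfolding bounded_width_def by (metis add.commute diff_add_cancel)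
  next
    case 3
    then have "\<bar>x (i + (k - i)) - x i - of_int (k - i) * \<rho>\<bar> \<le> real n"
      using assms unfolding bounded_width_def by blast
    moreover have "x (i + (k - i)) - x i - of_int (k - i) * \<rho> = - (x i - x k - of_int (i - k) * \<rho>)"
      by (simp add: algebra_simps)
    ultimately show ?thesis by (metis abs_minus_cancel)
  qed
qed

text \<open>
  After a suitable shift of the index and by an integer \<open>l\<close>, the second solution lies above the first one
  and exceeds it at particle \<open>k\<close> by at most \<open>n + n' + 1\<close>; the \<open>1\<close> is the cost of rounding. The order is
  preserved.
\<close>

lemma displacement_comparison:
  assumes u: "chain_solution f g (step_pulse \<kappa> \<tau>) t\<^sub>0 u" "bounded_width \<rho> n (u t\<^sub>0)"
    and w: "chain_solution f g (step_pulse \<kappa> \<tau>) t\<^sub>0 w" "bounded_width \<rho> n' (w t\<^sub>0)"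
    and \<tau>: "\<tau> > 0" and f: "mono f" "locally_lipschitz f"
    and g: "lipschitz g" "\<And>x. g (x + 1) = g x" and t: "t \<ge> t\<^sub>0"
  shows "\<bar>(u t k - u t\<^sub>0 k) - (w t k' - w t\<^sub>0 k')\<bar> \<le> real n + real n' + 1"
proof -
  have half: "u t k - u t\<^sub>0 k \<le> w t k' - w t\<^sub>0 k' + real n + real n' + 1"
    if u: "chain_solution f g (step_pulse \<kappa> \<tau>) t\<^sub>0 u" "bounded_width \<rho> n (u t\<^sub>0)"
      and w: "chain_solution f g (step_pulse \<kappa> \<tau>) t\<^sub>0 w" "bounded_width \<rho> n' (w t\<^sub>0)"
    for u w n n' k k'
  proof -
    define l where "l = \<lceil>u t\<^sub>0 k + real n + real n' - w t\<^sub>0 k'\<rceil>"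
    have l1: "of_int l \<ge> u t\<^sub>0 k + real n + real n' - w t\<^sub>0 k'" unfolding l_def by linarith
    have l2: "of_int l \<le> u t\<^sub>0 k + real n + real n' - w t\<^sub>0 k' + 1" unfolding l_def by linarith
    have "u t k \<le> w t (k + (k' - k)) + of_int l"
    proof (rule pulse_comparison[OF u(1) chain_solution_translate[OF w(1) g(2)] \<tau> f g(1) _ t])
      fix i
      have "\<bar>u t\<^sub>0 i - u t\<^sub>0 k - of_int (i - k) * \<rho>\<bar> \<le> real n" by (rule bounded_width_two_sided[OF u(2)])
      moreover have "\<bar>w t\<^sub>0 (i + (k' - k)) - w t\<^sub>0 k' - of_int (i - k) * \<rho>\<bar> \<le> real n'"
        using bounded_width_two_sided[OF w(2), of "i + (k' - k)" k'] by simp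
      ultimately show "u t\<^sub>0 i \<le> w t\<^sub>0 (i + (k' - k)) + of_int l" using l1 by linarith
    qed
    then show ?thesis using l2 by simp
  qed
  show ?thesis using half[OF u w, of k k'] half[OF w u, of k' k] by linarith
qed

text \<open>
  The intervals \<open>[(a m - c) / m, (a m + c) / m]\<close> intersect pairwise, because both \<open>m * a l\<close> and \<open>l * a m\<close>
  approximate \<open>a (m * l)\<close>; a common point is the slope.
\<close>

lemma quasi_additive_imp_linear:
  fixes a :: "nat \<Rightarrow> real"
  assumes quasi: "\<And>m l. \<bar>a (m + l) - a m - a l\<bar> \<le> c"
  shows "\<exists>v. \<forall>m. \<bar>a m - real m * v\<bar> \<le> c"
proof -
  have c0: "c \<ge> 0" using quasi[of 0 0] by linarith
  have mult: "\<bar>a (Suc m * l) - real (Suc m) * a l\<bar> \<le> real m * c" for m l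
  proof (induction m)
    case 0 then show ?case by simp
  next
    case (Suc m)
    have "\<bar>a (l + Suc m * l) - a l - a (Suc m * l)\<bar> \<le> c" by (rule quasi)
    then show ?case using Suc by (simp add: algebra_simps abs_le_iff)
  qed
  have mult': "\<bar>a (m * l) - real m * a l\<bar> \<le> real m * c" if "m \<ge> 1" for m l
    using mult[of "m - 1" l] that c0 by (simp add: algebra_simps of_nat_diff)
  have cross: "(a l - c) / real l \<le> (a m + c) / real m" if "l \<ge> 1" "m \<ge> 1" for l m
    using mult'[OF that(1), of m] mult'[OF that(2), of l] that
    by (simp add: divide_simps) (simp add: algebra_simps)
  define v where "v = (SUP l\<in>{1..}. (a l - c) / real l)"
  have bdd: "bdd_above ((\<lambda>l. (a l - c) / real l) ` {1..})"
    by (rule bdd_aboveI2[of _ _ "(a 1 + c) / real 1"]) (use cross[of _ 1] in auto)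
  have "\<bar>a m - real m * v\<bar> \<le> c" for m
  proof (cases "m = 0")
    case True then show ?thesis using quasi[of 0 0] by simp
  next
    case False
    have "(a m - c) / real m \<le> v" unfolding v_def by (rule cSUP_upper[OF _ bdd]) (use False in auto)
    moreover have "v \<le> (a m + c) / real m" unfolding v_def by (rule cSUP_least) (use cross False in auto)
    ultimately show ?thesis using False by (simp add: field_simps abs_le_iff)
  qed
  then show ?thesis by blast
qed

lemma le_of_linear_growth_bound:
  fixes x y C :: real
  assumes "\<And>l::nat. real l * x \<le> real l * y + C"
  shows "x \<le> y"
proof (rule ccontr)
  assume "\<not> x \<le> y"
  then obtain l :: nat where "real l * (x - y) > C" using reals_Archimedean3[of "x - y" ] by auto
  then show False using assms[of l] by (simp add: algebra_simps)
qed

text \<open>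
  The ordered solution \<open>w\<close> has width one at every time, so its displacements over any two blocks of
  equally many periods differ by at most \<open>3\<close>. They are thus quasi-additive, and their slope defines the speed. For any other solution,
  one displacement over \<open>m\<close> periods is compared with \<open>l\<close> consecutive ones of \<open>w\<close>. Each comparison costs
  \<open>n + 2\<close>, whereas the sum for \<open>w\<close> is known up to a constant; division by \<open>l\<close> gives the sharp constant \<open>n + 2\<close>.
\<close>

lemma transport_speed_exists:
  assumes f: "mono f" "locally_lipschitz f" and g: "lipschitz g" "\<And>x. g (x + 1) = g x"
    and \<tau>: "\<tau> > 0"
    and w: "chain_solution f g (step_pulse \<kappa> \<tau>) 0 w" and ord: "\<And>t. t \<ge> 0 \<Longrightarrow> ordered \<rho> (w t)"
  shows "\<exists>v. \<forall>n t\<^sub>0 u. n \<ge> 1 \<longrightarrow> chain_solution f g (step_pulse \<kappa> \<tau>) t\<^sub>0 u \<longrightarrow> bounded_width \<rho> n (u t\<^sub>0) \<longrightarrow>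
        (\<forall>k m :: int. m \<ge> 1 \<longrightarrow>
           \<bar>(u (t\<^sub>0 + 2 * of_int m * \<tau>) k - u t\<^sub>0 k) / (2 * of_int m * \<tau>) - v\<bar>
             \<le> (real n + 2) / (2 * of_int m * \<tau>))"
proof -
  have width: "bounded_width \<rho> 1 (w t)" if "t \<ge> 0" for t
    using ordered_imp_bounded_width ord that by blast
  have compare: "\<bar>(u (t\<^sub>0 + h) k - u t\<^sub>0 k) -
        (w (t\<^sub>0 + h + 2 * real i * \<tau>) 0 - w (t\<^sub>0 + 2 * real i * \<tau>) 0)\<bar> \<le> real n + 2"
    if "chain_solution f g (step_pulse \<kappa> \<tau>) t\<^sub>0 u" "bounded_width \<rho> n (u t\<^sub>0)"
      "t\<^sub>0 + 2 * real i * \<tau> \<ge> 0" "h \<ge> 0" for t\<^sub>0 u n i h k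
  proof -
    have "chain_solution f g (step_pulse \<kappa> \<tau>) t\<^sub>0 (\<lambda>t. w (t + 2 * real i * \<tau>))"
      by (rule chain_solution_time_shift[OF w])
        (use that step_pulse_periodic[of \<kappa> \<tau> _ "int i"] in auto)
    from displacement_comparison[OF that(1,2) this, of 1 "t\<^sub>0 + h" k 0] width[OF that(3)] that(4) \<tau> f g
    show ?thesis by simp
  qed
  define a where "a = (\<lambda>m::nat. w (2 * real m * \<tau>) 0 - w 0 0)"
  have "\<bar>a (m + l) - a m - a l\<bar> \<le> 3" for m l
    using compare[OF w width[of 0], of m "2 * real l * \<tau>" 0] \<tau> unfolding a_def
    by (simp add: distrib_left distrib_right add.commute abs_le_iff)
  from quasi_additive_imp_linear[of a, OF this]
  obtain v where v: "\<And>m. \<bar>a m - real m * v\<bar> \<le> 3" by blast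
  show ?thesis
  proof (intro exI[of _ "v / (2 * \<tau>)"] allI impI)
    fix n :: nat and t\<^sub>0 u and k m :: int
    assume u: "chain_solution f g (step_pulse \<kappa> \<tau>) t\<^sub>0 u" "bounded_width \<rho> n (u t\<^sub>0)" and m: "m \<ge> 1"
    define M where "M = nat m"
    have M: "of_int m = real M" using m unfolding M_def by simp
    define D where "D = u (t\<^sub>0 + 2 * real M * \<tau>) k - u t\<^sub>0 k"
    obtain i\<^sub>0 :: nat where i0: "- t\<^sub>0 / (2 * \<tau>) \<le> real i\<^sub>0" using real_arch_simple by blast
    define h where "h = t\<^sub>0 + 2 * real i\<^sub>0 * \<tau>"
    have h0: "h \<ge> 0" using i0 \<tau> unfolding h_def by (simp add: field_simps)
    define b where "b = (\<lambda>l::nat. w (h + 2 * real (l * M) * \<tau>) 0)"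
    \<comment> \<open>Here \<open>b\<close> samples \<open>w\<close> at the times \<open>h + 2 l M \<tau>\<close>, which are shifted by whole periods from \<open>t\<^sub>0\<close>.\<close>
    have step: "\<bar>D - (b (Suc l) - b l)\<bar> \<le> real n + 2" for l
    proof -
      have "t\<^sub>0 + 2 * real (i\<^sub>0 + l * M) * \<tau> = h + 2 * real (l * M) * \<tau>"
        "t\<^sub>0 + 2 * real M * \<tau> + 2 * real (i\<^sub>0 + l * M) * \<tau> = h + 2 * real (Suc l * M) * \<tau>"
        unfolding h_def by (simp_all add: algebra_simps)
      moreover have "h + 2 * real (l * M) * \<tau> \<ge> 0" using h0 \<tau> by simp
      ultimately show ?thesis
        using compare[OF u, of "i\<^sub>0 + l * M" "2 * real M * \<tau>" k] \<tau> unfolding D_def b_def by simp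
    qed
    have total: "\<bar>real l * D - (b l - b 0)\<bar> \<le> real l * (real n + 2)" for l
    proof (induction l)
      case 0 then show ?case by simp
    next
      case (Suc l)
      have "real (Suc l) * D - (b (Suc l) - b 0) = (real l * D - (b l - b 0)) + (D - (b (Suc l) - b l))"
        by (simp add: algebra_simps)
      moreover have "real (Suc l) * (real n + 2) = real l * (real n + 2) + (real n + 2)"
        by (simp add: algebra_simps)
      ultimately show ?case using Suc step[of l] by linarith
    qed
    \<comment> \<open>The offset \<open>h\<close> of the sampling times changes the displacements only by a bounded amount.\<close>
    have phase: "\<bar>(b 0 - w 0 0) - (b l - w (2 * real (l * M) * \<tau>) 0)\<bar> \<le> 3" for l
      using compare[OF w width[of 0], of "l * M" h 0] h0 \<tau> unfolding b_def by simp
    have "real l * \<bar>D - real M * v\<bar> \<le> real l * (real n + 2) + 6" for l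
    proof -
      have "real l * \<bar>D - real M * v\<bar> = \<bar>real l * D - real (l * M) * v\<bar>"
      proof -
        have "real l * \<bar>D - real M * v\<bar> = \<bar>real l * (D - real M * v)\<bar>" by (simp add: abs_mult)
        then show ?thesis by (simp add: right_diff_distrib)
      qed
      moreover have "\<bar>w (2 * real (l * M) * \<tau>) 0 - w 0 0 - real (l * M) * v\<bar> \<le> 3"
        using v[of "l * M"] unfolding a_def .
      ultimately show ?thesis using total[of l] phase[of l] by linarith
    qed
    then have "\<bar>D - real M * v\<bar> \<le> real n + 2" by (rule le_of_linear_growth_bound)
    moreover have "D / (2 * real M * \<tau>) - v / (2 * \<tau>) = (D - real M * v) / (2 * real M * \<tau>)"
      using m \<tau> M by (simp add: field_simps)
    moreover have "2 * real M * \<tau> > 0" using m \<tau> M by simp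
    ultimately show "\<bar>(u (t\<^sub>0 + 2 * of_int m * \<tau>) k - u t\<^sub>0 k) / (2 * of_int m * \<tau>) - v / (2 * \<tau>)\<bar>
             \<le> (real n + 2) / (2 * of_int m * \<tau>)"
      unfolding M D_def[symmetric] by (simp add: abs_divide divide_right_mono)
  qed
qed

lemma abs_quotient_diff_le_iff:
  fixes a v c P :: real
  assumes "P > 0"
  shows "\<bar>a / P - v\<bar> \<le> c / P \<longleftrightarrow> \<bar>a - P * v\<bar> \<le> c"
proof -
  have "a / P - v = (a - P * v) / P" using assms by (simp add: diff_divide_distrib)
  then show ?thesis using assms by (simp add: abs_divide divide_le_cancel)
qed

text \<open>
  Two candidates for the speed both describe \<open>w\<close> up to a bounded error over arbitrarily many periods, so
  they agree and the definite description in \<open>transport_speed\<close> is justified. From here on the speed can be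
  studied on a single ordered solution.
\<close>

lemma pulse_speed_realised_by_ordered_solution:
  assumes f: "mono (deriv W)" "locally_lipschitz (deriv W)"
    and g: "lipschitz (deriv V)" "\<And>x. deriv V (x + 1) = deriv V x" "\<And>x. \<bar>deriv V x\<bar> \<le> G"
    and \<tau>: "\<tau> > 0"
  obtains w where "chain_solution (deriv W) (deriv V) (step_pulse \<kappa> \<tau>) 0 w"
    "\<And>t. t \<ge> 0 \<Longrightarrow> ordered \<rho> (w t)"
    "\<And>k m. \<bar>w (2 * real m * \<tau>) k - w 0 k - 2 * real m * \<tau> * pulse_speed W V \<kappa> \<rho> \<tau>\<bar> \<le> 3"
proof -
  obtain w where w: "chain_solution (deriv W) (deriv V) (step_pulse \<kappa> \<tau>) 0 w"
    and ord: "\<And>t. t \<ge> 0 \<Longrightarrow> ordered \<rho> (w t)"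
    using ordered_solution_exists[OF f g \<tau>] by blast
  let ?is = "is_transport_speed W V (step_pulse \<kappa> \<tau>) \<tau> \<rho>"
  obtain v where v: "?is v"
    using transport_speed_exists[OF f g(1,2) \<tau> w ord]
    unfolding is_transport_speed_def is_solution_iff_chain_solution by blast
  have near: "\<bar>w (2 * real m * \<tau>) k - w 0 k - 2 * real m * \<tau> * v'\<bar> \<le> 3" if "?is v'" for v' k m
  proof (cases "m = 0")
    case True then show ?thesis by simp
  next
    case False
    have pos: "2 * real m * \<tau> > 0" using \<tau> False by simp
    have "\<bar>(w (0 + 2 * of_int (int m) * \<tau>) k - w 0 k) / (2 * of_int (int m) * \<tau>) - v'\<bar>
        \<le> (real 1 + 2) / (2 * of_int (int m) * \<tau>)"
      using that[unfolded is_transport_speed_def is_solution_iff_chain_solution, rule_format,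
          OF _ w, of 1 "int m" k] ordered_imp_bounded_width[OF ord, of 0] False by simp
    then show ?thesis using pos by (simp add: abs_quotient_diff_le_iff)
  qed
  have "v' = v" if "?is v'" for v'
  proof -
    have "real m * (2 * \<tau> * \<bar>v' - v\<bar>) \<le> real m * 0 + 6" for m
    proof -
      have "real m * (2 * \<tau> * \<bar>v' - v\<bar>) = \<bar>2 * real m * \<tau> * v' - 2 * real m * \<tau> * v\<bar>"
        using \<tau> by (simp add: abs_mult flip: right_diff_distrib)
      then show ?thesis using near[OF that, of m 0] near[OF v, of m 0] by linarith
    qed
    then have "2 * \<tau> * \<bar>v' - v\<bar> \<le> 0" by (rule le_of_linear_growth_bound)
    then show ?thesis using \<tau> by (simp add: mult_le_0_iff)
  qed
  then have "transport_speed W V (step_pulse \<kappa> \<tau>) \<tau> \<rho> = v"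
    unfolding transport_speed_def using v by (intro the_equality)
  then show ?thesis using that[OF w ord] near[OF v] unfolding pulse_speed_def by simp
qed

section \<open>Relaxation while the pulse is off\<close>

lemma sum_by_parts:
  fixes a F :: "int \<Rightarrow> real"
  shows "(\<Sum>k<N. a (int k) * (F (int k) - F (int k - 1))) =
    a (int N) * F (int N - 1) - a 0 * F (- 1) - (\<Sum>k<N. (a (int k + 1) - a (int k)) * F (int k))"
  by (induction N) (simp_all add: algebra_simps)

lemma ordered_spacing:
  assumes "ordered \<rho> x"
  shows "of_int \<lfloor>\<rho>\<rfloor> \<le> x (k + 1) - x k" "x (k + 1) - x k \<le> of_int \<lceil>\<rho>\<rceil>"
    "\<bar>x (k + 1) - x k - \<rho>\<bar> \<le> 1"
    "\<bar>(x (k + 1) - x k) - (x (j + 1) - x j)\<bar> \<le> 1"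
proof -
  have b: "of_int \<lfloor>\<rho>\<rfloor> \<le> x (k + 1) - x k \<and> x (k + 1) - x k \<le> of_int \<lceil>\<rho>\<rceil>" for k
    using assms[unfolded ordered_def, rule_format, of 1 k] by simp
  have c: "(of_int \<lceil>\<rho>\<rceil> :: real) \<le> of_int \<lfloor>\<rho>\<rfloor> + 1"
    using ceiling_diff_floor_le_1[of \<rho>] by linarith
  show "of_int \<lfloor>\<rho>\<rfloor> \<le> x (k + 1) - x k" "x (k + 1) - x k \<le> of_int \<lceil>\<rho>\<rceil>"
    using b by auto
  show "\<bar>x (k + 1) - x k - \<rho>\<bar> \<le> 1" using b[of k] by linarith
  show "\<bar>(x (k + 1) - x k) - (x (j + 1) - x j)\<bar> \<le> 1" using b[of k] b[of j] c by linarith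
qed

text \<open>
  With \<open>S0\<close> the sum of squares of the deviations from uniform spacing and \<open>S1\<close> the sum of squares of their
  increments, strong monotonicity of \<open>f\<close> makes \<open>S0 / 2\<close> decrease at rate at least \<open>d S1\<close>, while monotonicity
  makes \<open>S1\<close> itself decrease; both statements hold up to boundary terms that depend on \<open>T\<close> but not on the number
  \<open>N\<close> of particles. Therefore \<open>S0 / 2 + d (t - s\<^sub>0) S1\<close> is almost nonincreasing, and it is at most \<open>N / 2\<close> at
  the start. The second claim holds because the bond forces telescope.
\<close>

lemma relaxation_estimate:
  fixes w :: "real \<Rightarrow> int \<Rightarrow> real"
  assumes sol: "solves_on f g 0 s\<^sub>0 s\<^sub>1 w" and s: "s\<^sub>0 < s\<^sub>1"
    and ord: "\<And>t. t \<in> {s\<^sub>0..s\<^sub>1} \<Longrightarrow> ordered \<rho> (w t)"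
    and f: "mono f" and d: "d > 0" and strong: "\<And>x. (x - \<rho>) * (f x - f \<rho>) \<ge> d * (x - \<rho>)\<^sup>2"
    and D: "\<And>x y. \<bar>x - \<rho>\<bar> \<le> 1 \<Longrightarrow> \<bar>y - \<rho>\<bar> \<le> 1 \<Longrightarrow> \<bar>x - y\<bar> \<le> 1 \<Longrightarrow> \<bar>f x - f y\<bar> \<le> D"
  defines "T \<equiv> s\<^sub>1 - s\<^sub>0"
  shows "(\<Sum>k<N. (w s\<^sub>1 (int k + 1) - w s\<^sub>1 (int k) - \<rho>)\<^sup>2)
      \<le> real N / (2 * d * T) + (2 * (1 + D * T) * D + 4 * d * T * D) / d"
    and "(\<Sum>k<N. w s\<^sub>1 (int k) - w s\<^sub>0 (int k)) \<ge> - D * T"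
proof -
  have T: "T > 0" unfolding T_def using s by simp
  define F where "F = (\<lambda>t k. f (w t (k + 1) - w t k) - f \<rho>)"
  define y where "y = (\<lambda>t k. w t (k + 1) - w t k - \<rho>)"
  have D0: "D \<ge> 0" using D[of \<rho> \<rho>] by simp
  have y1: "\<bar>y t k\<bar> \<le> 1" if "t \<in> {s\<^sub>0..s\<^sub>1}" for t k
    unfolding y_def by (rule ordered_spacing(3)[OF ord[OF that]])
  have F_bound: "\<bar>F t k\<bar> \<le> D" if "t \<in> {s\<^sub>0..s\<^sub>1}" for t k
    unfolding F_def using y1[OF that, of k] by (intro D) (auto simp: y_def)
  have F_diff: "\<bar>F t k - F t j\<bar> \<le> D" if "t \<in> {s\<^sub>0..s\<^sub>1}" for t k j
  proof -
    have "\<bar>f (w t (k + 1) - w t k) - f (w t (j + 1) - w t j)\<bar> \<le> D"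
      using ordered_spacing[OF ord[OF that]] by (intro D) auto
    then show ?thesis unfolding F_def by simp
  qed
  have drift_eq: "drift f g 0 (w t) k = F t k - F t (k - 1)" for t k
    unfolding drift_def F_def by simp
  have deriv: "((\<lambda>t. w t k) has_real_derivative F t k - F t (k - 1)) (at t)" if "t \<in> {s\<^sub>0<..<s\<^sub>1}" for t k
    using sol that unfolding solves_on_def drift_eq by blast
  have cont: "continuous_on {s\<^sub>0..s} (\<lambda>t. w t k)" if "s \<le> s\<^sub>1" for k s
    using sol that unfolding solves_on_def by (auto intro: continuous_on_subset)

  have drop: "(\<Sum>k<N. w s\<^sub>0 (int k)) \<le> (\<Sum>k<N. w s\<^sub>1 (int k)) + D * (s\<^sub>1 - s\<^sub>0)"
  proof -
    have "(\<Sum>k<N. w s\<^sub>0 (int k)) + D * (s\<^sub>0 - s\<^sub>0) \<le> (\<Sum>k<N. w s\<^sub>1 (int k)) + D * (s\<^sub>1 - s\<^sub>0)"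
    proof (rule DERIV_nonneg_imp_increasing_open[of s\<^sub>0 s\<^sub>1 "\<lambda>t. (\<Sum>k<N. w t (int k)) + D * (t - s\<^sub>0)"])
      fix t assume "s\<^sub>0 < t" "t < s\<^sub>1"
      then have t: "t \<in> {s\<^sub>0<..<s\<^sub>1}" "t \<in> {s\<^sub>0..s\<^sub>1}" by auto
      have tel: "(\<Sum>k<N. F t (int k) - F t (int k - 1)) = F t (int N - 1) - F t (- 1)"
        by (induction N) simp_all
      show "\<exists>z. ((\<lambda>t. (\<Sum>k<N. w t (int k)) + D * (t - s\<^sub>0)) has_real_derivative z) (at t) \<and> 0 \<le> z"
      proof (intro exI conjI)
        show "((\<lambda>t. (\<Sum>k<N. w t (int k)) + D * (t - s\<^sub>0)) has_real_derivative
            (\<Sum>k<N. F t (int k) - F t (int k - 1)) + D * 1) (at t)"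
          by (intro derivative_intros DERIV_cmult DERIV_sum deriv t) (auto intro!: derivative_eq_intros)
        show "0 \<le> (\<Sum>k<N. F t (int k) - F t (int k - 1)) + D * 1"
          unfolding tel using F_diff[OF t(2), of "int N - 1" "- 1"] by linarith
      qed
    qed (use s in \<open>auto intro!: continuous_intros cont\<close>)
    then show ?thesis by simp
  qed
  then show "(\<Sum>k<N. w s\<^sub>1 (int k) - w s\<^sub>0 (int k)) \<ge> - D * T"
    unfolding T_def by (simp add: sum_subtractf)

  define x where "x = w s\<^sub>0 0"
  define a where "a = (\<lambda>t k. w t k - of_int k * \<rho> - x)"
  have a_diff: "a t (k + 1) - a t k = y t k" for t k unfolding a_def y_def by (simp add: algebra_simps)
  have width: "\<bar>w t k - w t 0 - of_int k * \<rho>\<bar> \<le> 1" if "t \<in> {s\<^sub>0..s\<^sub>1}" for t k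
    using bounded_width_two_sided[OF ordered_imp_bounded_width[OF ord[OF that]], of k 0] by simp
  have particle0: "\<bar>w t 0 - x\<bar> \<le> D * T" if "t \<in> {s\<^sub>0..s\<^sub>1}" for t
  proof -
    have up: "w s\<^sub>0 0 + D * (s\<^sub>0 - s\<^sub>0) \<le> w t 0 + D * (t - s\<^sub>0)"
    proof (rule DERIV_nonneg_imp_increasing_open[of s\<^sub>0 t "\<lambda>t. w t 0 + D * (t - s\<^sub>0)"])
      fix r assume "s\<^sub>0 < r" "r < t"
      then have r: "r \<in> {s\<^sub>0<..<s\<^sub>1}" "r \<in> {s\<^sub>0..s\<^sub>1}" using that by auto
      show "\<exists>z. ((\<lambda>t. w t 0 + D * (t - s\<^sub>0)) has_real_derivative z) (at r) \<and> 0 \<le> z"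
        using F_diff[OF r(2), of 0 "-1"] deriv[OF r(1), of 0]
        by (intro exI[of _ "F r 0 - F r (- 1) + D * 1"] conjI DERIV_add DERIV_cmult)
          (auto intro!: derivative_eq_intros)
    qed (use that in \<open>auto intro!: continuous_intros cont\<close>)
    have down: "D * (s\<^sub>0 - s\<^sub>0) - w s\<^sub>0 0 \<le> D * (t - s\<^sub>0) - w t 0"
    proof (rule DERIV_nonneg_imp_increasing_open[of s\<^sub>0 t "\<lambda>t. D * (t - s\<^sub>0) - w t 0"])
      fix r assume "s\<^sub>0 < r" "r < t"
      then have r: "r \<in> {s\<^sub>0<..<s\<^sub>1}" "r \<in> {s\<^sub>0..s\<^sub>1}" using that by auto
      show "\<exists>z. ((\<lambda>t. D * (t - s\<^sub>0) - w t 0) has_real_derivative z) (at r) \<and> 0 \<le> z"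
        using F_diff[OF r(2), of 0 "-1"] deriv[OF r(1), of 0]
        by (intro exI[of _ "D * 1 - (F r 0 - F r (- 1))"] conjI DERIV_diff DERIV_cmult)
          (auto intro!: derivative_eq_intros)
    qed (use that in \<open>auto intro!: continuous_intros cont\<close>)
    have "D * (t - s\<^sub>0) \<le> D * T" unfolding T_def using that D0 by (intro mult_left_mono) auto
    then show ?thesis using up down unfolding x_def by simp
  qed
  have a_bound: "\<bar>a t k\<bar> \<le> 1 + D * T" if "t \<in> {s\<^sub>0..s\<^sub>1}" for t k
    using width[OF that, of k] particle0[OF that] unfolding a_def by linarith
  have a_start: "\<bar>a s\<^sub>0 k\<bar> \<le> 1" for k
    using width[of s\<^sub>0 k] s unfolding a_def x_def by simp
  define S0 where "S0 = (\<lambda>t. \<Sum>k<N. (a t (int k))\<^sup>2)"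
  define S1 where "S1 = (\<lambda>t. \<Sum>k<N. (y t (int k))\<^sup>2)"
  define C where "C = 2 * (1 + D * T) * D + 4 * d * T * D"
  \<comment> \<open>The term with \<open>C\<close> absorbs the boundary contributions, so that \<open>E\<close> is nonincreasing.\<close>
  define E where "E = (\<lambda>t. S0 t / 2 + d * (t - s\<^sub>0) * S1 t - C * (t - s\<^sub>0))"
  have "E s\<^sub>1 \<le> E s\<^sub>0"
  proof (rule DERIV_nonpos_imp_decreasing_open[of s\<^sub>0 s\<^sub>1 E])
    fix t assume "s\<^sub>0 < t" "t < s\<^sub>1"
    then have t: "t \<in> {s\<^sub>0<..<s\<^sub>1}" "t \<in> {s\<^sub>0..s\<^sub>1}" and tT: "t - s\<^sub>0 \<le> T" "t - s\<^sub>0 > 0"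
      unfolding T_def by auto
    define P where "P = (\<Sum>k<N. a t (int k) * (F t (int k) - F t (int k - 1)))"
    define Gr where "Gr = (\<lambda>k. F t (k + 1) - F t k)"
    define Q where "Q = (\<Sum>k<N. y t (int k) * (Gr (int k) - Gr (int k - 1)))"
    have dS0: "(S0 has_real_derivative (\<Sum>k<N. 2 * (a t (int k) * (F t (int k) - F t (int k - 1))))) (at t)"
      unfolding S0_def a_def
      by (rule DERIV_sum) (auto intro!: derivative_eq_intros deriv[OF t(1)])
    have dS1: "(S1 has_real_derivative (\<Sum>k<N. 2 * (y t (int k) * (Gr (int k) - Gr (int k - 1))))) (at t)"
      unfolding S1_def y_def Gr_def
    proof (rule DERIV_sum)
      fix k :: nat
      have "((\<lambda>t. w t (int k + 1) - w t (int k) - \<rho>) has_real_derivative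
          F t (int k + 1) - F t (int k) - (F t (int k) - F t (int k - 1))) (at t)"
        using DERIV_diff[OF DERIV_diff[OF deriv[OF t(1), of "int k + 1"] deriv[OF t(1), of "int k"]] DERIV_const[of \<rho>]]
        by simp
      from DERIV_power[OF this, of 2]
      show "((\<lambda>t. (w t (int k + 1) - w t (int k) - \<rho>)\<^sup>2) has_real_derivative
          2 * ((w t (int k + 1) - w t (int k) - \<rho>) *
            (F t (int k + 1) - F t (int k) - (F t (int k - 1 + 1) - F t (int k - 1))))) (at t)"
        by (simp add: mult_ac)
    qed
    have "(E has_real_derivative (\<Sum>k<N. 2 * (a t (int k) * (F t (int k) - F t (int k - 1)))) / 2 +
        (d * (t - s\<^sub>0) * (\<Sum>k<N. 2 * (y t (int k) * (Gr (int k) - Gr (int k - 1)))) + d * S1 t) - C) (at t)"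
      unfolding E_def by (auto intro!: derivative_eq_intros dS0 dS1)
    then have dE: "(E has_real_derivative P + (d * (t - s\<^sub>0) * (2 * Q) + d * S1 t) - C) (at t)"
      unfolding P_def Q_def by (simp add: sum_distrib_left[symmetric])
    have "(\<Sum>k<N. y t (int k) * F t (int k)) \<ge> (\<Sum>k<N. d * (y t (int k))\<^sup>2)"
      using strong[of "w t (k + 1) - w t k" for k] unfolding y_def F_def by (intro sum_mono) auto
    then have diss0: "(\<Sum>k<N. y t (int k) * F t (int k)) \<ge> d * S1 t"
      unfolding S1_def by (simp add: sum_distrib_left)
    have P: "P = a t (int N) * F t (int N - 1) - a t 0 * F t (- 1) - (\<Sum>k<N. y t (int k) * F t (int k))"
      unfolding P_def using sum_by_parts[of "a t" "F t" N] by (simp add: a_diff)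
    have "\<bar>a t (int N) * F t (int N - 1)\<bar> \<le> (1 + D * T) * D" "\<bar>a t 0 * F t (- 1)\<bar> \<le> (1 + D * T) * D"
      unfolding abs_mult using a_bound[OF t(2)] F_bound[OF t(2)] D0 T by (auto intro!: mult_mono)
    then have P_le: "P \<le> 2 * (1 + D * T) * D - d * S1 t" using P diss0 by linarith
    have "(\<Sum>k<N. (y t (int k + 1) - y t (int k)) * Gr (int k)) \<ge> 0"
    proof (rule sum_nonneg)
      fix k
      show "(y t (int k + 1) - y t (int k)) * Gr (int k) \<ge> 0"
        unfolding y_def Gr_def F_def using f unfolding mono_def
        by (cases "w t (int k + 1) - w t (int k) \<le> w t (int k + 1 + 1) - w t (int k + 1)")
          (auto simp: zero_le_mult_iff)
    qed
    moreover have "Q = y t (int N) * Gr (int N - 1) - y t 0 * Gr (- 1)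
        - (\<Sum>k<N. (y t (int k + 1) - y t (int k)) * Gr (int k))"
      unfolding Q_def by (rule sum_by_parts)
    moreover have "\<bar>y t i * Gr j\<bar> \<le> D" for i j
      using mult_mono[OF y1[OF t(2), of i] F_diff[OF t(2), of "j + 1" j]]
      unfolding abs_mult Gr_def by simp
    note this[of "int N" "int N - 1"] this[of 0 "- 1"]
    ultimately have "Q \<le> 2 * D" by linarith
    then have "d * (t - s\<^sub>0) * (2 * Q) \<le> d * (t - s\<^sub>0) * (2 * (2 * D))"
      using d tT by (intro mult_left_mono) auto
    also have "\<dots> \<le> d * T * (2 * (2 * D))"
      using d tT D0 by (intro mult_right_mono mult_left_mono) auto
    finally have "P + (d * (t - s\<^sub>0) * (2 * Q) + d * S1 t) - C \<le> 0"
      using P_le unfolding C_def by linarith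
    then show "\<exists>z. (E has_real_derivative z) (at t) \<and> z \<le> 0" using dE by blast
  next
    show "continuous_on {s\<^sub>0..s\<^sub>1} E"
      unfolding E_def S0_def S1_def a_def y_def by (intro continuous_intros cont) auto
  qed (use s in auto)
  moreover have "E s\<^sub>0 \<le> real N / 2"
  proof -
    have "S0 s\<^sub>0 \<le> (\<Sum>k<N. 1)" unfolding S0_def
      using a_start by (intro sum_mono) (simp add: abs_square_le_1)
    then show ?thesis unfolding E_def by simp
  qed
  moreover have "S0 s\<^sub>1 \<ge> 0" unfolding S0_def by (intro sum_nonneg) auto
  ultimately have "d * T * S1 s\<^sub>1 \<le> real N / 2 + C * T"
    unfolding E_def T_def by simp
  then have "S1 s\<^sub>1 \<le> (real N / 2 + C * T) / (d * T)"
    using d T by (simp add: pos_le_divide_eq mult.commute)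
  also have "\<dots> = real N / (2 * d * T) + C / d"
    using d T by (simp add: field_simps)
  finally show "(\<Sum>k<N. (w s\<^sub>1 (int k + 1) - w s\<^sub>1 (int k) - \<rho>)\<^sup>2)
      \<le> real N / (2 * d * T) + (2 * (1 + D * T) * D + 4 * d * T * D) / d"
    unfolding S1_def y_def C_def .
qed

section \<open>Displacement while the pulse is on\<close>

text \<open>
  A function that does not decrease while its value lies in \<open>[c, e]\<close> cannot reach \<open>c\<close> from above: just before
  the first time at \<open>c\<close> its values lie in this band.
\<close>

lemma stays_above:
  fixes h h' :: "real \<Rightarrow> real"
  assumes s: "s\<^sub>0 \<le> s\<^sub>1" and cont: "continuous_on {s\<^sub>0..s\<^sub>1} h"
    and d: "\<And>t. t \<in> {s\<^sub>0<..<s\<^sub>1} \<Longrightarrow> (h has_real_derivative h' t) (at t)"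
    and push: "\<And>t. t \<in> {s\<^sub>0<..<s\<^sub>1} \<Longrightarrow> c \<le> h t \<Longrightarrow> h t \<le> e \<Longrightarrow> h' t \<ge> 0"
    and ce: "c < e" and start: "h s\<^sub>0 > c"
  shows "h s\<^sub>1 > c"
proof (rule ccontr)
  assume "\<not> h s\<^sub>1 > c"
  define B where "B = {s\<^sub>0..s\<^sub>1} \<inter> h -` {..c}"
  have "closed B" unfolding B_def by (rule continuous_closed_preimage[OF cont]) auto
  then have "compact B" using closed_Int_compact[of B "{s\<^sub>0..s\<^sub>1}"] unfolding B_def
    by (metis compact_Icc inf.absorb1 inf_le1)
  moreover have "s\<^sub>1 \<in> B" using \<open>\<not> h s\<^sub>1 > c\<close> s unfolding B_def by auto
  ultimately obtain b where b: "b \<in> B" and least: "\<And>t. t \<in> B \<Longrightarrow> b \<le> t"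
    using compact_attains_inf[of B] by auto
  have bs: "s\<^sub>0 < b" "b \<le> s\<^sub>1" "h b \<le> c" using b start unfolding B_def by (auto simp: less_le)
  have before: "h t > c" if "t \<in> {s\<^sub>0..<b}" for t
    using least[of t] that bs unfolding B_def by force
  have "\<exists>\<delta>>0. \<forall>t\<in>{s\<^sub>0..s\<^sub>1}. dist t b < \<delta> \<longrightarrow> dist (h t) (h b) < e - c"
    using cont bs ce unfolding continuous_on_iff by (metis atLeastAtMost_iff diff_gt_0_iff_gt less_imp_le)
  then obtain \<delta> where \<delta>: "\<delta> > 0" "\<And>t. t \<in> {s\<^sub>0..s\<^sub>1} \<Longrightarrow> dist t b < \<delta> \<Longrightarrow> dist (h t) (h b) < e - c" by blast
  define r where "r = max s\<^sub>0 (b - \<delta> / 2)"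
  have r: "s\<^sub>0 \<le> r" "r < b" using bs \<delta> unfolding r_def by auto
  have "h r \<le> h b"
  proof (rule DERIV_nonneg_imp_increasing_open[of r b h])
    fix t assume t: "r < t" "t < b"
    then have "t \<in> {s\<^sub>0..s\<^sub>1}" "t \<in> {s\<^sub>0<..<s\<^sub>1}" "dist t b < \<delta>"
      using r bs unfolding r_def dist_real_def by auto
    moreover have "h t \<le> e" using \<delta>(2)[OF calculation(1,3)] bs unfolding dist_real_def by linarith
    moreover have "h t \<ge> c" using before[of t] t r by auto
    ultimately show "\<exists>z. (h has_real_derivative z) (at t) \<and> 0 \<le> z" using d push by blast
  next
    show "continuous_on {r..b} h" using cont r bs by (auto intro: continuous_on_subset)
  qed (use r in auto)
  moreover have "h r > c" using before r by auto
  ultimately show False using bs by linarith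
qed

lemma pushed_past:
  fixes h h' :: "real \<Rightarrow> real"
  assumes s: "s\<^sub>0 \<le> s\<^sub>1" and cont: "continuous_on {s\<^sub>0..s\<^sub>1} h"
    and d: "\<And>t. t \<in> {s\<^sub>0<..<s\<^sub>1} \<Longrightarrow> (h has_real_derivative h' t) (at t)"
    and push: "\<And>t. t \<in> {s\<^sub>0<..<s\<^sub>1} \<Longrightarrow> c \<le> h t \<Longrightarrow> h t \<le> e \<Longrightarrow> h' t \<ge> \<beta>"
    and \<beta>: "\<beta> > 0" and ce: "c < e" and start: "h s\<^sub>0 > c" and time: "\<beta> * (s\<^sub>1 - s\<^sub>0) \<ge> e - c"
  shows "h s\<^sub>1 \<ge> e"
proof (rule ccontr)
  assume neg: "\<not> h s\<^sub>1 \<ge> e"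
  have sub: "continuous_on {r..r'} h" if "s\<^sub>0 \<le> r" "r' \<le> s\<^sub>1" for r r'
    using cont that by (auto intro: continuous_on_subset)
  have above: "h t > c" if "t \<in> {s\<^sub>0..s\<^sub>1}" for t
    by (rule stays_above[of s\<^sub>0 t h h' c e])
      (use that sub d push \<beta> ce start in \<open>auto intro: order_trans[OF less_imp_le[OF \<beta>]]\<close>)
  have below: "h t < e" if t: "t \<in> {s\<^sub>0..s\<^sub>1}" for t
  proof (rule ccontr)
    assume "\<not> h t < e"
    \<comment> \<open>Once \<open>h\<close> has reached \<open>e\<close>, it stays above every level \<open>m < e\<close>, in particular above its supposed final value.\<close>
    define m where "m = max c (h s\<^sub>1)"
    have m: "c \<le> m" "m < e" "h s\<^sub>1 \<le> m" using neg ce unfolding m_def by auto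
    have "h s\<^sub>1 > m"
      by (rule stays_above[of t s\<^sub>1 h h' m e])
        (use t sub d push \<beta> m \<open>\<not> h t < e\<close> in \<open>auto intro: order_trans[OF less_imp_le[OF \<beta>]]\<close>)
    then show False using m by simp
  qed
  have "h s\<^sub>0 - \<beta> * s\<^sub>0 \<le> h s\<^sub>1 - \<beta> * s\<^sub>1"
  proof (rule DERIV_nonneg_imp_increasing_open[of s\<^sub>0 s\<^sub>1 "\<lambda>t. h t - \<beta> * t"])
    fix t assume t: "s\<^sub>0 < t" "t < s\<^sub>1"
    have "((\<lambda>t. h t - \<beta> * t) has_real_derivative h' t - \<beta>) (at t)"
      using d t by (auto intro!: derivative_eq_intros)
    moreover have "h' t \<ge> \<beta>" using push[of t] above[of t] below[of t] t by auto
    ultimately show "\<exists>z. ((\<lambda>t. h t - \<beta> * t) has_real_derivative z) (at t) \<and> 0 \<le> z"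
      by (intro exI[of _ "h' t - \<beta>"]) auto
  qed (use s cont in \<open>auto intro!: continuous_intros\<close>)
  then show False using time start neg by (simp add: algebra_simps)
qed

text \<open>
  The force acts on all integer translates of \<open>[a', b]\<close>. The particle starts in the fundamental domain
  \<open>[a + l, a + l + 1)\<close> and is driven past \<open>b + l\<close>; if it starts beyond \<open>b + l\<close>, it may move back, but not below
  that point. The margin \<open>a' < a\<close> is needed for a start exactly at \<open>a + l\<close>.
\<close>

lemma displacement_under_force:
  fixes w :: "real \<Rightarrow> int \<Rightarrow> real"
  assumes sol: "solves_on f g \<kappa> s\<^sub>0 s\<^sub>1 w" and s: "s\<^sub>0 \<le> s\<^sub>1"
    and low: "\<And>t k. t \<in> {s\<^sub>0..s\<^sub>1} \<Longrightarrow> f (w t (k + 1) - w t k) - f (w t k - w t (k - 1)) \<ge> - D"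
    and per: "\<And>x (l::int). g (x + of_int l) = g x"
    and force: "\<And>x. x \<in> {a'..b} \<Longrightarrow> \<kappa> * g x \<ge> D + \<beta>"
    and \<beta>: "\<beta> > 0" and a: "a' < a" "a \<le> b" and time: "\<beta> * (s\<^sub>1 - s\<^sub>0) \<ge> b - a'"
  shows "w s\<^sub>1 k - w s\<^sub>0 k \<ge> b - a - frac (w s\<^sub>0 k - a)"
proof -
  define l where "l = \<lfloor>w s\<^sub>0 k - a\<rfloor>"
  have "w s\<^sub>1 k \<ge> b + of_int l"
  proof (rule pushed_past[of s\<^sub>0 s\<^sub>1 "\<lambda>t. w t k" "\<lambda>t. drift f g \<kappa> (w t) k" "a' + of_int l" "b + of_int l" \<beta>])
    fix t assume t: "t \<in> {s\<^sub>0<..<s\<^sub>1}" and h: "a' + of_int l \<le> w t k" "w t k \<le> b + of_int l"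
    have "\<kappa> * g (w t k - of_int l) \<ge> D + \<beta>" using h by (intro force) auto
    moreover have "g (w t k - of_int l) = g (w t k)" using per[of "w t k - of_int l" l] by simp
    ultimately show "\<beta> \<le> drift f g \<kappa> (w t) k"
      using low[of t k] t unfolding drift_def by auto
  next
    have "of_int l \<le> w s\<^sub>0 k - a" unfolding l_def by linarith
    then show "a' + of_int l < w s\<^sub>0 k" using a by simp
  qed (use sol s \<beta> a time in \<open>auto simp: solves_on_def\<close>)
  then show ?thesis unfolding l_def frac_def by simp
qed

section \<open>Phases near a rational lattice\<close>

lemma frac_perturb_le:
  fixes z s :: real
  assumes "0 \<le> s" "s \<le> \<sigma>"
  shows "frac (z - s) \<le> frac z + (if frac z < \<sigma> then 1 else 0)"
proof (cases "s \<le> frac z")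
  case True
  then have "\<lfloor>z - s\<rfloor> = \<lfloor>z\<rfloor>" using assms unfolding frac_def by (intro floor_unique) linarith+
  then show ?thesis using assms by (simp add: frac_def)
next
  case False
  have "frac (z - s) \<le> frac z + 1" using frac_lt_1[of "z - s"] frac_ge_0[of z] by linarith
  then show ?thesis using False assms by simp
qed

lemma bij_betw_mult_mod:
  fixes p m :: int and q :: nat
  assumes q: "q \<ge> 1" and p: "coprime p (int q)"
  shows "bij_betw (\<lambda>j. nat ((m + int j * p) mod int q)) {..<q} {..<q}"
proof -
  have "inj_on (\<lambda>j. nat ((m + int j * p) mod int q)) {..<q}"
  proof (rule inj_onI)
    fix i j assume ij: "i \<in> {..<q}" "j \<in> {..<q}"
      and "nat ((m + int i * p) mod int q) = nat ((m + int j * p) mod int q)"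
    then have "(m + int i * p) mod int q = (m + int j * p) mod int q"
      using q by (simp add: nat_eq_iff)
    then have "int q dvd (m + int i * p) - (m + int j * p)" by (simp add: mod_eq_dvd_iff)
    then have "int q dvd (int i - int j) * p" by (simp add: algebra_simps)
    then have "int q dvd int i - int j" using p by (simp add: coprime_dvd_mult_left_iff coprime_commute)
    then show "i = j" using ij zdvd_imp_le[of "int q" "int i - int j"] zdvd_imp_le[of "int q" "int j - int i"]
      by (cases i j rule: linorder_cases) (auto simp: dvd_diff_commute)
  qed
  moreover have "(\<lambda>j. nat ((m + int j * p) mod int q)) ` {..<q} \<subseteq> {..<q}"
    using q by (auto simp: nat_less_iff)
  ultimately show ?thesis unfolding bij_betw_def by (simp add: card_image card_subset_eq)
qed

lemma frac_of_lattice_point: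
  fixes x :: real and p :: int and q :: nat
  assumes q: "q \<ge> 1"
  shows "frac (x + real j * of_int p / real q) =
    (real (nat ((\<lfloor>real q * x\<rfloor> + int j * p) mod int q)) + frac (real q * x)) / real q"
proof -
  define n where "n = \<lfloor>real q * x\<rfloor> + int j * p"
  define i where "i = n mod int q"
  have i: "0 \<le> i" "i < int q" using q unfolding i_def by auto
  have "n = (n div int q) * int q + i" unfolding i_def by simp
  then have "(of_int n :: real) = of_int (n div int q) * real q + of_int i"
    by (metis of_int_add of_int_mult of_int_of_nat_eq)
  moreover have "real q * x = of_int \<lfloor>real q * x\<rfloor> + frac (real q * x)" by (simp add: frac_def)
  then have "real q * (x + real j * of_int p / real q) = of_int n + frac (real q * x)"
    using q unfolding n_def by (simp add: distrib_left)
  moreover have cancel: "real q * (a + b / real q) = a * real q + b" for a b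
    using q by (simp add: distrib_left)
  ultimately have "real q * (x + real j * of_int p / real q)
      = real q * (of_int (n div int q) + (of_int i + frac (real q * x)) / real q)"
    using cancel[of "of_int (n div int q)" "of_int i + frac (real q * x)"] by simp
  then have "x + real j * of_int p / real q
      = of_int (n div int q) + (of_int i + frac (real q * x)) / real q"
    using q by (subst (asm) mult_cancel_left) auto
  moreover have "0 \<le> (of_int i + frac (real q * x)) / real q" using i q frac_ge_0[of "real q * x"] by simp
  moreover have "(of_int i + frac (real q * x)) / real q < 1"
  proof -
    have "of_int i \<le> real q - 1" using i by linarith
    then have "of_int i + frac (real q * x) < real q" using frac_lt_1[of "real q * x"] by linarith
    then show ?thesis using q by simp
  qed
  ultimately have "frac (x + real j * of_int p / real q) = (of_int i + frac (real q * x)) / real q"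
    by (simp add: frac_unique_iff)
  moreover have "real (nat i) = of_int i" using i by simp
  ultimately show ?thesis unfolding i_def n_def by simp
qed

text \<open>
  On the exact lattice the fractional parts are \<open>(i + \<phi>) / q\<close> with a common offset \<open>\<phi> < 1\<close>, and their sum is
  \<open>(q - 1) / 2 + \<phi>\<close>. A perturbation of size \<open>\<eta>\<close> is treated as a backward shift by at most \<open>2 \<eta>\<close> from the
  lattice translated by \<open>\<eta>\<close>. Such a shift increases a fractional part only by crossing an integer, by at
  most \<open>1\<close>. The points that can cross are those with \<open>i < 2 \<eta> q - \<phi>\<close>; there are at most \<open>1 - \<phi> + 2 \<eta> q\<close> of
  them, so that \<open>\<phi>\<close> cancels.
\<close>

lemma sum_frac_near_lattice_le:
  fixes x \<eta> :: real and y :: "nat \<Rightarrow> real" and p :: int and q :: nat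
  assumes q: "q \<ge> 1" and p: "coprime p (int q)"
    and near: "\<And>j. j < q \<Longrightarrow> \<bar>y j - (x + real j * of_int p / real q)\<bar> \<le> \<eta>"
  shows "(\<Sum>j<q. frac (y j)) \<le> (real q - 1) / 2 + 1 + 2 * \<eta> * real q"
proof -
  define X where "X = x + \<eta>"
  define \<phi> where "\<phi> = frac (real q * X)"
  define h where "h = (\<lambda>i::nat. (real i + \<phi>) / real q)"
  \<comment> \<open>Penalty for the lattice points that may cross an integer under the backward shift.\<close>
  define pen where "pen = (\<lambda>i::nat. if h i < 2 * \<eta> then 1 else 0 :: real)"
  have eta0: "\<eta> \<ge> 0" using near[of 0] q by fastforce
  have phi: "0 \<le> \<phi>" "\<phi> < 1" unfolding \<phi>_def by (auto simp: frac_lt_1)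
  have "(\<Sum>j<q. frac (y j)) \<le> (\<Sum>j<q. (\<lambda>i. h i + pen i) (nat ((\<lfloor>real q * X\<rfloor> + int j * p) mod int q)))"
  proof (rule sum_mono)
    fix j assume "j \<in> {..<q}"
    then have j: "j < q" by simp
    define z where "z = X + real j * of_int p / real q"
    have z: "frac z = h (nat ((\<lfloor>real q * X\<rfloor> + int j * p) mod int q))"
      unfolding z_def h_def \<phi>_def by (rule frac_of_lattice_point[OF q])
    have "frac (z - (z - y j)) \<le> frac z + (if frac z < 2 * \<eta> then 1 else 0)"
      by (rule frac_perturb_le) (use near[OF j] in \<open>auto simp: z_def X_def abs_le_iff\<close>)
    then show "frac (y j) \<le> (\<lambda>i. h i + pen i) (nat ((\<lfloor>real q * X\<rfloor> + int j * p) mod int q))"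
      unfolding pen_def z[symmetric] by simp
  qed
  also have "\<dots> = (\<Sum>i<q. h i + pen i)"
    by (rule sum.reindex_bij_betw[OF bij_betw_mult_mod[OF q p]])
  also have "\<dots> = (\<Sum>i<q. h i) + (\<Sum>i<q. pen i)" by (rule sum.distrib)
  also have "(\<Sum>i<q. h i) = (real q - 1) / 2 + \<phi>"
  proof -
    have "(\<Sum>i<q. h i) = ((\<Sum>i<q. real i) + real q * \<phi>) / real q"
      unfolding h_def by (simp add: sum.distrib flip: sum_divide_distrib)
    also have "(\<Sum>i<q. real i) = real q * (real q - 1) / 2"
      by (induction q) (auto simp: field_simps)
    finally have "(\<Sum>i<q. h i) = real q * ((real q - 1) / 2 + \<phi>) / real q"
      by (simp add: algebra_simps)
    then show ?thesis using q by simp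
  qed
  also have "(\<Sum>i<q. pen i) \<le> 1 - \<phi> + 2 * \<eta> * real q"
  proof -
    have cond: "h i < 2 * \<eta> \<longleftrightarrow> real i < 2 * \<eta> * real q - \<phi>" for i
      unfolding h_def using q by (simp add: field_simps)
    have "(\<Sum>i<q. pen i) = real (card {i. i < q \<and> h i < 2 * \<eta>})"
      unfolding pen_def by (simp add: sum.If_cases Int_def lessThan_def conj_commute)
    also have "\<dots> \<le> 1 - \<phi> + 2 * \<eta> * real q"
    proof (cases "2 * \<eta> * real q - \<phi> > 0")
      case False
      then have "{i. i < q \<and> h i < 2 * \<eta>} = {}" unfolding cond by auto
      then have "card {i. i < q \<and> h i < 2 * \<eta>} = 0" by (simp only: card.empty)
      moreover have "2 * \<eta> * real q \<ge> 0" using eta0 by simp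
      ultimately show ?thesis using phi by linarith
    next
      case True
      have "{i. i < q \<and> h i < 2 * \<eta>} \<subseteq> {..<nat \<lceil>2 * \<eta> * real q - \<phi>\<rceil>}"
        unfolding cond using True by (auto simp: less_ceiling_iff zless_nat_eq_int_zless)
      then have "card {i. i < q \<and> h i < 2 * \<eta>} \<le> nat \<lceil>2 * \<eta> * real q - \<phi>\<rceil>"
        by (metis card_lessThan card_mono finite_lessThan)
      then have "real (card {i. i < q \<and> h i < 2 * \<eta>}) \<le> of_int \<lceil>2 * \<eta> * real q - \<phi>\<rceil>"
        using True by (simp add: nat_le_iff le_nat_iff)
      then show ?thesis by linarith
    qed
    finally show ?thesis .
  qed
  finally show ?thesis by simp
qed

section \<open>A lower bound for the transport speed\<close>

lemma abs_le_weighted_square: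
  fixes z s :: real
  assumes "s > 0"
  shows "\<bar>z\<bar> \<le> (s * z\<^sup>2 + 1 / s) / 2"
proof -
  have "0 \<le> (s * \<bar>z\<bar> - 1)\<^sup>2 / s" using assms by simp
  also have "(s * \<bar>z\<bar> - 1)\<^sup>2 / s = s * z\<^sup>2 + 1 / s - 2 * \<bar>z\<bar>"
    using assms by (simp add: power2_diff power_mult_distrib field_simps) (simp add: power2_eq_square)
  finally show ?thesis by simp
qed

text \<open>
  Within a block of \<open>q\<close> particles the configuration differs from the lattice through its first particle
  by the accumulated spacing deviations plus \<open>|q \<rho> - p|\<close>. As \<open>sum_frac_near_lattice_le\<close> is linear in the
  error, only the average spacing deviation over all blocks matters.
\<close>

lemma block_sum_frac_le:
  fixes x :: "int \<Rightarrow> real"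
  assumes q: "q \<ge> 1" and p: "coprime p (int q)"
  shows "(\<Sum>k<M * q. frac (x (int k) - a)) \<le>
    real M * ((real q - 1) / 2 + 1 + 2 * \<bar>real q * \<rho> - of_int p\<bar> * real q)
      + 2 * real q * (\<Sum>k<M * q. \<bar>x (int k + 1) - x (int k) - \<rho>\<bar>)"
proof -
  define e where "e = \<bar>real q * \<rho> - of_int p\<bar>"
  define z where "z = (\<lambda>k::nat. \<bar>x (int k + 1) - x (int k) - \<rho>\<bar>)"
  have group: "(\<Sum>k<M * q. h k) = (\<Sum>m<M. \<Sum>j<q. h (m * q + j))" for h :: "nat \<Rightarrow> real"
  proof -
    have "(\<Sum>k<M * q. h k) = (\<Sum>m<M. sum h {m * q..<m * q + q})" by (rule sum.nat_group[symmetric])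
    also have "\<dots> = (\<Sum>m<M. \<Sum>j<q. h (m * q + j))"
      using sum.shift_bounds_nat_ivl[of h 0 "m * q" q for m]
      by (simp add: add.commute atLeast0LessThan)
    finally show ?thesis .
  qed
  have block: "(\<Sum>j<q. frac (x (int (m * q + j)) - a)) \<le>
      (real q - 1) / 2 + 1 + 2 * (e + (\<Sum>j<q. z (m * q + j))) * real q" for m
  proof (rule sum_frac_near_lattice_le[OF q p, where x = "x (int (m * q)) - a"])
    fix j assume j: "j < q"
    have "\<bar>x (int (m * q + i)) - x (int (m * q)) - real i * \<rho>\<bar> \<le> (\<Sum>l<i. z (m * q + l))" for i
    proof (induction i)
      case 0 then show ?case by simp
    next
      case (Suc i)
      have "\<bar>x (int (m * q + Suc i)) - x (int (m * q + i)) - \<rho>\<bar> = z (m * q + i)"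
        unfolding z_def by (simp add: algebra_simps)
      then show ?case using Suc by (simp add: algebra_simps)
    qed
    from this[of j] have "\<bar>x (int (m * q + j)) - x (int (m * q)) - real j * \<rho>\<bar> \<le> (\<Sum>l<j. z (m * q + l))" .
    also have "\<dots> \<le> (\<Sum>l<q. z (m * q + l))"
      using j by (intro sum_mono2) (auto simp: z_def)
    finally have 1: "\<bar>x (int (m * q + j)) - x (int (m * q)) - real j * \<rho>\<bar> \<le> (\<Sum>l<q. z (m * q + l))" .
    have "real j * \<rho> - real j * of_int p / real q = real j / real q * (real q * \<rho> - of_int p)"
      using q by (simp add: right_diff_distrib)
    then have "\<bar>real j * \<rho> - real j * of_int p / real q\<bar> = real j / real q * e"
      unfolding e_def by (simp add: abs_mult)
    also have "\<dots> \<le> 1 * e" using j q unfolding e_def by (intro mult_right_mono) auto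
    finally show "\<bar>x (int (m * q + j)) - a - (x (int (m * q)) - a + real j * of_int p / real q)\<bar>
        \<le> e + (\<Sum>j<q. z (m * q + j))" using 1 by linarith
  qed
  have "(\<Sum>k<M * q. frac (x (int k) - a)) \<le>
      (\<Sum>m<M. (real q - 1) / 2 + 1 + 2 * (e + (\<Sum>j<q. z (m * q + j))) * real q)"
    unfolding group by (intro sum_mono block)
  also have "\<dots> = (\<Sum>m<M. ((real q - 1) / 2 + 1 + 2 * e * real q) + 2 * real q * (\<Sum>j<q. z (m * q + j)))"
    by (simp add: algebra_simps)
  also have "\<dots> = real M * ((real q - 1) / 2 + 1 + 2 * e * real q) + 2 * real q * (\<Sum>k<M * q. z k)"
    unfolding group by (subst sum.distrib) (simp add: sum_distrib_left)
  finally show ?thesis unfolding e_def z_def .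
qed

text \<open>
  The phase without pulse costs the bounded boundary term \<open>D \<tau>\<close> and leaves small spacing deviations; the
  phase with pulse gains \<open>b - a\<close> minus the fractional part at its start. The weight \<open>r = sqrt (2 d \<tau>)\<close>
  balances the two terms in the passage from the quadratic bound to the sum of absolute deviations.
  The constant \<open>C\<close> is the same for all periods \<open>i\<close> and all numbers \<open>M\<close> of blocks.
\<close>

lemma period_gain:
  assumes w: "chain_solution f g (step_pulse \<kappa> \<tau>) 0 w" and \<tau>: "\<tau> > 0"
    and ord: "\<And>t. t \<ge> 0 \<Longrightarrow> ordered \<rho> (w t)"
    and f: "mono f" and d: "d > 0" and strong: "\<And>x. (x - \<rho>) * (f x - f \<rho>) \<ge> d * (x - \<rho>)\<^sup>2"
    and D: "\<And>x y. \<bar>x - \<rho>\<bar> \<le> 1 \<Longrightarrow> \<bar>y - \<rho>\<bar> \<le> 1 \<Longrightarrow> \<bar>x - y\<bar> \<le> 1 \<Longrightarrow> \<bar>f x - f y\<bar> \<le> D"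
    and per: "\<And>x (l::int). g (x + of_int l) = g x"
    and force: "\<And>x. x \<in> {a'..b} \<Longrightarrow> \<kappa> * g x \<ge> D + \<beta>"
    and \<beta>: "\<beta> > 0" and a: "a' < a" "a \<le> b" and time: "\<beta> * \<tau> \<ge> b - a'"
    and q: "q \<ge> 1" and p: "coprime p (int q)"
  shows "\<exists>C. \<forall>i M. real (M * q) * (b - a - 1 / 2 - 1 / (2 * real q)
        - 2 * \<bar>real q * \<rho> - of_int p\<bar> - 2 * real q / sqrt (2 * d * \<tau>)) - C
      \<le> (\<Sum>k<M * q. w (2 * real (Suc i) * \<tau>) (int k) - w (2 * real i * \<tau>) (int k))"
proof -
  define e where "e = \<bar>real q * \<rho> - of_int p\<bar>"
  define r where "r = sqrt (2 * d * \<tau>)"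
  have r: "r > 0" "r\<^sup>2 = 2 * d * \<tau>" unfolding r_def using d \<tau> by auto
  define C1 where "C1 = (2 * (1 + D * \<tau>) * D + 4 * d * \<tau> * D) / d"
  have "real (M * q) * (b - a - 1 / 2 - 1 / (2 * real q) - 2 * e - 2 * real q / r) - (D * \<tau> + real q * r * C1)
      \<le> (\<Sum>k<M * q. w (2 * real (Suc i) * \<tau>) (int k) - w (2 * real i * \<tau>) (int k))" for i M
  proof -
    define s0 where "s0 = 2 * real i * \<tau>"
    define s1 where "s1 = (2 * real i + 1) * \<tau>"
    define s2 where "s2 = 2 * real (Suc i) * \<tau>"
    have s: "0 \<le> s0" "s0 < s1" "s1 < s2" "s1 - s0 = \<tau>" "s2 - s1 = \<tau>"
      unfolding s0_def s1_def s2_def using \<tau> by (auto simp: algebra_simps)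
    have sol0: "solves_on f g 0 s0 s1 w"
      using chain_solution_solves_on_phase[OF w \<tau> s(1), of "2 * int i" s1]
      by (simp add: phase_value_def s0_def s1_def)
    have sol1: "solves_on f g \<kappa> s1 s2 w"
      using chain_solution_solves_on_phase[OF w \<tau>, of s1 "2 * int i + 1" s2] s
      by (simp add: phase_value_def s1_def s2_def algebra_simps)
    define z where "z = (\<lambda>k::nat. w s1 (int k + 1) - w s1 (int k) - \<rho>)"
    let ?N = "real (M * q)"
    have relax: "(\<Sum>k<M * q. (z k)\<^sup>2) \<le> ?N / r\<^sup>2 + C1"
      "(\<Sum>k<M * q. w s1 (int k) - w s0 (int k)) \<ge> - D * \<tau>"
      using relaxation_estimate[OF sol0 s(2) ord f d strong D, of "M * q"] s
      unfolding z_def C1_def r by auto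
    have "(\<Sum>k<M * q. \<bar>z k\<bar>) \<le> (\<Sum>k<M * q. (r * (z k)\<^sup>2 + 1 / r) / 2)"
      by (intro sum_mono abs_le_weighted_square r)
    also have "\<dots> = (r * (\<Sum>k<M * q. (z k)\<^sup>2) + ?N / r) / 2"
      by (simp add: sum.distrib sum_distrib_left flip: sum_divide_distrib)
    also have "\<dots> \<le> (r * (?N / r\<^sup>2 + C1) + ?N / r) / 2"
      using relax(1) r by (intro divide_right_mono add_right_mono mult_left_mono) auto
    also have "\<dots> = ?N / r + r * C1 / 2"
      using r(1) by (simp add: power2_eq_square field_simps)
    finally have spread: "2 * real q * (\<Sum>k<M * q. \<bar>z k\<bar>) \<le> 2 * real q * (?N / r + r * C1 / 2)"
      by (intro mult_left_mono) auto
    have "(\<Sum>k<M * q. frac (w s1 (int k) - a)) \<le>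
        real M * ((real q - 1) / 2 + 1 + 2 * e * real q) + 2 * real q * (\<Sum>k<M * q. \<bar>z k\<bar>)"
      using block_sum_frac_le[OF q p, of "w s1" a M \<rho>] unfolding e_def z_def .
    also have "\<dots> \<le> real M * ((real q - 1) / 2 + 1 + 2 * e * real q) + 2 * real q * (?N / r + r * C1 / 2)"
      using spread by simp
    finally have fr: "(\<Sum>k<M * q. frac (w s1 (int k) - a)) \<le>
        real M * ((real q - 1) / 2 + 1 + 2 * e * real q) + 2 * real q * (?N / r + r * C1 / 2)" .
    have gain: "b - a - frac (w s1 k - a) \<le> w s2 k - w s1 k" for k
    proof (rule displacement_under_force[OF sol1 _ _ per force \<beta> a])
      fix t k assume "t \<in> {s1..s2}"
      then have o: "ordered \<rho> (w t)" using ord s by auto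
      have "\<bar>f (w t (k + 1) - w t k) - f (w t ((k - 1) + 1) - w t (k - 1))\<bar> \<le> D"
        by (intro D ordered_spacing(3,4)[OF o])
      then show "- D \<le> f (w t (k + 1) - w t k) - f (w t k - w t (k - 1))" by simp
    qed (use s time in auto)
    have "?N * (b - a) - (\<Sum>k<M * q. frac (w s1 (int k) - a)) = (\<Sum>k<M * q. b - a - frac (w s1 (int k) - a))"
      by (simp add: sum_subtractf)
    also have "\<dots> \<le> (\<Sum>k<M * q. w s2 (int k) - w s1 (int k))" by (intro sum_mono gain)
    finally have "?N * (b - a) - (real M * ((real q - 1) / 2 + 1 + 2 * e * real q)
        + 2 * real q * (?N / r + r * C1 / 2)) - D * \<tau>
      \<le> (\<Sum>k<M * q. w s2 (int k) - w s1 (int k)) + (\<Sum>k<M * q. w s1 (int k) - w s0 (int k))"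
      using fr relax(2) by linarith
    also have "\<dots> = (\<Sum>k<M * q. w s2 (int k) - w s0 (int k))"
      by (simp add: sum_subtractf)
    also have "?N * (b - a) - (real M * ((real q - 1) / 2 + 1 + 2 * e * real q)
        + 2 * real q * (?N / r + r * C1 / 2)) - D * \<tau>
      = ?N * (b - a - 1 / 2 - 1 / (2 * real q) - 2 * e - 2 * real q / r) - (D * \<tau> + real q * r * C1)"
      using q r(1) by (simp add: field_simps)
    finally show ?thesis unfolding s0_def s2_def .
  qed
  then show ?thesis unfolding e_def r_def by blast
qed

text \<open>
  For \<open>m\<close> periods the boundary cost \<open>m C\<close> is independent of \<open>M\<close>, and the error \<open>3\<close> per particle is
  independent of \<open>m\<close>. So first \<open>M\<close> and then \<open>m\<close> tends to infinity.
\<close>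

lemma speed_ge_of_period_gain:
  fixes w :: "real \<Rightarrow> int \<Rightarrow> real"
  assumes gain: "\<And>i M. real (M * q) * X - C
      \<le> (\<Sum>k<M * q. w (2 * real (Suc i) * \<tau>) (int k) - w (2 * real i * \<tau>) (int k))"
    and speed: "\<And>k m. \<bar>w (2 * real m * \<tau>) k - w 0 k - 2 * real m * \<tau> * v\<bar> \<le> 3"
    and q: "q \<ge> 1"
  shows "X \<le> 2 * \<tau> * v"
proof -
  have "real m * X \<le> real m * (2 * \<tau> * v) + 3" for m
  proof -
    have "real M * (real q * (real m * X)) \<le> real M * (real q * (real m * (2 * \<tau> * v) + 3)) + real m * C" for M
    proof -
      have sum: "real m * (real (M * q) * X - C) \<le> (\<Sum>k<M * q. w (2 * real m * \<tau>) (int k) - w 0 (int k))"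
      proof (induction m)
        case 0 then show ?case by simp
      next
        case (Suc m)
        then show ?case using gain[of M m] by (simp add: sum_subtractf algebra_simps)
      qed
      have "(\<Sum>k<M * q. w (2 * real m * \<tau>) (int k) - w 0 (int k)) \<le> (\<Sum>k<M * q. 2 * real m * \<tau> * v + 3)"
        using speed by (intro sum_mono) (simp add: abs_le_iff algebra_simps)
      then show ?thesis using sum by (simp add: algebra_simps)
    qed
    then have "real q * (real m * X) \<le> real q * (real m * (2 * \<tau> * v) + 3)" by (rule le_of_linear_growth_bound)
    then show ?thesis using q by simp
  qed
  then show ?thesis by (rule le_of_linear_growth_bound)
qed

text \<open>
  The threshold \<open>T\<close> depends only on the time that a particle needs to cross \<open>[a', b]\<close> at speed \<open>\<beta> / 2\<close>, hence
  not on \<open>p\<close> and \<open>q\<close>. This uniformity allows \<open>q\<close> to grow with \<open>\<tau>\<close> later.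
\<close>

theorem transport_speed_lower_bound:
  fixes W V :: "real \<Rightarrow> real"
  assumes W: "C2 W" and V: "C2 V" and d: "d > 0" "\<And>x. deriv (deriv W) x \<ge> d"
    and per: "\<And>x. V (x + 1) = V x" and \<beta>: "\<beta> > 0" and \<alpha>: "\<alpha> > 0"
    and H: "cond_H W V \<kappa> \<beta> \<alpha> \<rho>"
  shows "\<exists>T>0. \<forall>\<tau>\<ge>T. \<forall>q p. q \<ge> 1 \<longrightarrow> coprime p (int q) \<longrightarrow>
    \<alpha> - 1 / (2 * real q) - 2 * \<bar>real q * \<rho> - of_int p\<bar> - 2 * real q / sqrt (2 * d * \<tau>)
      \<le> 2 * \<tau> * pulse_speed W V \<kappa> \<rho> \<tau>"
proof -
  define f where "f = deriv W"
  define g where "g = deriv V"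
  define D where "D = delta_plus W \<rho>"
  obtain a b where ab: "1 / 2 + \<alpha> \<le> b - a" and strong_force: "\<And>x. x \<in> {a..b} \<Longrightarrow> \<kappa> * g x \<ge> D + \<beta>"
    using H unfolding cond_H_def D_def g_def by blast
  obtain G where G: "\<And>x. \<bar>g x\<bar> \<le> G" using potential_force_regular(3)[OF V per] unfolding g_def by blast
  have g: "lipschitz g" "\<And>x. g (x + 1) = g x" "continuous_on UNIV g"
    using potential_force_regular[OF V per] unfolding g_def by auto
  have f_inc: "f y - f x \<ge> d * (y - x)" if "x \<le> y" for x y
    unfolding f_def by (rule strongly_monotone_of_deriv_ge[OF C2_derivatives(2)[OF W] d(2) that])
  have f_mono: "mono f"
  proof (rule monoI)
    fix x y :: real assume "x \<le> y"
    moreover have "d * (y - x) \<ge> 0" using d calculation by simp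
    ultimately show "f x \<le> f y" using f_inc[of x y] by simp
  qed
  have f_strong: "(x - y) * (f x - f y) \<ge> d * (x - y)\<^sup>2" for x y
  proof (cases "x \<le> y")
    case True
    have "(y - x) * (d * (y - x)) \<le> (y - x) * (f y - f x)" using True by (intro mult_left_mono f_inc) auto
    then show ?thesis by (simp add: power2_eq_square algebra_simps)
  next
    case False
    have "(x - y) * (d * (x - y)) \<le> (x - y) * (f x - f y)" using False by (intro mult_left_mono f_inc) auto
    then show ?thesis by (simp add: power2_eq_square algebra_simps)
  qed
  have bdd: "bdd_above (deriv (deriv W) ` {\<rho> - 1..\<rho> + 1})"
    by (intro bounded_imp_bdd_above compact_imp_bounded compact_continuous_image C2_derivatives(3)[OF W]) auto
  have D_upper: "deriv (deriv W) x \<le> D" if "\<bar>x - \<rho>\<bar> \<le> 1" for x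
    unfolding D_def delta_plus_def using that by (intro cSUP_upper bdd) (auto simp: abs_le_iff)
  have D0: "D > 0" using D_upper[of \<rho>] d(2)[of \<rho>] d(1) by simp
  have D: "\<bar>f x - f y\<bar> \<le> D" if "\<bar>x - \<rho>\<bar> \<le> 1" "\<bar>y - \<rho>\<bar> \<le> 1" "\<bar>x - y\<bar> \<le> 1" for x y
  proof -
    have "\<bar>f x - f y\<bar> \<le> D * \<bar>x - y\<bar>" unfolding f_def
    proof (rule lipschitz_of_bounded_derivative[OF C2_derivatives(2)[OF W], of "{\<rho> - 1..\<rho> + 1}"])
      fix z assume "z \<in> {\<rho> - 1..\<rho> + 1}"
      then show "\<bar>deriv (deriv W) z\<bar> \<le> D" using D_upper[of z] d(2)[of z] d(1) by (simp add: abs_le_iff)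
    qed (use that in \<open>auto simp: abs_le_iff\<close>)
    also have "\<dots> \<le> D * 1" using that D0 by (intro mult_left_mono) auto
    finally show ?thesis by simp
  qed
  note g_int = periodic_int_shift[of g, OF g(2)]
  \<comment> \<open>By continuity of the force half of the margin \<open>\<beta>\<close> survives slightly to the left of \<open>a\<close>.\<close>
  obtain a' where a': "a' < a" and force: "\<And>x. x \<in> {a'..b} \<Longrightarrow> \<kappa> * g x \<ge> D + \<beta> / 2"
  proof -
    have "continuous_on UNIV (\<lambda>x. \<kappa> * g x)" by (intro continuous_intros g(3))
    then have "isCont (\<lambda>x. \<kappa> * g x) a" by (simp add: continuous_on_eq_continuous_at)
    moreover have "\<kappa> * g a > D + \<beta> / 2" using strong_force[of a] ab \<alpha> \<beta> by simp
    ultimately have "\<forall>\<^sub>F x in at a. \<kappa> * g x > D + \<beta> / 2"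
      unfolding isCont_def by (rule order_tendstoD(1))
    then obtain \<delta> where \<delta>: "\<delta> > 0" "\<And>x. x \<noteq> a \<Longrightarrow> dist x a < \<delta> \<Longrightarrow> \<kappa> * g x > D + \<beta> / 2"
      unfolding eventually_at by auto
    show ?thesis
    proof (rule that[of "a - \<delta> / 2"])
      fix x assume x: "x \<in> {a - \<delta> / 2..b}"
      show "\<kappa> * g x \<ge> D + \<beta> / 2"
      proof (cases "x < a")
        case True
        then show ?thesis using \<delta>(2)[of x] x \<delta>(1) by (auto simp: dist_real_def)
      next
        case False
        then show ?thesis using strong_force[of x] x \<beta> by auto
      qed
    qed (use \<delta> in auto)
  qed
  define T where "T = 2 * (b - a') / \<beta>"
  have "T > 0" unfolding T_def using a' ab \<alpha> \<beta> by simp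
  moreover have "\<alpha> - 1 / (2 * real q) - 2 * \<bar>real q * \<rho> - of_int p\<bar> - 2 * real q / sqrt (2 * d * \<tau>)
      \<le> 2 * \<tau> * pulse_speed W V \<kappa> \<rho> \<tau>"
    if \<tau>T: "\<tau> \<ge> T" and q: "q \<ge> 1" and p: "coprime p (int q)" for \<tau> q p
  proof -
    have \<tau>: "\<tau> > 0" using \<tau>T \<open>T > 0\<close> by simp
    have time: "\<beta> / 2 * \<tau> \<ge> b - a'" using \<tau>T \<beta> unfolding T_def by (simp add: field_simps)
    obtain w where w: "chain_solution f g (step_pulse \<kappa> \<tau>) 0 w"
      and ord: "\<And>t. t \<ge> 0 \<Longrightarrow> ordered \<rho> (w t)"
      and speed: "\<And>k m. \<bar>w (2 * real m * \<tau>) k - w 0 k - 2 * real m * \<tau> * pulse_speed W V \<kappa> \<rho> \<tau>\<bar> \<le> 3"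
      by (rule pulse_speed_realised_by_ordered_solution[of W V G \<tau> \<kappa> \<rho>])
        (use f_mono C2_deriv_locally_lipschitz[OF W] g G \<tau> in \<open>auto simp: f_def g_def\<close>)
    obtain C where C: "\<And>i M. real (M * q) * (b - a - 1 / 2 - 1 / (2 * real q)
        - 2 * \<bar>real q * \<rho> - of_int p\<bar> - 2 * real q / sqrt (2 * d * \<tau>)) - C
      \<le> (\<Sum>k<M * q. w (2 * real (Suc i) * \<tau>) (int k) - w (2 * real i * \<tau>) (int k))"
      using period_gain[OF w \<tau> ord f_mono d(1) f_strong D g_int force _ a' _ time q p] ab \<alpha> \<beta> by auto
    from speed_ge_of_period_gain[OF C speed q] show ?thesis using ab by linarith
  qed
  ultimately show ?thesis by blast
qed

section \<open>Diophantine approximation of the mean spacing\<close>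

text \<open>
  The exponent \<open>2\<close> is larger than the exponent \<open>1\<close> of a typical number, so that the exceptional set is null,
  yet it still keeps the denominators of Dirichlet's theorem from being too small. The constant \<open>c\<close> absorbs the finitely
  many small \<open>q\<close>.
\<close>

definition not_too_well_approximable :: "real \<Rightarrow> bool" where
  "not_too_well_approximable \<rho> \<longleftrightarrow>
     (\<exists>c>0. \<forall>(p::int) (q::nat). q \<ge> 1 \<longrightarrow> c / (real q)\<^sup>2 \<le> \<bar>real q * \<rho> - of_int p\<bar>)"

text \<open>
  For \<open>0 < c \<le> 1\<close> the exceptional set within \<open>[-n, n]\<close> is covered by the intervals of radius \<open>c / q\<^sup>3\<close> around
  the fractions \<open>p / q\<close> with \<open>|p| \<le> (n + 1) q\<close>. Their total length is at most a multiple of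
  \<open>c\<close> times the sum of \<open>1 / q\<^sup>2\<close>, and \<open>c\<close> is arbitrarily small.
\<close>

lemma negligible_well_approximable: "negligible {\<rho>. \<not> not_too_well_approximable \<rho>}"
proof -
  define S where "S = (\<lambda>n::nat. {\<rho>. \<not> not_too_well_approximable \<rho>} \<inter> {- real n..real n})"
  have "negligible (S n)" for n
    unfolding negligible_outer
  proof (intro allI impI)
    fix e :: real assume e: "e > 0"
    define Z where "Z = (\<Sum>j. 1 / (real (Suc j))\<^sup>2)"
    have summ: "summable (\<lambda>j. 1 / (real (Suc j))\<^sup>2)"
      using sums_summable[OF inverse_squares_sums] by (simp add: add.commute)
    have Z0: "Z \<ge> 0" unfolding Z_def by (intro suminf_nonneg summ) auto
    \<comment> \<open>With this \<open>c\<close> the total length of the cover is at most \<open>e / 2\<close>; the bound \<open>c \<le> 1\<close> confines the numerators \<open>p\<close>.\<close>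
    define c where "c = min 1 (e / (8 * (real n + 2) * (Z + 1)))"
    have c: "c > 0" "c \<le> 1" unfolding c_def using e Z0 by auto
    define A where "A = (\<lambda>j p. {of_int p / real (Suc j) - c / (real (Suc j)) ^ 3 ..
        of_int p / real (Suc j) + c / (real (Suc j)) ^ 3})"
    define I where "I = (\<lambda>j. {- ((int n + 1) * int (Suc j))..(int n + 1) * int (Suc j)})"
    define T where "T = (\<Union>j. \<Union>p\<in>I j. A j p)"
    have A_meas: "A j p \<in> lmeasurable" for j p unfolding A_def by simp
    have Aj_meas: "(\<Union>p\<in>I j. A j p) \<in> lmeasurable" for j
      by (intro fmeasurable.finite_UN A_meas) (simp add: I_def)
    have Aj: "measure lebesgue (\<Union>p\<in>I j. A j p) \<le> 4 * (real n + 2) * c * (1 / (real (Suc j))\<^sup>2)" for j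
    proof -
      let ?q = "real (Suc j)"
      have "measure lebesgue (\<Union>p\<in>I j. A j p) \<le> (\<Sum>p\<in>I j. measure lebesgue (A j p))"
        by (rule measure_UNION_le) (use A_meas in \<open>auto simp: I_def fmeasurable_def\<close>)
      also have "\<dots> = real (card (I j)) * (2 * (c / ?q ^ 3))"
        unfolding A_def using c by simp
      also have "\<dots> \<le> (2 * (real n + 2) * ?q) * (2 * (c / ?q ^ 3))"
      proof (rule mult_right_mono)
        define X where "X = (int n + 1) * int (Suc j)"
        have "X \<ge> 0" unfolding X_def by simp
        then have "real (card (I j)) = 2 * of_int X + 1" unfolding I_def X_def[symmetric] by simp
        also have "of_int X = (real n + 1) * ?q" unfolding X_def by simp
        finally have "real (card (I j)) = 2 * ((real n + 1) * ?q) + 1" .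
        then show "real (card (I j)) \<le> 2 * (real n + 2) * ?q" by (simp add: algebra_simps)
      qed (use c in auto)
      also have "\<dots> = 4 * (real n + 2) * c * (1 / ?q\<^sup>2)"
        by (simp add: power2_eq_square power3_eq_cube del: of_nat_Suc)
      finally show ?thesis .
    qed
    have part: "measure lebesgue (\<Union>j\<le>m. \<Union>p\<in>I j. A j p) \<le> 4 * (real n + 2) * c * Z" for m
    proof -
      have "measure lebesgue (\<Union>j\<le>m. \<Union>p\<in>I j. A j p) \<le> (\<Sum>j\<le>m. measure lebesgue (\<Union>p\<in>I j. A j p))"
        by (rule measure_UNION_le) (use Aj_meas in \<open>auto simp: fmeasurable_def\<close>)
      also have "\<dots> \<le> (\<Sum>j\<le>m. 4 * (real n + 2) * c * (1 / (real (Suc j))\<^sup>2))" by (intro sum_mono Aj)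
      also have "\<dots> = 4 * (real n + 2) * c * (\<Sum>j\<le>m. 1 / (real (Suc j))\<^sup>2)" by (simp add: sum_distrib_left)
      also have "\<dots> \<le> 4 * (real n + 2) * c * Z"
        unfolding Z_def using c by (intro mult_left_mono sum_le_suminf summ) auto
      finally show ?thesis .
    qed
    have "S n \<subseteq> T"
    proof
      fix \<rho> assume "\<rho> \<in> S n"
      then have bad: "\<not> not_too_well_approximable \<rho>" and bnd: "\<bar>\<rho>\<bar> \<le> real n" unfolding S_def by auto
      obtain p :: int and q :: nat where q: "q \<ge> 1" and pq: "\<bar>real q * \<rho> - of_int p\<bar> < c / (real q)\<^sup>2"
        using bad c(1) unfolding not_too_well_approximable_def by (meson not_le)
      define j where "j = q - 1"
      have j: "q = Suc j" using q unfolding j_def by simp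
      have "c / (real q)\<^sup>2 \<le> 1" using c q by (simp add: divide_le_eq order_trans[OF c(2)])
      then have "\<bar>of_int p\<bar> \<le> \<bar>real q * \<rho>\<bar> + 1" using pq by linarith
      also have "\<bar>real q * \<rho>\<bar> = real q * \<bar>\<rho>\<bar>" by (simp add: abs_mult)
      also have "real q * \<bar>\<rho>\<bar> \<le> real q * real n" using bnd by (intro mult_left_mono) auto
      finally have "\<bar>of_int p :: real\<bar> \<le> of_int ((int n + 1) * int (Suc j))" unfolding j by (simp add: algebra_simps del: of_int_mult) (simp add: algebra_simps)
      then have "\<bar>p\<bar> \<le> (int n + 1) * int (Suc j)" by (metis of_int_abs of_int_le_iff)
      then have "p \<in> I j" unfolding I_def by (auto simp: abs_le_iff)
      moreover have "\<bar>\<rho> - of_int p / real q\<bar> \<le> c / real q ^ 3"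
      proof -
        have "\<bar>\<rho> - of_int p / real q\<bar> = \<bar>real q * \<rho> - of_int p\<bar> / real q"
        proof -
          have "\<rho> - of_int p / real q = (real q * \<rho> - of_int p) / real q"
            using q by (simp add: diff_divide_distrib)
          then show ?thesis by (simp add: abs_divide)
        qed
        also have "\<dots> \<le> c / (real q)\<^sup>2 / real q" using pq by (intro divide_right_mono) auto
        finally show ?thesis by (simp add: power2_eq_square power3_eq_cube)
      qed
      then have "\<rho> \<in> A j p" unfolding A_def j by (auto simp: abs_le_iff)
      ultimately show "\<rho> \<in> T" unfolding T_def by blast
    qed
    moreover have "T \<in> lmeasurable" unfolding T_def
      by (rule fmeasurable_countable_Union[OF Aj_meas part])
    moreover have "measure lebesgue T < e"
    proof -
      have "measure lebesgue T \<le> 4 * (real n + 2) * c * Z" unfolding T_def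
        by (rule measure_countable_Union_le[OF Aj_meas part])
      also have "\<dots> \<le> c * (8 * (real n + 2) * (Z + 1)) / 2"
        using c Z0 mult_nonneg_nonneg[of c "real n"] by (simp add: algebra_simps)
      also have "\<dots> \<le> e / 2"
      proof -
        have "c \<le> e / (8 * (real n + 2) * (Z + 1))" unfolding c_def by simp
        moreover have "8 * (real n + 2) * (Z + 1) > 0" using Z0 by simp
        ultimately show ?thesis by (simp add: pos_le_divide_eq)
      qed
      finally show ?thesis using e by simp
    qed
    ultimately show "\<exists>T. S n \<subseteq> T \<and> T \<in> lmeasurable \<and> measure lebesgue T < e" by blast
  qed
  then have "negligible (\<Union>n. S n)" by (rule negligible_Union_nat)
  moreover have "{\<rho>. \<not> not_too_well_approximable \<rho>} \<subseteq> (\<Union>n. S n)"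
  proof
    fix \<rho> :: real assume "\<rho> \<in> {\<rho>. \<not> not_too_well_approximable \<rho>}"
    moreover obtain n :: nat where "\<bar>\<rho>\<bar> \<le> real n" using real_arch_simple by blast
    ultimately have "\<rho> \<in> S n" unfolding S_def by (auto simp: abs_le_iff)
    then show "\<rho> \<in> (\<Union>n. S n)" by blast
  qed
  ultimately show ?thesis by (rule negligible_subset)
qed

lemma good_denominators_of_irrational:
  assumes "\<rho> \<notin> \<rat>"
  obtains p :: int and q :: nat where "q > n" "coprime p (int q)" "\<bar>real q * \<rho> - of_int p\<bar> < 1 / real q"
proof -
  have "infinite (approx_set \<rho>)" using assms rational_iff_finite_approx_set by blast
  then obtain h k where hk: "(h, k) \<in> approx_set \<rho>" "k > int n" using infinite_approx_set by blast
  define q where "q = nat k"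
  have k: "k = int q" "q > 0" "q > n" using hk(2) unfolding q_def by auto
  have cop: "coprime h (int q)" and near: "\<bar>\<rho> - of_int h / real q\<bar> < 1 / (real q)\<^sup>2"
    using hk(1) unfolding approx_set_def k by auto
  have "\<bar>real q * \<rho> - of_int h\<bar> = real q * \<bar>\<rho> - of_int h / real q\<bar>"
  proof -
    have "real q * \<rho> - of_int h = real q * (\<rho> - of_int h / real q)" using k by (simp add: right_diff_distrib)
    then show ?thesis by (simp add: abs_mult)
  qed
  also have "\<dots> < real q * (1 / (real q)\<^sup>2)" using near k by (intro mult_strict_left_mono) auto
  also have "\<dots> = 1 / real q" using k by (simp add: power2_eq_square)
  finally show ?thesis using that cop k by blast
qed

text \<open>
  Dirichlet's theorem bounds the denominator from above by \<open>N\<close>. The lower bound for \<open>|q \<rho> - p|\<close> forces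
  \<open>c / q\<^sup>2 < 1 / N\<close>, hence a lower bound for \<open>q\<close> of order \<open>\<surd>N\<close>.
\<close>

lemma good_denominator_in_window:
  assumes "not_too_well_approximable \<rho>"
  obtains c where "c > 0"
    "\<And>N::nat. N \<ge> 1 \<Longrightarrow> \<exists>(p::int) (q::nat). q \<ge> 1 \<and> q \<le> N \<and> coprime p (int q) \<and>
        \<bar>real q * \<rho> - of_int p\<bar> < 1 / real N \<and> 1 / real q \<le> c / sqrt (real N)"
proof -
  obtain c where c: "c > 0"
    and far: "\<And>(p::int) (q::nat). q \<ge> 1 \<Longrightarrow> c / (real q)\<^sup>2 \<le> \<bar>real q * \<rho> - of_int p\<bar>"
    using assms unfolding not_too_well_approximable_def by blast
  show ?thesis
  proof (rule that[of "1 / sqrt c"])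
    fix N :: nat assume N: "N \<ge> 1"
    obtain h k where hk: "coprime h k" "0 < k" "k \<le> int N" "\<bar>of_int k * \<rho> - of_int h\<bar> < 1 / real N"
      using Dirichlet_approx_coprime[of N \<rho>] N by auto
    define q where "q = nat k"
    have k: "k = int q" "q \<ge> 1" using hk(2) unfolding q_def by auto
    have near: "\<bar>real q * \<rho> - of_int h\<bar> < 1 / real N" using hk(4) unfolding k by simp
    then have "c / (real q)\<^sup>2 \<le> 1 / real N" using far[OF k(2), of h] by linarith
    then have "(1 / real q)\<^sup>2 \<le> (1 / sqrt c / sqrt (real N))\<^sup>2"
      using c N k by (simp add: power_divide field_simps)
    then have "1 / real q \<le> 1 / sqrt c / sqrt (real N)"
      by (rule power2_le_imp_le) (use c in auto)
    then show "\<exists>(p::int) (q::nat). q \<ge> 1 \<and> q \<le> N \<and> coprime p (int q) \<and>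
        \<bar>real q * \<rho> - of_int p\<bar> < 1 / real N \<and> 1 / real q \<le> 1 / sqrt c / sqrt (real N)"
      using hk near k by (intro exI[of _ h] exI[of _ q]) auto
  qed (use c in auto)
qed

section \<open>Asymptotics for long pulses\<close>

text \<open>
  A deficit of order \<open>\<tau> powr (-e)\<close> with \<open>e > 1/8\<close> is eventually below \<open>2 c' \<tau> powr (-1/8)\<close>, whatever the
  positive constant \<open>c'\<close>. Division by \<open>2 \<tau>\<close> gives the exponents \<open>-1\<close> and \<open>-9/8\<close>.
\<close>

lemma speed_bound_of_small_deficit:
  fixes C e c' \<alpha> :: real
  assumes "c' > 0" "e > 1 / 8"
  shows "\<forall>\<^sub>F \<tau> in at_top. \<forall>v. \<alpha> - C * \<tau> powr (- e) \<le> 2 * \<tau> * v \<longrightarrow>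
    \<alpha> / 2 * \<tau> powr (- 1) - c' * \<tau> powr (- 9 / 8) \<le> v"
proof -
  have "((\<lambda>\<tau>. C * \<tau> powr (1 / 8 - e)) \<longlongrightarrow> C * 0) at_top"
    by (intro tendsto_mult tendsto_const tendsto_neg_powr filterlim_ident) (use assms in auto)
  then have "\<forall>\<^sub>F \<tau> in at_top. C * \<tau> powr (1 / 8 - e) < 2 * c'"
    by (rule order_tendstoD) (use assms in auto)
  then show ?thesis using eventually_gt_at_top[of 0]
  proof eventually_elim
    case (elim \<tau>)
    show ?case
    proof (intro allI impI)
      fix v assume v: "\<alpha> - C * \<tau> powr (- e) \<le> 2 * \<tau> * v"
      have "C * \<tau> powr (- e) = C * \<tau> powr (1 / 8 - e) * \<tau> powr (- 1 / 8)"
        by (simp flip: powr_add)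
      also have "\<dots> \<le> 2 * c' * \<tau> powr (- 1 / 8)"
        using elim by (intro mult_right_mono) auto
      finally have "\<alpha> - 2 * c' * \<tau> powr (- 1 / 8) \<le> 2 * \<tau> * v" using v by linarith
      then have "(\<alpha> - 2 * c' * \<tau> powr (- 1 / 8)) / (2 * \<tau>) \<le> v"
        using elim by (simp add: divide_le_eq mult.commute)
      also have "(\<alpha> - 2 * c' * \<tau> powr (- 1 / 8)) / (2 * \<tau>)
          = \<alpha> / 2 * \<tau> powr (- 1) - c' * (\<tau> powr (- 1 / 8) * \<tau> powr (- 1))"
        using elim by (simp add: powr_minus_divide field_simps)
      also have "\<tau> powr (- 1 / 8) * \<tau> powr (- 1) = \<tau> powr (- 9 / 8)"
        unfolding powr_add[symmetric] by simp
      finally show "\<alpha> / 2 * \<tau> powr (- 1) - c' * \<tau> powr (- 9 / 8) \<le> v" .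
    qed
  qed
qed

lemma c_const_pos:
  assumes W: "C2 W" and d: "d > 0" "\<And>x. deriv (deriv W) x \<ge> d"
  shows "c_const W \<rho> > 0"
proof -
  have img: "deriv (deriv W) ` {\<rho> - 1..\<rho> + 1} \<noteq> {}" by simp
  have "delta_minus W \<rho> \<ge> d" unfolding delta_minus_def using img d by (intro cINF_greatest) auto
  moreover have "delta_plus W \<rho> \<ge> deriv (deriv W) \<rho>"
    unfolding delta_plus_def
    by (intro cSUP_upper bounded_imp_bdd_above compact_imp_bounded compact_continuous_image
        C2_derivatives(3)[OF W]) auto
  ultimately have "delta_minus W \<rho> > 0" "delta_plus W \<rho> > 0" using d(1) d(2)[of \<rho>] by linarith+
  then show ?thesis unfolding c_const_def by simp
qed

theorem corollary2p1:
  fixes W V :: "real \<Rightarrow> real" and \<kappa> \<beta> \<alpha> :: real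
  assumes "C2 W" and "C2 V"
    and "\<exists>d>0. \<forall>x. deriv (deriv W) x \<ge> d"
    and "\<forall>x. V (x + 1) = V x"
    and "\<kappa> \<ge> 0" and "\<beta> > 0" and "0 < \<alpha>" and "\<alpha> < 1 / 2"
  shows
    "(\<forall>(p\<^sub>0::int) (q\<^sub>0::int) (\<rho>::real).
        \<rho> = of_int p\<^sub>0 / of_int q\<^sub>0 \<longrightarrow> coprime p\<^sub>0 q\<^sub>0 \<longrightarrow> q\<^sub>0 \<ge> 2 \<longrightarrow> cond_H W V \<kappa> \<beta> \<alpha> \<rho> \<longrightarrow>
        \<alpha> > 1 / sqrt (of_int q\<^sub>0) - 1 / (2 * of_int q\<^sub>0) \<longrightarrow>
        (\<exists>\<tau>\<^sub>0. \<forall>\<tau>>\<tau>\<^sub>0. pulse_speed W V \<kappa> \<rho> \<tau> > 0) \<and>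
        Liminf at_top (\<lambda>\<tau>. ereal (2 * pulse_speed W V \<kappa> \<rho> \<tau> * \<tau> /
            (\<alpha> - 1 / sqrt (of_int q\<^sub>0) + 1 / (2 * of_int q\<^sub>0)))) \<ge> 1)
     \<and>
     (\<forall>\<rho>. \<rho> \<notin> \<rat> \<longrightarrow> cond_H W V \<kappa> \<beta> \<alpha> \<rho> \<longrightarrow>
        (\<forall>\<^sub>F \<tau> in at_top. pulse_speed W V \<kappa> \<rho> \<tau> > 0) \<and>
        (\<exists>s :: nat \<Rightarrow> real. filterlim s at_top sequentially \<and>
          (\<exists>r \<in> O(\<lambda>n. s n powr (- 5 / 4)). \<forall>\<^sub>F n in sequentially.
             pulse_speed W V \<kappa> \<rho> (s n)
               \<ge> \<alpha> / 2 * s n powr (- 1) - c_const W \<rho> * s n powr (- 9 / 8) + r n)))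
     \<and>
     (\<exists>R :: real set. R \<in> sets lebesgue \<and> - R \<in> null_sets lebesgue \<and>
        (\<forall>\<rho>\<in>R. cond_H W V \<kappa> \<beta> \<alpha> \<rho> \<longrightarrow>
          (\<forall>\<epsilon>>0. \<exists>r \<in> O[at_top](\<lambda>\<tau>. \<tau> powr (- 5 / 4)). \<forall>\<^sub>F \<tau> in at_top.
             pulse_speed W V \<kappa> \<rho> \<tau>
               \<ge> \<alpha> / 2 * \<tau> powr (- 1)
                 - c_const W \<rho> * sqrt ((gamma_L + 1) / 2) * (1 + \<epsilon>) * \<tau> powr (- 9 / 8) + r \<tau>)))"
proof -
  obtain d where d: "d > 0" "\<And>x. deriv (deriv W) x \<ge> d" using assms(3) by blast
  define K where "K = 2 / sqrt (2 * d)"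
  have K: "K > 0" unfolding K_def using d by simp
  note cpos = c_const_pos[OF assms(1) d]
  have bound: "\<exists>T>0. \<forall>\<tau>\<ge>T. \<forall>q p. q \<ge> 1 \<longrightarrow> coprime p (int q) \<longrightarrow>
      \<alpha> - 1 / (2 * real q) - 2 * \<bar>real q * \<rho> - of_int p\<bar> - K * real q / sqrt \<tau>
        \<le> 2 * \<tau> * pulse_speed W V \<kappa> \<rho> \<tau>" if "cond_H W V \<kappa> \<beta> \<alpha> \<rho>" for \<rho>
  proof -
    have "2 * real q / sqrt (2 * d * \<tau>) = K * real q / sqrt \<tau>" for q \<tau>
      unfolding K_def by (simp add: real_sqrt_mult)
    then show ?thesis
      using transport_speed_lower_bound[OF assms(1,2) d _ assms(6,7) that] assms(4) by simp
  qed
  have decay: "((\<lambda>\<tau>. A / sqrt \<tau>) \<longlongrightarrow> 0) at_top" for A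
    by (rule tendsto_divide_0[OF tendsto_const])
      (rule filterlim_at_top_imp_at_infinity[OF sqrt_at_top])
  have part1: "(\<exists>\<tau>\<^sub>0. \<forall>\<tau>>\<tau>\<^sub>0. pulse_speed W V \<kappa> \<rho> \<tau> > 0) \<and>
        Liminf at_top (\<lambda>\<tau>. ereal (2 * pulse_speed W V \<kappa> \<rho> \<tau> * \<tau> /
            (\<alpha> - 1 / sqrt (of_int q\<^sub>0) + 1 / (2 * of_int q\<^sub>0)))) \<ge> 1"
    if \<rho>: "\<rho> = of_int p\<^sub>0 / of_int q\<^sub>0" and cop: "coprime p\<^sub>0 q\<^sub>0" and q0: "q\<^sub>0 \<ge> 2"
      and H: "cond_H W V \<kappa> \<beta> \<alpha> \<rho>" and \<alpha>: "\<alpha> > 1 / sqrt (of_int q\<^sub>0) - 1 / (2 * of_int q\<^sub>0)"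
    for p\<^sub>0 q\<^sub>0 :: int and \<rho>
  proof -
    define q where "q = nat q\<^sub>0"
    have q: "q\<^sub>0 = int q" "q \<ge> 2" using q0 unfolding q_def by auto
    define M where "M = \<alpha> - 1 / sqrt (real q) + 1 / (2 * real q)"
    have M: "M > 0" using \<alpha> unfolding M_def q by simp
    \<comment> \<open>Since \<open>1/q \<le> 1/\<surd>q\<close>, the target \<open>M\<close> is at most the limit \<open>\<alpha> - 1/(2q)\<close> of the lower bound.\<close>
    have "sqrt (real q) * 1 \<le> sqrt (real q) * sqrt (real q)" using q by (intro mult_left_mono) auto
    then have "1 / real q \<le> 1 / sqrt (real q)" using q by (intro divide_left_mono) auto
    then have M_le: "M \<le> \<alpha> - 1 / (2 * real q)" unfolding M_def by (simp add: field_simps)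
    obtain T where T: "T > 0" "\<And>\<tau>. \<tau> \<ge> T \<Longrightarrow> \<alpha> - 1 / (2 * real q) - K * real q / sqrt \<tau>
        \<le> 2 * \<tau> * pulse_speed W V \<kappa> \<rho> \<tau>"
    proof -
      have "real q * \<rho> - of_int p\<^sub>0 = 0" unfolding \<rho> q using q(2) by simp
      then have zero: "\<bar>real q * \<rho> - of_int p\<^sub>0\<bar> = 0" by simp
      obtain T where "T > 0" and T: "\<And>\<tau> q p. \<tau> \<ge> T \<Longrightarrow> q \<ge> 1 \<Longrightarrow> coprime p (int q) \<Longrightarrow>
        \<alpha> - 1 / (2 * real q) - 2 * \<bar>real q * \<rho> - of_int p\<bar> - K * real q / sqrt \<tau>
          \<le> 2 * \<tau> * pulse_speed W V \<kappa> \<rho> \<tau>" using bound[OF H] by blast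
      have "coprime p\<^sub>0 (int q)" "1 \<le> q" using cop q by auto
      then show ?thesis using that[OF \<open>T > 0\<close>] T[of _ q p\<^sub>0] unfolding zero by simp
    qed
    have ge: "\<forall>\<^sub>F \<tau> in at_top. M - K * real q / sqrt \<tau> \<le> 2 * \<tau> * pulse_speed W V \<kappa> \<rho> \<tau>"
      using eventually_ge_at_top[of T] by eventually_elim (use T(2) M_le in force)
    have "\<forall>\<^sub>F \<tau> in at_top. K * real q / sqrt \<tau> < M"
      using decay[of "K * real q"] M by (rule order_tendstoD)
    with ge have "\<forall>\<^sub>F \<tau> in at_top. pulse_speed W V \<kappa> \<rho> \<tau> > 0"
      using eventually_gt_at_top[of 0]
    proof eventually_elim
      case (elim \<tau>)
      then have "2 * \<tau> * pulse_speed W V \<kappa> \<rho> \<tau> > 0" by linarith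
      then show ?case using elim by (simp add: zero_less_mult_iff)
    qed
    then have pos: "\<exists>\<tau>\<^sub>0. \<forall>\<tau>>\<tau>\<^sub>0. pulse_speed W V \<kappa> \<rho> \<tau> > 0"
      unfolding eventually_at_top_dense .
    have "((\<lambda>\<tau>. ereal ((M - K * real q / sqrt \<tau>) / M)) \<longlongrightarrow> ereal ((M - 0) / M)) at_top"
      by (intro tendsto_ereal tendsto_divide tendsto_diff tendsto_const decay) (use M in auto)
    then have "Liminf at_top (\<lambda>\<tau>. ereal ((M - K * real q / sqrt \<tau>) / M)) = ereal ((M - 0) / M)"
      by (intro lim_imp_Liminf) auto
    also have "\<dots> = 1" using M by simp
    finally have "1 = Liminf at_top (\<lambda>\<tau>. ereal ((M - K * real q / sqrt \<tau>) / M))" by simp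
    also have "\<dots> \<le> Liminf at_top (\<lambda>\<tau>. ereal (2 * pulse_speed W V \<kappa> \<rho> \<tau> * \<tau> / M))"
    proof (rule Liminf_mono, use ge in eventually_elim)
      case (elim \<tau>)
      then show ?case using M by (simp add: divide_right_mono mult_ac)
    qed
    finally show ?thesis using pos unfolding M_def q by simp
  qed
  have part2: "(\<forall>\<^sub>F \<tau> in at_top. pulse_speed W V \<kappa> \<rho> \<tau> > 0) \<and>
        (\<exists>s :: nat \<Rightarrow> real. filterlim s at_top sequentially \<and>
          (\<exists>r \<in> O(\<lambda>n. s n powr (- 5 / 4)). \<forall>\<^sub>F n in sequentially.
             pulse_speed W V \<kappa> \<rho> (s n)
               \<ge> \<alpha> / 2 * s n powr (- 1) - c_const W \<rho> * s n powr (- 9 / 8) + r n))"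
    if irr: "\<rho> \<notin> \<rat>" and H: "cond_H W V \<kappa> \<beta> \<alpha> \<rho>" for \<rho>
  proof
    obtain T where T: "T > 0" "\<And>\<tau> q p. \<tau> \<ge> T \<Longrightarrow> q \<ge> 1 \<Longrightarrow> coprime p (int q) \<Longrightarrow>
      \<alpha> - 1 / (2 * real q) - 2 * \<bar>real q * \<rho> - of_int p\<bar> - K * real q / sqrt \<tau>
        \<le> 2 * \<tau> * pulse_speed W V \<kappa> \<rho> \<tau>" using bound[OF H] by blast
    have T': "\<alpha> - 3 / real q - K * real q / sqrt \<tau> \<le> 2 * \<tau> * pulse_speed W V \<kappa> \<rho> \<tau>"
      if "\<tau> \<ge> T" "q \<ge> 1" "coprime p (int q)" "\<bar>real q * \<rho> - of_int p\<bar> < 1 / real q" for \<tau> q p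
    proof -
      have "1 / (2 * real q) \<le> 1 / real q" using that by (simp add: field_simps)
      then show ?thesis using T(2)[OF that(1-3)] that(4) by simp
    qed
    show "\<forall>\<^sub>F \<tau> in at_top. pulse_speed W V \<kappa> \<rho> \<tau> > 0"
    proof -
      obtain n :: nat where n: "6 / \<alpha> \<le> real n" using real_arch_simple by blast
      obtain p :: int and q :: nat where q: "q > n" "coprime p (int q)" "\<bar>real q * \<rho> - of_int p\<bar> < 1 / real q"
        using good_denominators_of_irrational[OF irr] by blast
      have "6 / \<alpha> < real q" using n q by linarith
      then have q3: "3 / real q < \<alpha> / 2" using assms(7) q by (simp add: field_simps)
      have "\<forall>\<^sub>F \<tau> in at_top. K * real q / sqrt \<tau> < \<alpha> / 2"
        using decay[of "K * real q"] assms(7) by (intro order_tendstoD) auto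
      then show ?thesis using eventually_ge_at_top[of T]
      proof eventually_elim
        case (elim \<tau>)
        then have "2 * \<tau> * pulse_speed W V \<kappa> \<rho> \<tau> > 0" using T'[OF elim(2) _ q(2,3)] q q3 by simp
        then show ?case using elim T(1) by (simp add: zero_less_mult_iff)
      qed
    qed
    have "\<forall>n. \<exists>(p::int) (q::nat). q > n \<and> coprime p (int q) \<and> \<bar>real q * \<rho> - of_int p\<bar> < 1 / real q"
      using good_denominators_of_irrational[OF irr] by metis
    then obtain p :: "nat \<Rightarrow> int" and q :: "nat \<Rightarrow> nat" where pq: "\<And>n. q n > n" "\<And>n. coprime (p n) (int (q n))"
      "\<And>n. \<bar>real (q n) * \<rho> - of_int (p n)\<bar> < 1 / real (q n)" by metis
    \<comment> \<open>The choice \<open>s = q\<^sup>4\<close> balances \<open>3 / q\<close> against \<open>K q / \<surd>s\<close>.\<close>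
    define s where "s = (\<lambda>n. real (q n) ^ 4)"
    have s_lim: "filterlim s at_top sequentially"
    proof (rule filterlim_at_top_mono[OF filterlim_real_sequentially])
      show "\<forall>\<^sub>F n in sequentially. real n \<le> s n"
      proof (intro always_eventually allI)
        fix n
        have "real (q n) ^ 1 \<le> real (q n) ^ 4" using pq(1)[of n] by (intro power_increasing) auto
        then show "real n \<le> s n" using pq(1)[of n] unfolding s_def by simp
      qed
    qed
    have "\<forall>\<^sub>F n in sequentially. T \<le> s n"
      using s_lim by (simp add: filterlim_at_top)
    moreover have "\<forall>\<^sub>F n in sequentially. \<forall>v. \<alpha> - (3 + K) * s n powr (- (1 / 4)) \<le> 2 * s n * v \<longrightarrow>
        \<alpha> / 2 * s n powr (- 1) - c_const W \<rho> * s n powr (- 9 / 8) \<le> v"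
      by (rule eventually_compose_filterlim[OF speed_bound_of_small_deficit s_lim]) (use cpos in auto)
    ultimately have "\<forall>\<^sub>F n in sequentially. pulse_speed W V \<kappa> \<rho> (s n)
        \<ge> \<alpha> / 2 * s n powr (- 1) - c_const W \<rho> * s n powr (- 9 / 8) + 0"
    proof eventually_elim
      case (elim n)
      have q0: "real (q n) > 0" using pq(1)[of n] by simp
      have "sqrt (s n) = (real (q n))\<^sup>2" unfolding s_def
        by (rule real_sqrt_unique) (simp_all flip: power_mult)
      moreover have "s n powr (- (1 / 4)) = 1 / real (q n)"
      proof -
        have "s n = real (q n) powr 4" unfolding s_def using q0 by simp
        then have "s n powr (- (1 / 4)) = (real (q n) powr 4) powr (- (1 / 4))" by (simp only:)
        also have "\<dots> = real (q n) powr (- 1)" by (subst powr_powr) simp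
        finally show ?thesis using q0 by (simp add: powr_minus_divide)
      qed
      moreover have "\<alpha> - 3 / real (q n) - K * real (q n) / sqrt (s n) \<le> 2 * s n * pulse_speed W V \<kappa> \<rho> (s n)"
        using q0 by (intro T'[OF _ _ pq(2,3)] elim) simp
      ultimately have "\<alpha> - (3 + K) * s n powr (- (1 / 4)) \<le> 2 * s n * pulse_speed W V \<kappa> \<rho> (s n)"
        using q0 by (simp add: power2_eq_square add_divide_distrib)
      then show ?case using elim by simp
    qed
    then show "\<exists>s :: nat \<Rightarrow> real. filterlim s at_top sequentially \<and>
          (\<exists>r \<in> O(\<lambda>n. s n powr (- 5 / 4)). \<forall>\<^sub>F n in sequentially.
             pulse_speed W V \<kappa> \<rho> (s n)
               \<ge> \<alpha> / 2 * s n powr (- 1) - c_const W \<rho> * s n powr (- 9 / 8) + r n)"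
      using s_lim by (intro exI[of _ s] conjI bexI[of _ "\<lambda>_. 0"]) auto
  qed
  have part3: "\<exists>r \<in> O[at_top](\<lambda>\<tau>. \<tau> powr (- 5 / 4)). \<forall>\<^sub>F \<tau> in at_top.
             pulse_speed W V \<kappa> \<rho> \<tau>
               \<ge> \<alpha> / 2 * \<tau> powr (- 1)
                 - c_const W \<rho> * sqrt ((gamma_L + 1) / 2) * (1 + \<epsilon>) * \<tau> powr (- 9 / 8) + r \<tau>"
    if R: "not_too_well_approximable \<rho>" and H: "cond_H W V \<kappa> \<beta> \<alpha> \<rho>" and \<epsilon>: "\<epsilon> > 0" for \<rho> \<epsilon>
  proof -
    obtain T where T: "T > 0" "\<And>\<tau> q p. \<tau> \<ge> T \<Longrightarrow> q \<ge> 1 \<Longrightarrow> coprime p (int q) \<Longrightarrow>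
      \<alpha> - 1 / (2 * real q) - 2 * \<bar>real q * \<rho> - of_int p\<bar> - K * real q / sqrt \<tau>
        \<le> 2 * \<tau> * pulse_speed W V \<kappa> \<rho> \<tau>" using bound[OF H] by blast
    obtain c where c: "c > 0"
      and window: "\<And>N::nat. N \<ge> 1 \<Longrightarrow> \<exists>(p::int) (q::nat). q \<ge> 1 \<and> q \<le> N \<and> coprime p (int q) \<and>
        \<bar>real q * \<rho> - of_int p\<bar> < 1 / real N \<and> 1 / real q \<le> c / sqrt (real N)"
      using good_denominator_in_window[OF R] by metis
    define c' where "c' = c_const W \<rho> * sqrt ((gamma_L + 1) / 2) * (1 + \<epsilon>)"
    have "gamma_L > 0" unfolding gamma_L_def by simp
    then have c': "c' > 0" unfolding c'_def using cpos[of \<rho>] \<epsilon> by simp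
    define C where "C = c + 4 + K"
    have "\<forall>\<^sub>F \<tau> in at_top. \<forall>v. \<alpha> - C * \<tau> powr (- (5 / 32)) \<le> 2 * \<tau> * v \<longrightarrow>
        \<alpha> / 2 * \<tau> powr (- 1) - c' * \<tau> powr (- 9 / 8) \<le> v"
      by (rule speed_bound_of_small_deficit[OF c']) simp
    then have "\<forall>\<^sub>F \<tau> in at_top. pulse_speed W V \<kappa> \<rho> \<tau> \<ge> \<alpha> / 2 * \<tau> powr (- 1) - c' * \<tau> powr (- 9 / 8) + 0"
      using eventually_ge_at_top[of T] eventually_ge_at_top[of 1]
    proof eventually_elim
      case (elim \<tau>)
      \<comment> \<open>The window must satisfy \<open>1 / \<surd>y = o(\<tau> powr (-1/8))\<close> and \<open>y / \<surd>\<tau> = o(\<tau> powr (-1/8))\<close>: any exponent strictly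
          between \<open>1/4\<close> and \<open>3/8\<close> works.\<close>
      define y where "y = \<tau> powr (5 / 16)"
      have y1: "y \<ge> 1" unfolding y_def using elim by (simp add: ge_one_powr_ge_zero)
      define N where "N = nat \<lfloor>y\<rfloor>"
      have N: "N \<ge> 1" "real N \<le> y" "real N \<ge> y / 2"
      proof -
        have "real N = of_int \<lfloor>y\<rfloor>" "\<lfloor>y\<rfloor> \<ge> 1" unfolding N_def using y1 by simp_all
        then show "N \<ge> 1" "real N \<le> y" "real N \<ge> y / 2" by linarith+
      qed
      obtain p :: int and q :: nat where q: "q \<ge> 1" "q \<le> N" "coprime p (int q)"
        "\<bar>real q * \<rho> - of_int p\<bar> < 1 / real N" "1 / real q \<le> c / sqrt (real N)"
        using window[OF N(1)] by blast
      have powers: "1 / sqrt y = \<tau> powr (- (5 / 32))" "1 / y \<le> \<tau> powr (- (5 / 32))"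
        "y / sqrt \<tau> \<le> \<tau> powr (- (5 / 32))"
      proof -
        show "1 / sqrt y = \<tau> powr (- (5 / 32))"
          unfolding y_def using elim by (simp add: powr_half_sqrt[symmetric] powr_powr powr_minus_divide)
        have "1 / y = \<tau> powr (- (5 / 16))" unfolding y_def by (simp add: powr_minus_divide)
        also have "\<dots> \<le> \<tau> powr (- (5 / 32))" using elim by (intro powr_mono) auto
        finally show "1 / y \<le> \<tau> powr (- (5 / 32))" .
        have "y / sqrt \<tau> = \<tau> powr (5 / 16) / \<tau> powr (1 / 2)"
          unfolding y_def using elim by (simp add: powr_half_sqrt)
        also have "\<dots> = \<tau> powr (5 / 16 - 1 / 2)" by (rule powr_diff[symmetric])
        also have "\<dots> \<le> \<tau> powr (- (5 / 32))" using elim by (intro powr_mono) auto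
        finally show "y / sqrt \<tau> \<le> \<tau> powr (- (5 / 32))" .
      qed
      have "1 / (2 * real q) \<le> c * \<tau> powr (- (5 / 32))"
      proof -
        have "sqrt y \<le> sqrt (4 * real N)" using N by (intro real_sqrt_le_mono) auto
        then have "sqrt y \<le> 2 * sqrt (real N)" by (simp add: real_sqrt_mult)
        then have "1 / (2 * sqrt (real N)) \<le> 1 / sqrt y"
          using y1 N(1) by (intro divide_left_mono mult_pos_pos) auto
        then have "c * (1 / (2 * sqrt (real N))) \<le> c * (1 / sqrt y)" using c by (intro mult_left_mono) auto
        then show ?thesis using q(5) unfolding powers(1) by simp
      qed
      moreover have "2 * \<bar>real q * \<rho> - of_int p\<bar> \<le> 4 * \<tau> powr (- (5 / 32))"
      proof -
        have "1 / real N \<le> 1 / (y / 2)" using N y1 by (intro divide_left_mono) auto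
        then show ?thesis using q(4) powers(2) by simp
      qed
      moreover have "K * real q / sqrt \<tau> \<le> K * \<tau> powr (- (5 / 32))"
      proof -
        have "real q / sqrt \<tau> \<le> y / sqrt \<tau>" using q N elim by (intro divide_right_mono) auto
        then have "real q / sqrt \<tau> \<le> \<tau> powr (- (5 / 32))" using powers(3) by linarith
        then show ?thesis using K mult_left_mono[of "real q / sqrt \<tau>" _ K] by simp
      qed
      ultimately have "\<alpha> - C * \<tau> powr (- (5 / 32)) \<le> 2 * \<tau> * pulse_speed W V \<kappa> \<rho> \<tau>"
        using T(2)[OF elim(2) q(1,3)] unfolding C_def distrib_right by linarith
      then show ?case using elim by simp
    qed
    then show ?thesis unfolding c'_def by (intro bexI[of _ "\<lambda>_. 0"]) auto
  qed
  have "negligible (- {\<rho>. not_too_well_approximable \<rho>})"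
    using negligible_well_approximable by (simp add: Collect_neg_eq)
  then have null: "- {\<rho>. not_too_well_approximable \<rho>} \<in> null_sets lebesgue"
    by (simp add: negligible_iff_null_sets)
  then have "space lebesgue - (- {\<rho>. not_too_well_approximable \<rho>}) \<in> sets lebesgue"
    by (intro sets.compl_sets null_setsD2)
  then have meas: "{\<rho>. not_too_well_approximable \<rho>} \<in> sets lebesgue" by (simp add: Diff_eq)
  show ?thesis
  proof (intro conjI)
    show "\<forall>(p\<^sub>0::int) (q\<^sub>0::int) (\<rho>::real).
        \<rho> = of_int p\<^sub>0 / of_int q\<^sub>0 \<longrightarrow> coprime p\<^sub>0 q\<^sub>0 \<longrightarrow> q\<^sub>0 \<ge> 2 \<longrightarrow> cond_H W V \<kappa> \<beta> \<alpha> \<rho> \<longrightarrow>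
        \<alpha> > 1 / sqrt (of_int q\<^sub>0) - 1 / (2 * of_int q\<^sub>0) \<longrightarrow>
        (\<exists>\<tau>\<^sub>0. \<forall>\<tau>>\<tau>\<^sub>0. pulse_speed W V \<kappa> \<rho> \<tau> > 0) \<and>
        Liminf at_top (\<lambda>\<tau>. ereal (2 * pulse_speed W V \<kappa> \<rho> \<tau> * \<tau> /
            (\<alpha> - 1 / sqrt (of_int q\<^sub>0) + 1 / (2 * of_int q\<^sub>0)))) \<ge> 1"
      by (intro allI impI) (rule part1)
  next
    show "\<forall>\<rho>. \<rho> \<notin> \<rat> \<longrightarrow> cond_H W V \<kappa> \<beta> \<alpha> \<rho> \<longrightarrow>
        (\<forall>\<^sub>F \<tau> in at_top. pulse_speed W V \<kappa> \<rho> \<tau> > 0) \<and>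
        (\<exists>s :: nat \<Rightarrow> real. filterlim s at_top sequentially \<and>
          (\<exists>r \<in> O(\<lambda>n. s n powr (- 5 / 4)). \<forall>\<^sub>F n in sequentially.
             pulse_speed W V \<kappa> \<rho> (s n)
               \<ge> \<alpha> / 2 * s n powr (- 1) - c_const W \<rho> * s n powr (- 9 / 8) + r n))"
      by (intro allI impI) (rule part2)
  next
    show "\<exists>R :: real set. R \<in> sets lebesgue \<and> - R \<in> null_sets lebesgue \<and>
        (\<forall>\<rho>\<in>R. cond_H W V \<kappa> \<beta> \<alpha> \<rho> \<longrightarrow>
          (\<forall>\<epsilon>>0. \<exists>r \<in> O[at_top](\<lambda>\<tau>. \<tau> powr (- 5 / 4)). \<forall>\<^sub>F \<tau> in at_top.
             pulse_speed W V \<kappa> \<rho> \<tau>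
               \<ge> \<alpha> / 2 * \<tau> powr (- 1)
                 - c_const W \<rho> * sqrt ((gamma_L + 1) / 2) * (1 + \<epsilon>) * \<tau> powr (- 9 / 8) + r \<tau>))"
    proof (intro exI[of _ "{\<rho>. not_too_well_approximable \<rho>}"] conjI ballI impI allI meas null)
      fix \<rho> \<epsilon> :: real
      assume "\<rho> \<in> {\<rho>. not_too_well_approximable \<rho>}" "cond_H W V \<kappa> \<beta> \<alpha> \<rho>" "\<epsilon> > 0"
      then show "\<exists>r \<in> O[at_top](\<lambda>\<tau>. \<tau> powr (- 5 / 4)). \<forall>\<^sub>F \<tau> in at_top.
             pulse_speed W V \<kappa> \<rho> \<tau>
               \<ge> \<alpha> / 2 * \<tau> powr (- 1)
                 - c_const W \<rho> * sqrt ((gamma_L + 1) / 2) * (1 + \<epsilon>) * \<tau> powr (- 9 / 8) + r \<tau>"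
        by (intro part3) simp_all
    qed
  qed
qed

end
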